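(* Let $d\ge2$, $r>0$, and let $\Omega\subset\mathbb{R}^d$ be a bounded domain admitting a bounded Sobolev-extension operator. Let $\sigma$ be analytic in a bounded open complex domain $\Omega_\sigma\subset\mathbb{C}$, real-valued on $\Omega_\sigma\cap\mathbb{R}$, and suppose there exist $c_\sigma>0$, $\rho_\sigma>0$ with $$\frac{1}{k!}|\sigma^{(k)}(0)|\ge c_\sigma\rho_\sigma^{-k},\qquad \forall k\in\mathbb{N}=\{0,1,2,\dots\}.$$ Let $I\subset\mathbb{R}$ be a bounded open interval with $\theta\cdot x\in I$ for all $\theta\in\mathbb{S}^{d-1}$ and $x\in\overline\Omega$, and let $I'\subset\mathbb{R}$ be a bounded interval such that $$0\in I',\qquad \{\omega t:\ \omega\in I',\ t\in I\}\Subset\Omega_\sigma.$$ Then for any quasi-uniform sets $\Omega_m=\{\theta_i^{(m)}\}_{i=1}^{N_m}\subset\mathbb{S}^{d-1}$ with $N_m=|\Omega_m|\simeq m^{d-1}$ and any quasi-Chebyshev sets $\{\omega_j^{(m)}\}_{j=1}^m\subset I'$ ($m\ge1$), setting $n=m^d$, $$\inf_{\{a_{ij}\}\in\mathbb{R}^{N_m\times m}}\Big\|f-\sum_{i=1}^{N_m}\sum_{j=1}^m a_{ij}\,\sigma\big(\omega_j^{(m)}\theta_i^{(m)}\cdot x\big)\Big\|_{L^2(\Omega)}\le K\,n^{-\frac rd}\|f\|_{H^r(\Omega)},\qquad f\in H^r(\Omega),$$ where the constant $K>0$ is independent of $m$ and $f$.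
   Context: Intervals are nondegenerate; $H^s$ is the $L^2$-based Sobolev space of real order $s\ge0$. $A\Subset B$ means that the closure of $A$ is compact and contained in the interior of $B$. A bounded Sobolev-extension operator for $\Omega$ is a linear operator $E$ with $Ef|_\Omega=f$ that is bounded from $H^t(\Omega)$ to $H^t(\mathbb{R}^d)$ for every $t\ge0$. $N_m\simeq m^{d-1}$ means two-sided bounds with positive constants independent of $m$. All point sets are families indexed by $m$. A family $\{\theta_j^{(m)}\}_{j}\subset[a,b]$ is quasi-uniform if there is a constant $c$ independent of $m$ with $\max_{\theta\in[a,b]}\min_j|\theta-\theta_j^{(m)}|\le c\min_{i\ne j}|\theta_i^{(m)}-\theta_j^{(m)}|$ for all $m$ (a minimum over the empty set is $+\infty$). A family on the sphere $\mathbb{S}^{d-1}$ is quasi-uniform if the same inequality holds with $[a,b]$ replaced by $\mathbb{S}^{d-1}$ and $|\cdot-\cdot|$ replaced by the geodesic distance. A family $\{x_j^{(m)}\}_j$ in a bounded interval with endpoints $a<b$ is quasi-Chebyshev if there is a quasi-uniform family $\{\theta_j^{(m)}\}_j$ on $[0,\pi]$ with $x_j^{(m)}=\frac{a+b}{2}+\frac{b-a}{2}\cos\theta_j^{(m)}$. *)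

theory Defs
  imports "HOL-Analysis.Analysis" "HOL-Complex_Analysis.Complex_Analysis"
begin

text \<open>Elements of function spaces on \<open>\<Omega>\<close> are represented by total functions; only their values
  almost everywhere on \<open>\<Omega>\<close> matter.\<close>

definition L2_space :: "(real^'n) set \<Rightarrow> (real^'n \<Rightarrow> real) set" where
  "L2_space \<Omega> = {f. f \<in> borel_measurable (lebesgue_on \<Omega>) \<and>
     integrable (lebesgue_on \<Omega>) (\<lambda>x. (f x)\<^sup>2)}"

definition norm_L2 :: "(real^'n) set \<Rightarrow> (real^'n \<Rightarrow> real) \<Rightarrow> real" where
  "norm_L2 \<Omega> f = sqrt (LINT x|lebesgue_on \<Omega>. (f x)\<^sup>2)"

definition partial_deriv :: "'n \<Rightarrow> (real^'n \<Rightarrow> real) \<Rightarrow> real^'n \<Rightarrow> real" where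
  "partial_deriv i f x = frechet_derivative f (at x) (axis i 1)"

text \<open>Derivatives of higher order are indexed by lists of coordinate directions, the order being
  the length of the list.\<close>

definition partial_derivs :: "'n list \<Rightarrow> (real^'n \<Rightarrow> real) \<Rightarrow> real^'n \<Rightarrow> real" where
  "partial_derivs ds = foldr partial_deriv ds"

definition smooth :: "(real^'n \<Rightarrow> real) \<Rightarrow> bool" where
  "smooth f \<longleftrightarrow> (\<forall>ds x. partial_derivs ds f differentiable at x)"

definition test_functions :: "(real^'n) set \<Rightarrow> (real^'n \<Rightarrow> real) set" where
  "test_functions \<Omega> = {\<phi>. smooth \<phi> \<and> compact (closure {x. \<phi> x \<noteq> 0}) \<and> closure {x. \<phi> x \<noteq> 0} \<subseteq> \<Omega>}"

definition has_weak_deriv ::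
    "(real^'n) set \<Rightarrow> 'n list \<Rightarrow> (real^'n \<Rightarrow> real) \<Rightarrow> (real^'n \<Rightarrow> real) \<Rightarrow> bool" where
  "has_weak_deriv \<Omega> ds f g \<longleftrightarrow> f \<in> L2_space \<Omega> \<and> g \<in> L2_space \<Omega> \<and>
     (\<forall>\<phi>\<in>test_functions \<Omega>.
        (LINT x|lebesgue_on \<Omega>. f x * partial_derivs ds \<phi> x) =
        (-1) ^ length ds * (LINT x|lebesgue_on \<Omega>. g x * \<phi> x))"

text \<open>For open \<open>\<Omega>\<close> the weak derivative is unique up to null sets, so the choice is immaterial.\<close>

definition weak_deriv :: "(real^'n) set \<Rightarrow> 'n list \<Rightarrow> (real^'n \<Rightarrow> real) \<Rightarrow> real^'n \<Rightarrow> real" where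
  "weak_deriv \<Omega> ds f = (SOME g. has_weak_deriv \<Omega> ds f g)"

text \<open>The squared Gagliardo (Slobodeckij) seminorm of order \<open>0 < \<theta> < 1\<close>. The value of the integrand
  on the diagonal is \<open>0\<close>, which is irrelevant.\<close>

definition gagliardo_sq :: "real \<Rightarrow> (real^'n) set \<Rightarrow> (real^'n \<Rightarrow> real) \<Rightarrow> ennreal" where
  "gagliardo_sq \<theta> \<Omega> g = (\<integral>\<^sup>+ x. \<integral>\<^sup>+ y.
      ennreal ((g x - g y)\<^sup>2 / norm (x - y) powr (real CARD('n) + 2 * \<theta>))
      \<partial>lebesgue_on \<Omega> \<partial>lebesgue_on \<Omega>)"

text \<open>The Sobolev space \<open>H\<^sup>s(\<Omega>)\<close> for real \<open>s \<ge> 0\<close>, with integer part \<open>nat \<lfloor>s\<rfloor>\<close> and fractional part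
  \<open>frac s\<close>. Since lists of directions are used instead of multi-indices, mixed derivatives
  enter the norm with their multinomial multiplicities, i.e. through the Frobenius norms of the
  tensors of derivatives of each order.\<close>

definition sobolev_space :: "real \<Rightarrow> (real^'n) set \<Rightarrow> (real^'n \<Rightarrow> real) set" where
  "sobolev_space s \<Omega> = {f \<in> L2_space \<Omega>.
     (\<forall>ds. length ds \<le> nat \<lfloor>s\<rfloor> \<longrightarrow> (\<exists>g. has_weak_deriv \<Omega> ds f g)) \<and>
     (frac s > 0 \<longrightarrow> (\<forall>ds. length ds = nat \<lfloor>s\<rfloor> \<longrightarrow>
        gagliardo_sq (frac s) \<Omega> (weak_deriv \<Omega> ds f) < \<infinity>))}"

definition sobolev_norm :: "real \<Rightarrow> (real^'n) set \<Rightarrow> (real^'n \<Rightarrow> real) \<Rightarrow> real" where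
  "sobolev_norm s \<Omega> f = sqrt (
     (\<Sum>ds | length ds \<le> nat \<lfloor>s\<rfloor>. (norm_L2 \<Omega> (weak_deriv \<Omega> ds f))\<^sup>2) +
     (if frac s > 0
      then \<Sum>ds | length ds = nat \<lfloor>s\<rfloor>. enn2real (gagliardo_sq (frac s) \<Omega> (weak_deriv \<Omega> ds f))
      else 0))"

text \<open>One operator, defined on \<open>L\<^sup>2(\<Omega>) = H\<^sup>0(\<Omega>)\<close>, that serves all orders \<open>t \<ge> 0\<close> simultaneously.
  Linearity is that of equivalence classes; together with boundedness it makes \<open>E\<close> respect
  equality almost everywhere on \<open>\<Omega>\<close>.\<close>

definition sobolev_extension_operator ::
    "(real^'n) set \<Rightarrow> ((real^'n \<Rightarrow> real) \<Rightarrow> (real^'n \<Rightarrow> real)) \<Rightarrow> bool" where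
  "sobolev_extension_operator \<Omega> E \<longleftrightarrow>
     (\<forall>f\<in>L2_space \<Omega>. \<forall>g\<in>L2_space \<Omega>. \<forall>\<alpha> \<beta>.
        AE x in lebesgue. E (\<lambda>y. \<alpha> * f y + \<beta> * g y) x = \<alpha> * E f x + \<beta> * E g x) \<and>
     (\<forall>f\<in>L2_space \<Omega>. AE x in lebesgue_on \<Omega>. E f x = f x) \<and>
     (\<forall>t\<ge>0. \<exists>C. \<forall>f\<in>sobolev_space t \<Omega>. E f \<in> sobolev_space t UNIV \<and>
        sobolev_norm t UNIV (E f) \<le> C * sobolev_norm t \<Omega> f)"

definition compactly_contained :: "'a::topological_space set \<Rightarrow> 'a set \<Rightarrow> bool" where
  "compactly_contained A B \<longleftrightarrow> compact (closure A) \<and> closure A \<subseteq> interior B"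

text \<open>The family consists of the points \<open>p m 1, \<dots>, p m (N m)\<close> for \<open>m \<ge> 1\<close>, and \<open>\<delta>\<close> is the distance
  on \<open>S\<close>. In \<open>ereal\<close> the infimum over the empty set is \<open>\<infinity>\<close>, and \<open>c > 0\<close> gives \<open>c * \<infinity> = \<infinity>\<close>.\<close>

definition quasi_uniform ::
    "'a set \<Rightarrow> ('a \<Rightarrow> 'a \<Rightarrow> real) \<Rightarrow> (nat \<Rightarrow> nat) \<Rightarrow> (nat \<Rightarrow> nat \<Rightarrow> 'a) \<Rightarrow> bool" where
  "quasi_uniform S \<delta> N p \<longleftrightarrow>
     (\<forall>m\<ge>1. \<forall>j\<in>{1..N m}. p m j \<in> S) \<and>
     (\<exists>c>0. \<forall>m\<ge>1.
        (SUP x\<in>S. INF j\<in>{1..N m}. ereal (\<delta> x (p m j)))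
        \<le> ereal c * (INF (i, j)\<in>{(i, j). i \<in> {1..N m} \<and> j \<in> {1..N m} \<and> i \<noteq> j}.
                       ereal (\<delta> (p m i) (p m j))))"

text \<open>Geodesic distance on the unit sphere.\<close>

definition sphere_dist :: "real^'n \<Rightarrow> real^'n \<Rightarrow> real" where
  "sphere_dist x y = arccos (x \<bullet> y)"

text \<open>\<open>J\<close> is a bounded interval, possibly without its endpoints \<open>Inf J\<close> and \<open>Sup J\<close>.\<close>

definition quasi_chebyshev :: "real set \<Rightarrow> (nat \<Rightarrow> nat) \<Rightarrow> (nat \<Rightarrow> nat \<Rightarrow> real) \<Rightarrow> bool" where
  "quasi_chebyshev J N x \<longleftrightarrow>
     (\<forall>m\<ge>1. \<forall>j\<in>{1..N m}. x m j \<in> J) \<and>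
     (\<exists>\<theta>. quasi_uniform {0..pi} dist N \<theta> \<and>
        (\<forall>m\<ge>1. \<forall>j\<in>{1..N m}.
           x m j = (Inf J + Sup J) / 2 + (Sup J - Inf J) / 2 * cos (\<theta> m j)))"

end

theory Submission
  imports Defs
begin

text \<open>The proof is by duality. Let \<open>g\<close> be the residual of the projection of \<open>f\<close> in \<open>L\<^sup>2(\<Omega>)\<close> onto the span of
the neurons, extended by zero. Then \<open>\<parallel>g\<parallel>\<^sup>2 = \<langle>f, g\<rangle>\<close> and \<open>g\<close> is orthogonal to every neuron. Orthogonality
makes the Fourier transform of \<open>g\<close> exponentially small in \<open>m\<close> on a ball of radius proportional to
\<open>m\<close>. Hence \<open>g\<close> is paired only with the high frequencies of \<open>f\<close>, and those have size
\<open>O(m\<^sup>-\<^sup>r)\<close> because \<open>f\<close> is in \<open>H\<^sup>r\<close>. Factors that are exponential in a small multiple of \<open>m\<close> are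
harmless throughout, which is why rather crude estimates suffice.

Smallness of the Fourier transform: for a fixed direction \<open>\<theta>\<^sub>i\<close> the function
\<open>w \<mapsto> \<integral> g(x) \<sigma>(w \<theta>\<^sub>i \<bullet> x) dx\<close> is bounded and holomorphic near \<open>I'\<close> and vanishes at the \<open>m\<close> distinct
points \<open>\<omega>\<^sub>j\<close>. A bounded holomorphic function is dominated by the Blaschke product of its zeros, taken
in a conformal coordinate, so this function is at most of size \<open>q\<^sup>m\<close> with \<open>q < 1\<close> near \<open>0\<close>, wherever
in \<open>I'\<close> the zeros lie (\<open>bounded_holomorphic_many_zeros\<close>). Its Taylor coefficients at \<open>0\<close> are those
of \<open>\<sigma>\<close> times the ridge moments \<open>\<integral> g(x) (\<theta>\<^sub>i \<bullet> x)\<^sup>l dx\<close>; the lower bound on the former makes the latter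
at most \<open>C B\<^sup>l q\<^sup>m\<close> (\<open>moments_of_orthogonal_function\<close>). As a function of the direction, a ridge moment of
order \<open>l\<close> is a homogeneous polynomial of degree \<open>l\<close>, so by Bernstein's inequality on great circles
a net of mesh size \<open>h\<close> controls it on the whole sphere as long as \<open>l h\<close> is small
(\<open>ridge_moment_le_on_net\<close>). Comparing volumes shows that the directions form a net of mesh size
\<open>O(1/m)\<close> (\<open>quasi_uniform_sphere_mesh\<close>), so orders up to a small multiple of \<open>m\<close> are admissible, and
the Taylor series of \<open>exp(\<i> \<xi> \<bullet> x)\<close> gives \<open>fourier_transform_exponentially_small\<close>.

Pairing with a Sobolev function: the extension operator replaces \<open>f\<close> by a function \<open>F\<close> on the whole
space. With \<open>n = \<lfloor>r\<rfloor>\<close>, the function \<open>\<plusminus>F\<close> is its forward difference of order \<open>n + 1\<close> with step \<open>h\<close> minus a linear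
combination of the translates \<open>F(x + j h)\<close>, \<open>1 \<le> j \<le> n + 1\<close>. This identity is paired with \<open>g\<close> and
averaged over \<open>h\<close> against a nonnegative kernel that lives at scale \<open>1/a\<close> with \<open>a\<close> proportional to
\<open>m\<close>. The difference contributes \<open>O(a\<^sup>-\<^sup>r)\<close>, by the weak derivatives of order \<open>n\<close> and the Gagliardo
seminorm. Each translate contributes the pairing of \<open>F\<close> with a convolution of \<open>g\<close> and the kernel. The
kernel is band-limited to frequencies where the Fourier transform of \<open>g\<close> is tiny, so the convolution
is uniformly tiny, and it is bounded in \<open>L\<^sup>1\<close>, hence it is tiny in \<open>L\<^sup>2\<close>
(\<open>sobolev_pairing_le\<close>). For the finitely many \<open>m\<close> below a threshold the zero network suffices.\<close>

section \<open>Square integrable functions and parameter integrals\<close>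

text \<open>Functions are not identified when they agree almost everywhere, so \<open>L\<^sup>2(M)\<close> is treated as a
space with a seminorm.\<close>

definition square_integrable :: "'a measure \<Rightarrow> ('a \<Rightarrow> real) \<Rightarrow> bool" where
  "square_integrable M f \<longleftrightarrow> f \<in> borel_measurable M \<and> integrable M (\<lambda>x. (f x)\<^sup>2)"

definition l2_norm :: "'a measure \<Rightarrow> ('a \<Rightarrow> real) \<Rightarrow> real" where
  "l2_norm M f = sqrt (LINT x|M. (f x)\<^sup>2)"

lemma square_integrable_integrable_power2: "square_integrable M f \<Longrightarrow> integrable M (\<lambda>x. (f x)\<^sup>2)"
  by (simp add: square_integrable_def)

lemma square_integrableI_bound:
  assumes "f \<in> borel_measurable M" "integrable M b" "\<And>x. x \<in> space M \<Longrightarrow> (f x)\<^sup>2 \<le> b x"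
  shows "square_integrable M f"
proof -
  have "integrable M (\<lambda>x. (f x)\<^sup>2)"
  proof (rule Bochner_Integration.integrable_bound[OF assms(2)])
    show "AE x in M. norm ((f x)\<^sup>2) \<le> norm (b x)"
      using assms(3) by (intro AE_I2) (auto intro: order_trans[OF _ abs_ge_self])
  qed (use assms(1) in auto)
  thus ?thesis using assms(1) by (simp add: square_integrable_def)
qed

lemma l2_norm_nonneg [simp]: "l2_norm M f \<ge> 0"
  by (simp add: l2_norm_def)

lemma l2_norm_power2: "(l2_norm M f)\<^sup>2 = (LINT x|M. (f x)\<^sup>2)"
  by (simp add: l2_norm_def)

lemma square_integrable_mult_integrable:
  assumes "square_integrable M f" "square_integrable M g"
  shows "integrable M (\<lambda>x. f x * g x)"
proof (rule Bochner_Integration.integrable_bound)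
  show "integrable M (\<lambda>x. (f x)\<^sup>2 + (g x)\<^sup>2)"
    using assms by (auto simp: square_integrable_def)
  show "(\<lambda>x. f x * g x) \<in> borel_measurable M"
    using assms by (auto simp: square_integrable_def)
  show "AE x in M. norm (f x * g x) \<le> norm ((f x)\<^sup>2 + (g x)\<^sup>2)"
  proof (rule AE_I2)
    fix x
    have "2 * \<bar>f x\<bar> * \<bar>g x\<bar> \<le> \<bar>f x\<bar>\<^sup>2 + \<bar>g x\<bar>\<^sup>2"
      by (rule sum_squares_bound)
    moreover have "0 \<le> \<bar>f x\<bar> * \<bar>g x\<bar>"
      by simp
    ultimately have "\<bar>f x\<bar> * \<bar>g x\<bar> \<le> (f x)\<^sup>2 + (g x)\<^sup>2"
      unfolding power2_abs by linarith
    thus "norm (f x * g x) \<le> norm ((f x)\<^sup>2 + (g x)\<^sup>2)"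
      by (simp add: abs_mult)
  qed
qed

lemma square_integrable_cmult:
  "square_integrable M f \<Longrightarrow> square_integrable M (\<lambda>x. c * f x)"
  by (auto simp: square_integrable_def power_mult_distrib)

lemma square_integrable_add:
  assumes "square_integrable M f" "square_integrable M g"
  shows "square_integrable M (\<lambda>x. f x + g x)"
proof -
  have "integrable M (\<lambda>x. (f x)\<^sup>2 + (g x)\<^sup>2 + 2 * (f x * g x))"
    using assms square_integrable_mult_integrable[OF assms] by (simp add: square_integrable_def)
  moreover have "(\<lambda>x. (f x)\<^sup>2 + (g x)\<^sup>2 + 2 * (f x * g x)) = (\<lambda>x. (f x + g x)\<^sup>2)"
    by (simp add: power2_sum mult.assoc)
  ultimately show ?thesis
    using assms by (auto simp: square_integrable_def)
qed

lemma square_integrable_diff: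
  assumes "square_integrable M f" "square_integrable M g"
  shows "square_integrable M (\<lambda>x. f x - g x)"
  using square_integrable_add[OF assms(1) square_integrable_cmult[OF assms(2), of "-1"]] by simp

lemma square_integrable_sum:
  assumes "\<And>a. a \<in> A \<Longrightarrow> square_integrable M (u a)"
  shows "square_integrable M (\<lambda>x. \<Sum>a\<in>A. u a x)"
  using assms
proof (induction A rule: infinite_finite_induct)
  case (insert a A)
  thus ?case by (simp add: square_integrable_add)
qed (auto simp: square_integrable_def)

lemma l2_norm_cmult: "l2_norm M (\<lambda>x. c * f x) = \<bar>c\<bar> * l2_norm M f"
  by (simp add: l2_norm_def power_mult_distrib real_sqrt_mult)

lemma l2_Cauchy_Schwarz:
  assumes f: "square_integrable M f" and g: "square_integrable M g"
  shows "\<bar>LINT x|M. f x * g x\<bar> \<le> l2_norm M f * l2_norm M g"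
proof -
  define a b c where "a = (LINT x|M. (f x)\<^sup>2)" and "b = (LINT x|M. f x * g x)"
    and "c = (LINT x|M. (g x)\<^sup>2)"
  have nonneg: "0 \<le> a + 2 * t * b + t\<^sup>2 * c" for t
  proof -
    have "0 \<le> (LINT x|M. (f x + t * g x)\<^sup>2)"
      by simp
    also have "(LINT x|M. (f x + t * g x)\<^sup>2)
        = (LINT x|M. (f x)\<^sup>2 + (2 * t * (f x * g x) + t\<^sup>2 * (g x)\<^sup>2))"
      by (rule Bochner_Integration.integral_cong) (auto simp: algebra_simps power2_eq_square)
    also have "\<dots> = a + (2 * t * b + t\<^sup>2 * c)"
      using f g square_integrable_mult_integrable[OF f g]
      by (simp add: square_integrable_def a_def b_def c_def)
    finally show ?thesis by (simp add: add.assoc)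
  qed
  have ac: "a \<ge> 0" "c \<ge> 0" by (simp_all add: a_def c_def)
  have "b\<^sup>2 \<le> a * c"
  proof (cases "c = 0")
    case True
    show ?thesis
    proof (cases "b = 0")
      case False
      have "0 \<le> a + 2 * (-(a + 1) / (2 * b)) * b"
        using nonneg[of "-(a + 1) / (2 * b)"] True by simp
      also have "\<dots> = -1" using False by (simp add: field_simps)
      finally show ?thesis by simp
    qed (use True in simp)
  next
    case False
    hence "c > 0" using ac by simp
    have "0 \<le> a + 2 * (- b / c) * b + (- b / c)\<^sup>2 * c" by (rule nonneg)
    also have "\<dots> = a - b\<^sup>2 / c"
      using \<open>c > 0\<close> by (simp add: field_simps power2_eq_square)
    finally show ?thesis using \<open>c > 0\<close> by (simp add: field_simps)
  qed
  hence "sqrt (b\<^sup>2) \<le> sqrt (a * c)" by (rule real_sqrt_le_mono)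
  thus ?thesis by (simp add: l2_norm_def a_def b_def c_def real_sqrt_mult)
qed

lemma l2_norm_triangle:
  assumes f: "square_integrable M f" and g: "square_integrable M g"
  shows "l2_norm M (\<lambda>x. f x + g x) \<le> l2_norm M f + l2_norm M g"
proof (rule power2_le_imp_le)
  have "(LINT x|M. (f x + g x)\<^sup>2) = (LINT x|M. (f x)\<^sup>2 + (2 * (f x * g x) + (g x)\<^sup>2))"
    by (rule Bochner_Integration.integral_cong) (auto simp: algebra_simps power2_eq_square)
  also have "\<dots> = (LINT x|M. (f x)\<^sup>2) + (2 * (LINT x|M. f x * g x) + (LINT x|M. (g x)\<^sup>2))"
    using f g square_integrable_mult_integrable[OF f g] by (simp add: square_integrable_def)
  finally show "(l2_norm M (\<lambda>x. f x + g x))\<^sup>2 \<le> (l2_norm M f + l2_norm M g)\<^sup>2"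
    using l2_Cauchy_Schwarz[OF f g] by (simp add: l2_norm_power2 power2_sum)
qed simp

lemma l2_norm_diff_triangle:
  assumes f: "square_integrable M f" and g: "square_integrable M g"
  shows "l2_norm M (\<lambda>x. f x - g x) \<le> l2_norm M f + l2_norm M g"
  using l2_norm_triangle[OF f square_integrable_cmult[OF g, of "-1"]] l2_norm_cmult[of M "-1" g] by simp

text \<open>Gram-Schmidt by induction on the family: if \<open>p\<close> and \<open>q\<close> are the residuals of \<open>f\<close> and of the new
member with respect to the old family, then \<open>p - t q\<close> is the new residual of \<open>f\<close> for a suitable \<open>t\<close>.\<close>

lemma l2_projection:
  assumes "finite A" "\<And>a. a \<in> A \<Longrightarrow> square_integrable M (u a)" "square_integrable M f"
  shows "\<exists>c. \<forall>b\<in>A. (LINT x|M. (f x - (\<Sum>a\<in>A. c a * u a x)) * u b x) = 0"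
  using assms
proof (induction A arbitrary: f rule: finite_induct)
  case (insert a A)
  have sq: "square_integrable M (\<lambda>x. \<Sum>b\<in>A. c b * u b x)" for c
    using insert.prems by (intro square_integrable_sum square_integrable_cmult) auto
  obtain c where c: "\<And>b. b \<in> A \<Longrightarrow> (LINT x|M. (f x - (\<Sum>a\<in>A. c a * u a x)) * u b x) = 0"
    using insert.IH[OF _ insert.prems(2)] insert.prems by auto
  obtain c' where c': "\<And>b. b \<in> A \<Longrightarrow> (LINT x|M. (u a x - (\<Sum>a\<in>A. c' a * u a x)) * u b x) = 0"
    using insert.IH[of "u a"] insert.prems by auto
  define p where "p = (\<lambda>x. f x - (\<Sum>b\<in>A. c b * u b x))"
  define q where "q = (\<lambda>x. u a x - (\<Sum>b\<in>A. c' b * u b x))"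
  have p: "square_integrable M p" and q: "square_integrable M q"
    unfolding p_def q_def using insert.prems sq by (auto intro!: square_integrable_diff)
  have ub: "square_integrable M (u b)" if "b \<in> insert a A" for b
    using insert.prems that by auto
  have q_span: "(LINT x|M. q x * (\<Sum>b\<in>A. e b * u b x)) = 0" for e
  proof -
    have "(LINT x|M. q x * (\<Sum>b\<in>A. e b * u b x)) = (LINT x|M. (\<Sum>b\<in>A. e b * (q x * u b x)))"
      by (simp add: sum_distrib_left mult.left_commute)
    also have "\<dots> = (\<Sum>b\<in>A. LINT x|M. e b * (q x * u b x))"
      by (rule Bochner_Integration.integral_sum)
        (auto intro!: integrable_mult_right square_integrable_mult_integrable q ub)
    also have "\<dots> = 0"
      using c' by (auto simp: q_def)
    finally show ?thesis .
  qed
  define t where "t = (LINT x|M. p x * q x) / (LINT x|M. (q x)\<^sup>2)"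
  have tq: "(LINT x|M. p x * q x) = t * (LINT x|M. (q x)\<^sup>2)"
  proof (cases "(LINT x|M. (q x)\<^sup>2) = 0")
    case True
    \<comment> \<open>Here \<open>u a\<close> lies in the span of the other functions, up to norm zero.\<close>
    hence "l2_norm M q = 0" by (simp add: l2_norm_def)
    thus ?thesis using l2_Cauchy_Schwarz[OF p q] True by simp
  qed (simp add: t_def)
  have pq: "(LINT x|M. (p x - t * q x) * u b x) = 0" if "b \<in> insert a A" for b
  proof -
    have *: "(LINT x|M. (p x - t * q x) * u b x) = (LINT x|M. p x * u b x) - t * (LINT x|M. q x * u b x)"
      using square_integrable_mult_integrable[OF p ub[OF that]]
        square_integrable_mult_integrable[OF q ub[OF that]]
      by (simp add: left_diff_distrib mult.assoc)
    show ?thesis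
    proof (cases "b \<in> A")
      case True
      thus ?thesis using * c c' by (simp add: p_def q_def)
    next
      case False
      hence b: "b = a" using that by simp
      have split: "(LINT x|M. h x * u a x) = (LINT x|M. h x * q x) + (LINT x|M. h x * (\<Sum>b\<in>A. c' b * u b x))"
        if "square_integrable M h" for h
      proof -
        have "(LINT x|M. h x * u a x) = (LINT x|M. h x * q x + h x * (\<Sum>b\<in>A. c' b * u b x))"
          by (simp add: q_def algebra_simps)
        thus ?thesis
          using square_integrable_mult_integrable[OF that q] square_integrable_mult_integrable[OF that sq[of c']]
          by simp
      qed
      have p_span: "(LINT x|M. p x * (\<Sum>b\<in>A. c' b * u b x)) = 0"
      proof -
        have "(LINT x|M. p x * (\<Sum>b\<in>A. c' b * u b x)) = (LINT x|M. (\<Sum>b\<in>A. c' b * (p x * u b x)))"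
          by (simp add: sum_distrib_left mult.left_commute)
        also have "\<dots> = (\<Sum>b\<in>A. LINT x|M. c' b * (p x * u b x))"
          by (rule Bochner_Integration.integral_sum)
            (auto intro!: integrable_mult_right square_integrable_mult_integrable p ub)
        also have "\<dots> = 0"
          using c by (auto simp: p_def)
        finally show ?thesis .
      qed
      show ?thesis
        unfolding * unfolding b
        using split[OF p] split[OF q] p_span q_span[of c'] tq by (simp add: power2_eq_square)
    qed
  qed
  define d where "d = (\<lambda>b. if b = a then t else c b - t * c' b)"
  have "(\<Sum>b\<in>insert a A. d b * u b x) = t * u a x + (\<Sum>b\<in>A. (c b - t * c' b) * u b x)" for x
  proof -
    have "(\<Sum>b\<in>A. d b * u b x) = (\<Sum>b\<in>A. (c b - t * c' b) * u b x)"
      using insert.hyps by (intro sum.cong) (auto simp: d_def)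
    thus ?thesis using insert.hyps by (simp add: d_def)
  qed
  hence "f x - (\<Sum>b\<in>insert a A. d b * u b x) = p x - t * q x" for x
    by (simp add: p_def q_def algebra_simps sum_subtractf sum_distrib_left)
  thus ?case
    using pq by (intro exI[of _ d]) simp
qed simp

text \<open>The field is left open because the rule serves real parameters (translations of test functions)
as well as complex ones (dilations of the activation function).\<close>

lemma has_field_derivative_integral:
  fixes F :: "'a::{real_normed_field,banach,second_countable_topology} \<Rightarrow> 'b \<Rightarrow> 'a"
  assumes U: "open U" "w \<in> U"
    and int: "\<And>v. v \<in> U \<Longrightarrow> integrable M (F v)"
    and F': "F' \<in> borel_measurable M"
    and B: "integrable M B"
    and der: "\<And>x. x \<in> space M \<Longrightarrow> ((\<lambda>v. F v x) has_field_derivative F' x) (at w)"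
    and lip: "\<And>v x. v \<in> U \<Longrightarrow> x \<in> space M \<Longrightarrow> norm (F v x - F w x) \<le> B x * norm (v - w)"
  shows "((\<lambda>v. LINT x|M. F v x) has_field_derivative (LINT x|M. F' x)) (at w)"
proof -
  have "(\<lambda>n. ((LINT x|M. F (X n) x) - (LINT x|M. F w x)) / (X n - w)) \<longlonglongrightarrow> (LINT x|M. F' x)"
    if X: "\<And>n. X n \<in> U - {w}" and lim: "X \<longlonglongrightarrow> w" for X
  proof -
    have eq: "((LINT x|M. F (X n) x) - (LINT x|M. F w x)) / (X n - w)
        = (LINT x|M. (F (X n) x - F w x) / (X n - w))" for n
      using Bochner_Integration.integral_diff[of M "F (X n)" "F w"] int[of "X n"] int[of w] X[of n] U
      by (simp only: integral_divide_zero) auto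
    have "(\<lambda>n. LINT x|M. (F (X n) x - F w x) / (X n - w)) \<longlonglongrightarrow> (LINT x|M. F' x)"
    proof (rule integral_dominated_convergence[where w = B])
      show "(\<lambda>x. (F (X n) x - F w x) / (X n - w)) \<in> borel_measurable M" for n
        using borel_measurable_integrable[OF int[of "X n"]] borel_measurable_integrable[OF int[of w]] X[of n] U
        by (intro borel_measurable_divide borel_measurable_diff) auto
      show "AE x in M. (\<lambda>n. (F (X n) x - F w x) / (X n - w)) \<longlonglongrightarrow> F' x"
      proof (rule AE_I2)
        fix x assume "x \<in> space M"
        from der[OF this] have "((\<lambda>v. (F v x - F w x) / (v - w)) \<longlongrightarrow> F' x) (at w)"
          by (simp add: has_field_derivative_iff)
        hence "((\<lambda>v. (F v x - F w x) / (v - w)) \<circ> X) \<longlonglongrightarrow> F' x"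
          using X lim unfolding tendsto_at_iff_sequentially by blast
        thus "(\<lambda>n. (F (X n) x - F w x) / (X n - w)) \<longlonglongrightarrow> F' x"
          by (simp only: o_def)
      qed
      show "AE x in M. norm ((F (X n) x - F w x) / (X n - w)) \<le> B x" for n
      proof (rule AE_I2)
        fix x assume x: "x \<in> space M"
        have "norm (X n - w) > 0" using X[of n] by auto
        moreover have "norm (F (X n) x - F w x) \<le> B x * norm (X n - w)"
          using lip[of "X n"] X[of n] x by auto
        ultimately show "norm ((F (X n) x - F w x) / (X n - w)) \<le> B x"
          by (simp add: norm_divide divide_simps)
      qed
    qed (use F' B in auto)
    thus ?thesis unfolding eq .
  qed
  hence "((\<lambda>v. ((LINT x|M. F v x) - (LINT x|M. F w x)) / (v - w)) \<longlongrightarrow> (LINT x|M. F' x)) (at w within U)"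
    unfolding tendsto_at_iff_sequentially o_def by blast
  thus ?thesis
    using at_within_open[OF U(2,1)] by (simp only: has_field_derivative_iff)
qed

section \<open>Bounded holomorphic functions with many zeros\<close>

text \<open>Dividing by a Blaschke factor does not increase the supremum: a disc automorphism moves the zero
to the origin, where this is the Schwarz lemma.\<close>

lemma bounded_holomorphic_factor_zero:
  assumes hol: "h holomorphic_on ball 0 1" and bd: "\<And>z. norm z < 1 \<Longrightarrow> norm (h z) \<le> M"
    and a: "norm a < 1" "h a = 0"
  obtains k where "k holomorphic_on ball 0 1" "\<And>z. norm z < 1 \<Longrightarrow> norm (k z) \<le> M"
    "\<And>z. norm z < 1 \<Longrightarrow> h z = Moebius_function 0 a z * k z"
proof -
  define F where "F = h \<circ> Moebius_function 0 (- a)"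
  have M0: "M \<ge> 0" using order_trans[OF norm_ge_zero bd[of 0]] by simp
  have lt1: "norm (Moebius_function 0 b z) < 1" if "norm b < 1" "norm z < 1" for b z
    using Moebius_function_norm_lt_1 that by blast
  have holF: "F holomorphic_on ball 0 1"
    unfolding F_def
    by (rule holomorphic_on_compose_gen[OF Moebius_function_holomorphic hol]) (use a lt1[of "-a"] in auto)
  have F0: "F 0 = 0"
    using a by (simp add: F_def Moebius_function_of_zero)
  have Fbd: "norm (F z) \<le> M" if "norm z < 1" for z
    unfolding F_def using bd lt1[of "-a" z] a that by auto
  obtain H where H: "H holomorphic_on ball 0 1" "\<And>z. norm z < 1 \<Longrightarrow> F z = z * H z" "deriv F 0 = H 0"
    using Schwarz3[OF holF F0] by metis
  have Hbd: "norm (H z) \<le> M" if z: "norm z < 1" for z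
  \<comment> \<open>The Schwarz lemma asks for a strict bound, hence the extra \<open>e\<close>.\<close>
  proof (rule field_le_epsilon)
    fix e :: real assume e: "e > 0"
    define G where "G = (\<lambda>z. F z / of_real (M + e))"
    have holG: "G holomorphic_on ball 0 1"
      unfolding G_def using M0 e by (intro holomorphic_intros holF) (auto simp: complex_eq_iff)
    have G0: "G 0 = 0" by (simp add: G_def F0)
    have Gn: "norm (G w) = norm (F w) / (M + e)" for w
      unfolding G_def norm_divide norm_of_real using M0 e by simp
    have G1: "norm (G w) < 1" if "norm w < 1" for w
      using Fbd[OF that] M0 e by (simp add: Gn)
    have der: "deriv G 0 = deriv F 0 / of_real (M + e)"
      unfolding G_def
      using holF holomorphic_on_imp_differentiable_at[of F "ball 0 1" 0] by (intro deriv_cdivide_right) auto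
    show "norm (H z) \<le> M + e"
    proof (cases "z = 0")
      case True
      have "norm (deriv G 0) \<le> 1" by (rule Schwarz_Lemma(2)[OF holG G0 G1 z])
      hence "norm (deriv F 0) / (M + e) \<le> 1"
        unfolding der norm_divide norm_of_real using M0 e by simp
      thus ?thesis using True H(3) M0 e by (simp add: field_simps)
    next
      case False
      have "norm (G z) \<le> norm z" by (rule Schwarz_Lemma(1)[OF holG G0 G1 z])
      hence "norm z * norm (H z) \<le> norm z * (M + e)"
        unfolding Gn H(2)[OF z] norm_mult using M0 e by (simp add: field_simps)
      thus ?thesis using False by simp
    qed
  qed
  show thesis
  proof
    show "(H \<circ> Moebius_function 0 a) holomorphic_on ball 0 1"
      by (rule holomorphic_on_compose_gen[OF Moebius_function_holomorphic H(1)]) (use a lt1[of a] in auto)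
    show "norm ((H \<circ> Moebius_function 0 a) z) \<le> M" if "norm z < 1" for z
      using Hbd lt1[of a z] a that by simp
    show "h z = Moebius_function 0 a z * (H \<circ> Moebius_function 0 a) z" if z: "norm z < 1" for z
    proof -
      have "F (Moebius_function 0 a z) = h z"
        unfolding F_def o_def using Moebius_function_compose[of "-a" a z] a z by simp
      thus ?thesis using H(2)[OF lt1[OF a(1) z]] by simp
    qed
  qed
qed

lemma bounded_holomorphic_le_Blaschke_product:
  assumes "finite Z" "Z \<subseteq> ball 0 1" "h holomorphic_on ball 0 1"
    "\<And>z. norm z < 1 \<Longrightarrow> norm (h z) \<le> M" "\<And>a. a \<in> Z \<Longrightarrow> h a = 0" "norm z < 1"
  shows "norm (h z) \<le> M * (\<Prod>a\<in>Z. norm (Moebius_function 0 a z))"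
  using assms
proof (induction Z arbitrary: h rule: finite_induct)
  case (insert a Z)
  have a: "norm a < 1" "h a = 0" using insert.prems by auto
  obtain k where k: "k holomorphic_on ball 0 1" "\<And>z. norm z < 1 \<Longrightarrow> norm (k z) \<le> M"
    "\<And>z. norm z < 1 \<Longrightarrow> h z = Moebius_function 0 a z * k z"
    using bounded_holomorphic_factor_zero[OF insert.prems(2) insert.prems(3) a] by blast
  have "k b = 0" if b: "b \<in> Z" for b
  proof -
    have nb: "norm b < 1" "b \<noteq> a" using b insert by auto
    have "norm (cnj a * b) < 1"
      using norm_mult_less[of "cnj a" 1 b 1] a nb by simp
    hence "cnj a * b \<noteq> 1" by auto
    hence "Moebius_function 0 a b \<noteq> 0"
      using nb by (simp add: Moebius_function_simple)
    thus ?thesis using k(3)[OF nb(1)] insert.prems(4)[of b] b by simp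
  qed
  hence "norm (k z) \<le> M * (\<Prod>a\<in>Z. norm (Moebius_function 0 a z))"
    using insert.prems k by (intro insert.IH) auto
  hence "norm (Moebius_function 0 a z) * norm (k z)
      \<le> norm (Moebius_function 0 a z) * (M * (\<Prod>a\<in>Z. norm (Moebius_function 0 a z)))"
    by (rule mult_left_mono) simp
  thus ?case
    using insert.hyps k(3)[OF insert.prems(5)] by (simp add: norm_mult mult_ac)
qed auto

lemma Moebius_function_compact_bound:
  assumes "compact K" "K \<subseteq> ball 0 1"
  obtains q where "0 < q" "q < 1" "\<And>a z. a \<in> K \<Longrightarrow> z \<in> K \<Longrightarrow> norm (Moebius_function 0 a z) \<le> q"
proof (cases "K = {}")
  case True
  show ?thesis by (rule that[of "1/2"]) (use True in auto)
next
  case False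
  have ne: "1 - cnj a * z \<noteq> 0" if "a \<in> K" "z \<in> K" for a z
  proof -
    have "norm (cnj a * z) < 1"
      using norm_mult_less[of "cnj a" 1 z 1] subsetD[OF assms(2) that(1)] subsetD[OF assms(2) that(2)] by simp
    thus ?thesis by auto
  qed
  have "continuous_on (K \<times> K) (\<lambda>p. norm (Moebius_function 0 (fst p) (snd p)))"
    unfolding Moebius_function_simple using ne by (intro continuous_intros) auto
  moreover have "compact (K \<times> K)" using assms by (simp add: compact_Times)
  ultimately have "\<exists>p\<in>K \<times> K. \<forall>p'\<in>K \<times> K.
      norm (Moebius_function 0 (fst p') (snd p')) \<le> norm (Moebius_function 0 (fst p) (snd p))"
    using continuous_attains_sup[of "K \<times> K" "\<lambda>p. norm (Moebius_function 0 (fst p) (snd p))"] False by blast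
  then obtain p where p: "p \<in> K \<times> K" "\<And>p'. p' \<in> K \<times> K \<Longrightarrow>
      norm (Moebius_function 0 (fst p') (snd p')) \<le> norm (Moebius_function 0 (fst p) (snd p))"
    by blast
  have lt: "norm (Moebius_function 0 (fst p) (snd p)) < 1"
    using p(1) assms(2) by (intro Moebius_function_norm_lt_1) auto
  show ?thesis
  proof (rule that[of "max (1/2) (norm (Moebius_function 0 (fst p) (snd p)))"])
    show "norm (Moebius_function 0 a z) \<le> max (1/2) (norm (Moebius_function 0 (fst p) (snd p)))"
      if "a \<in> K" "z \<in> K" for a z
      using p(2)[of "(a, z)"] that by simp
  qed (use lt in auto)
qed

text \<open>The zeros may lie anywhere in the compact set: in the coordinate of the Riemann map each one
contributes a Blaschke factor that is bounded on that set by the same constant \<open>q < 1\<close>.\<close>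

lemma bounded_holomorphic_many_zeros:
  assumes D: "open D" "simply_connected D" "D \<noteq> UNIV" and K: "compact K" "K \<subseteq> D"
  obtains q :: real where "0 < q" "q < 1"
    "\<And>h M Z z. h holomorphic_on D \<Longrightarrow> (\<And>z. z \<in> D \<Longrightarrow> norm (h z) \<le> M) \<Longrightarrow> finite Z \<Longrightarrow> Z \<subseteq> K
       \<Longrightarrow> (\<And>a. a \<in> Z \<Longrightarrow> h a = 0) \<Longrightarrow> z \<in> K \<Longrightarrow> norm (h z) \<le> M * q ^ card Z"
proof (cases "D = {}")
  case True
  thus ?thesis using that[of "1/2"] K by auto
next
  case False
  obtain f g where fg: "f holomorphic_on D" "g holomorphic_on ball 0 1"
      "\<And>z. z \<in> D \<Longrightarrow> f z \<in> ball 0 1 \<and> g (f z) = z"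
      "\<And>z. z \<in> ball 0 1 \<Longrightarrow> g z \<in> D \<and> f (g z) = z"
    using Riemann_mapping_theorem[of D] D False by metis
  have "compact (f ` K)"
    using fg(1) K by (intro compact_continuous_image)
      (auto intro: holomorphic_on_imp_continuous_on holomorphic_on_subset)
  moreover have "f ` K \<subseteq> ball 0 1" using fg(3) K by auto
  ultimately obtain q where q: "0 < q" "q < 1"
    "\<And>a z. a \<in> f ` K \<Longrightarrow> z \<in> f ` K \<Longrightarrow> norm (Moebius_function 0 a z) \<le> q"
    using Moebius_function_compact_bound by metis
  show ?thesis
  proof (rule that[OF q(1,2)])
    fix h M Z z
    assume h: "h holomorphic_on D" and bd: "\<And>z. z \<in> D \<Longrightarrow> norm (h z) \<le> M" and Z: "finite Z" "Z \<subseteq> K"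
      "\<And>a. a \<in> Z \<Longrightarrow> h a = 0" and z: "z \<in> K"
    have M0: "M \<ge> 0" using bd[of z] z K norm_ge_zero[of "h z"] by (meson order_trans subsetD)
    have inj: "inj_on f Z"
      by (rule inj_on_inverseI[of _ g]) (use fg(3) Z K in auto)
    have "norm ((h \<circ> g) (f z)) \<le> M * (\<Prod>a\<in>f ` Z. norm (Moebius_function 0 a (f z)))"
    proof (rule bounded_holomorphic_le_Blaschke_product)
      show "(h \<circ> g) holomorphic_on ball 0 1"
        using fg(4) by (intro holomorphic_on_compose_gen[OF fg(2) h]) auto
      show "norm ((h \<circ> g) z) \<le> M" if "norm z < 1" for z
        using bd fg(4)[of z] that by simp
      show "(h \<circ> g) a = 0" if "a \<in> f ` Z" for a
        using that Z K fg(3) by auto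
      show "f ` Z \<subseteq> ball 0 1" "norm (f z) < 1" using fg(3) Z K z by auto
    qed (use Z in auto)
    also have "(\<Prod>a\<in>f ` Z. norm (Moebius_function 0 a (f z))) \<le> (\<Prod>a\<in>f ` Z. q)"
      using q Z z by (intro prod_mono) auto
    also have "\<dots> = q ^ card Z" by (simp add: card_image inj)
    finally show "norm (h z) \<le> M * q ^ card Z"
      using fg(3)[of z] z K M0 by (auto simp: mult_left_mono)
  qed
qed

section \<open>Moments of a function orthogonal to all neurons of one direction\<close>

text \<open>The factor \<open>t\<^sup>l\<close> is included so that differentiation in \<open>w\<close> stays inside the family: it raises \<open>l\<close> by
one and replaces \<open>\<phi>\<close> by its derivative.\<close>

definition dilation_transform ::
    "'a measure \<Rightarrow> ('a \<Rightarrow> real) \<Rightarrow> ('a \<Rightarrow> real) \<Rightarrow> nat \<Rightarrow> (complex \<Rightarrow> complex) \<Rightarrow> complex \<Rightarrow> complex" where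
  "dilation_transform M g t l \<phi> w = (LINT x|M. of_real (g x * t x ^ l) * \<phi> (w * of_real (t x)))"

context
  fixes M :: "'a measure" and g t :: "'a \<Rightarrow> real" and X S D :: "complex set" and R :: real
  assumes g: "integrable M g" and t: "t \<in> borel_measurable M"
    and X: "compact X" "X \<subseteq> S" and S: "open S" and D: "open D"
    and DX: "\<And>w x. w \<in> D \<Longrightarrow> x \<in> space M \<Longrightarrow> g x \<noteq> 0 \<Longrightarrow> w * of_real (t x) \<in> X"
    and R: "\<And>x. x \<in> space M \<Longrightarrow> g x \<noteq> 0 \<Longrightarrow> \<bar>t x\<bar> \<le> R" "R \<ge> 0"
begin

lemma dilation_transform_integrand:
  assumes \<phi>: "continuous_on X \<phi>" and w: "w \<in> D" and C: "\<And>z. z \<in> X \<Longrightarrow> norm (\<phi> z) \<le> C"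
  shows dilation_transform_integrable:
      "integrable M (\<lambda>x. of_real (g x * t x ^ l) * \<phi> (w * of_real (t x)))"
    and dilation_transform_le: "norm (dilation_transform M g t l \<phi> w) \<le> C * R ^ l * (LINT x|M. \<bar>g x\<bar>)"
proof -
  \<comment> \<open>Outside \<open>X\<close> nothing is known about \<open>\<phi>\<close>, not even measurability; there the factor \<open>g\<close> vanishes.\<close>
  define \<psi> where "\<psi> z = (if z \<in> X then \<phi> z else 0)" for z
  have "\<psi> \<in> borel_measurable borel"
    unfolding \<psi>_def using X \<phi> by (intro borel_measurable_continuous_on_if) (auto intro: borel_compact)
  moreover have eq: "of_real (g x * t x ^ l) * \<phi> (w * of_real (t x))
      = of_real (g x * t x ^ l) * \<psi> (w * of_real (t x))" if "x \<in> space M" for x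
    using DX[OF w that] by (cases "g x = 0") (auto simp: \<psi>_def)
  ultimately have meas: "(\<lambda>x. of_real (g x * t x ^ l) * \<phi> (w * of_real (t x))) \<in> borel_measurable M"
    using borel_measurable_integrable[OF g] t by (subst measurable_cong[OF eq]) auto
  have bound: "norm (of_real (g x * t x ^ l) * \<phi> (w * of_real (t x))) \<le> C * R ^ l * \<bar>g x\<bar>"
    if x: "x \<in> space M" for x
  proof (cases "g x = 0")
    case False
    have "\<bar>t x\<bar> ^ l * norm (\<phi> (w * of_real (t x))) \<le> R ^ l * C"
      using R(1)[OF x False] C[OF DX[OF w x False]] R(2) by (intro mult_mono power_mono) auto
    hence "\<bar>g x\<bar> * (\<bar>t x\<bar> ^ l * norm (\<phi> (w * of_real (t x)))) \<le> \<bar>g x\<bar> * (R ^ l * C)"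
      by (rule mult_left_mono) simp
    thus ?thesis by (simp add: norm_mult norm_power power_abs abs_mult mult_ac)
  qed simp
  have int: "integrable M (\<lambda>x. C * R ^ l * \<bar>g x\<bar>)" using g by simp
  show *: "integrable M (\<lambda>x. of_real (g x * t x ^ l) * \<phi> (w * of_real (t x)))"
  proof (rule Bochner_Integration.integrable_bound[OF int meas], rule AE_I2)
    fix x assume "x \<in> space M"
    note bound[OF this]
    also have "C * R ^ l * \<bar>g x\<bar> \<le> norm (C * R ^ l * \<bar>g x\<bar>)" by simp
    finally show "norm (of_real (g x * t x ^ l) * \<phi> (w * of_real (t x))) \<le> norm (C * R ^ l * \<bar>g x\<bar>)" .
  qed
  have "norm (dilation_transform M g t l \<phi> w) \<le> (LINT x|M. norm (of_real (g x * t x ^ l) * \<phi> (w * of_real (t x))))"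
    unfolding dilation_transform_def by (rule integral_norm_bound)
  also have "\<dots> \<le> (LINT x|M. C * R ^ l * \<bar>g x\<bar>)"
    using bound by (intro integral_mono integrable_norm * int) auto
  finally show "norm (dilation_transform M g t l \<phi> w) \<le> C * R ^ l * (LINT x|M. \<bar>g x\<bar>)" by simp
qed

lemma dilation_transform_has_derivative:
  assumes hol: "\<phi> holomorphic_on S" and w: "w \<in> D"
  shows "(dilation_transform M g t l \<phi> has_field_derivative dilation_transform M g t (Suc l) (deriv \<phi>) w) (at w)"
proof -
  have hol': "deriv \<phi> holomorphic_on S" using hol S by (rule holomorphic_deriv)
  have cont: "continuous_on X \<phi>" "continuous_on X (deriv \<phi>)"
    using hol hol' X(2) by (auto intro: holomorphic_on_imp_continuous_on holomorphic_on_subset)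
  obtain C where C: "\<And>z. z \<in> X \<Longrightarrow> norm (\<phi> z) \<le> C"
    using compact_imp_bounded[OF compact_continuous_image[OF cont(1) X(1)]] unfolding bounded_iff by auto
  obtain C' where C': "\<And>z. z \<in> X \<Longrightarrow> norm (deriv \<phi> z) \<le> C'"
    using compact_imp_bounded[OF compact_continuous_image[OF cont(2) X(1)]] unfolding bounded_iff by auto
  obtain e where e: "e > 0" "ball w e \<subseteq> D"
    using D w by (meson openE)
  let ?F = "\<lambda>v x. of_real (g x * t x ^ l) * \<phi> (v * of_real (t x)) :: complex"
  let ?F' = "\<lambda>v x. of_real (g x * t x ^ Suc l) * deriv \<phi> (v * of_real (t x)) :: complex"
  have der: "((\<lambda>v. ?F v x) has_field_derivative ?F' v x) (at v)" if "v \<in> D" "x \<in> space M" for v x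
  proof (cases "g x = 0")
    case False
    have "v * of_real (t x) \<in> S" using DX[OF that False] X by auto
    hence "(\<phi> has_field_derivative deriv \<phi> (v * of_real (t x))) (at (v * of_real (t x)))"
      using hol S holomorphic_derivI by blast
    hence "((\<lambda>v. \<phi> (v * of_real (t x))) has_field_derivative deriv \<phi> (v * of_real (t x)) * of_real (t x)) (at v)"
      by (rule DERIV_chain2) (auto intro!: derivative_eq_intros)
    from DERIV_cmult[OF this, of "of_real (g x * t x ^ l)"] show ?thesis
      by (simp add: mult_ac)
  qed simp
  have "((\<lambda>v. LINT x|M. ?F v x) has_field_derivative (LINT x|M. ?F' w x)) (at w)"
  proof (rule has_field_derivative_integral[where U = "ball w e" and B = "\<lambda>x. C' * R ^ Suc l * \<bar>g x\<bar>"])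
    show "integrable M (?F v)" if "v \<in> ball w e" for v
      using that e by (intro dilation_transform_integrable[OF cont(1) _ C]) auto
    show "?F' w \<in> borel_measurable M"
      using dilation_transform_integrable[OF cont(2) w C'] by (rule borel_measurable_integrable)
    show "((\<lambda>v. ?F v x) has_field_derivative ?F' w x) (at w)" if "x \<in> space M" for x
      using der[OF w that] .
    show "norm (?F v x - ?F w x) \<le> C' * R ^ Suc l * \<bar>g x\<bar> * norm (v - w)"
      if v: "v \<in> ball w e" and x: "x \<in> space M" for v x
    proof (rule field_differentiable_bound[of "ball w e" "\<lambda>v. ?F v x" "\<lambda>v. ?F' v x"])
      show "((\<lambda>v. ?F v x) has_field_derivative ?F' u x) (at u within ball w e)" if "u \<in> ball w e" for u
        using der[of u x] that e x by (blast intro: has_field_derivative_at_within)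
      show "norm (?F' u x) \<le> C' * R ^ Suc l * \<bar>g x\<bar>" if u: "u \<in> ball w e" for u
      proof (cases "g x = 0")
        case False
        have uD: "u \<in> D" using u e by auto
        have "\<bar>t x\<bar> ^ Suc l * norm (deriv \<phi> (u * of_real (t x))) \<le> R ^ Suc l * C'"
          using R(1)[OF x False] C'[OF DX[OF uD x False]] R(2) by (intro mult_mono power_mono) auto
        hence "\<bar>g x\<bar> * (\<bar>t x\<bar> ^ Suc l * norm (deriv \<phi> (u * of_real (t x)))) \<le> \<bar>g x\<bar> * (R ^ Suc l * C')"
          by (rule mult_left_mono) simp
        thus ?thesis by (simp add: norm_mult norm_power power_abs abs_mult mult_ac)
      qed simp
    qed (use v e in auto)
  qed (use e g in auto)
  thus ?thesis by (simp only: dilation_transform_def[abs_def])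
qed

lemma dilation_transform_higher_deriv:
  assumes hol: "\<phi> holomorphic_on S" and w: "w \<in> D"
  shows "(deriv ^^ l) (dilation_transform M g t 0 \<phi>) w = dilation_transform M g t l ((deriv ^^ l) \<phi>) w"
  using w
proof (induction l arbitrary: w)
  case (Suc l)
  have "(deriv ^^ l) \<phi> holomorphic_on S" using hol S by (rule holomorphic_higher_deriv)
  from dilation_transform_has_derivative[OF this Suc.prems, of l]
  have "((deriv ^^ l) (dilation_transform M g t 0 \<phi>) has_field_derivative
      dilation_transform M g t (Suc l) (deriv ((deriv ^^ l) \<phi>)) w) (at w)"
    by (rule has_field_derivative_transform_within_open[OF _ D Suc.prems]) (use Suc.IH in auto)
  thus ?case by (simp add: DERIV_imp_deriv)
qed simp

end

text \<open>The transform of \<open>\<sigma>\<close> is holomorphic in a convex neighbourhood of \<open>J\<close> and vanishes on \<open>W\<close>, so it is of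
size \<open>q ^ card W\<close> in a disc around \<open>0\<close>. Cauchy's inequality bounds its Taylor coefficients there,
which are the moments multiplied by the Taylor coefficients of \<open>\<sigma>\<close>.\<close>

lemma moments_of_orthogonal_function:
  fixes \<sigma> :: "complex \<Rightarrow> complex" and J T :: "real set" and c \<rho> :: real
  assumes hol: "\<sigma> holomorphic_on S" and S: "open S"
    and J: "compact J" "convex J" "0 \<in> J" and T: "compact T" "T \<noteq> {}"
    and JT: "\<And>w t. w \<in> J \<Longrightarrow> t \<in> T \<Longrightarrow> of_real (w * t) \<in> S"
    and real: "\<And>w t. w \<in> J \<Longrightarrow> t \<in> T \<Longrightarrow> \<sigma> (of_real (w * t)) \<in> \<real>"
    and c: "c > 0" "\<rho> > 0" and lower: "\<And>k. norm ((deriv ^^ k) \<sigma> 0) \<ge> fact k * c / \<rho> ^ k"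
  obtains C B q where "C > 0" "B > 0" "0 < q" "q < 1"
    "\<And>(M :: 'a measure) g t W l. integrable M g \<Longrightarrow> t \<in> borel_measurable M
       \<Longrightarrow> (\<And>x. x \<in> space M \<Longrightarrow> g x \<noteq> 0 \<Longrightarrow> t x \<in> T) \<Longrightarrow> finite W \<Longrightarrow> W \<subseteq> J
       \<Longrightarrow> (\<And>w. w \<in> W \<Longrightarrow> (LINT x|M. g x * Re (\<sigma> (of_real (w * t x)))) = 0)
       \<Longrightarrow> \<bar>LINT x|M. g x * t x ^ l\<bar> \<le> C * B ^ l * q ^ card W * (LINT x|M. \<bar>g x\<bar>)"
proof -
  define J' where "J' = complex_of_real ` J"
  define X0 where "X0 = (\<lambda>(w, t). complex_of_real (w * t)) ` (J \<times> T)"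
  have X0: "compact X0" "X0 \<subseteq> S"
    unfolding X0_def split_def using J T JT
    by (auto intro!: compact_continuous_image continuous_intros compact_Times)
  obtain e where e: "e > 0" "(\<Union>x\<in>X0. ball x e) \<subseteq> S"
    using compact_subset_open_imp_ball_epsilon_subset[OF X0(1) S X0(2)] by blast
  obtain R where R: "R > 0" "\<And>t. t \<in> T \<Longrightarrow> \<bar>t\<bar> \<le> R"
    using compact_imp_bounded[OF T(1)] unfolding bounded_pos by auto
  define X where "X = {x + y |x y. x \<in> X0 \<and> y \<in> cball 0 (e / 2)}"
  have X: "compact X" unfolding X_def using X0 by (intro compact_sums) auto
  have XS: "X \<subseteq> S"
  proof
    fix z assume "z \<in> X"
    then obtain x y where "z = x + y" "x \<in> X0" "norm y \<le> e / 2" by (auto simp: X_def)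
    hence "z \<in> ball x e" "x \<in> X0" using e by (auto simp: dist_norm)
    thus "z \<in> S" using e(2) by blast
  qed
  \<comment> \<open>With this radius, dilating \<open>T\<close> by a point within \<open>\<eta>\<close> of \<open>J\<close> stays within \<open>e / 2\<close> of \<open>X0\<close>.\<close>
  define \<eta> where "\<eta> = e / (2 * R)"
  have \<eta>: "\<eta> > 0" using e R by (simp add: \<eta>_def)
  define D where "D = {x + y |x y. x \<in> J' \<and> y \<in> ball 0 \<eta>}"
  have D: "open D" "convex D"
  proof -
    have "D = (\<Union>x\<in>J'. \<Union>y\<in>ball 0 \<eta>. {x + y})" unfolding D_def by blast
    moreover have "convex J'" unfolding J'_def
      by (rule convex_linear_image[OF _ J(2)]) (simp add: bounded_linear.linear[OF bounded_linear_of_real])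
    ultimately show "convex D" by (metis convex_ball convex_sums)
    have "z \<in> D \<longleftrightarrow> z \<in> (\<Union>x\<in>J'. ball x \<eta>)" for z
    proof
      assume "z \<in> D"
      then obtain x y where "z = x + y" "x \<in> J'" "norm y < \<eta>" unfolding D_def by auto
      thus "z \<in> (\<Union>x\<in>J'. ball x \<eta>)" by (intro UN_I[of x]) (auto simp: dist_norm)
    next
      assume "z \<in> (\<Union>x\<in>J'. ball x \<eta>)"
      then obtain x where "x \<in> J'" "dist x z < \<eta>" by auto
      thus "z \<in> D"
        unfolding D_def by (intro CollectI exI[of _ x] exI[of _ "z - x"]) (auto simp: dist_norm norm_minus_commute)
    qed
    hence "D = (\<Union>x\<in>J'. ball x \<eta>)" by blast
    thus "open D" by auto
  qed
  have J': "compact J'" unfolding J'_def using J by (intro compact_continuous_image continuous_intros)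
  have DX: "w * of_real t \<in> X" if w: "w \<in> D" and "t \<in> T" for w t
  proof -
    obtain x y where xy: "w = of_real x + y" "x \<in> J" "norm y < \<eta>"
      using w unfolding D_def J'_def by fastforce
    have "norm y * \<bar>t\<bar> \<le> \<eta> * R" using xy R that \<eta> by (intro mult_mono) auto
    hence "norm (y * of_real t) \<le> e / 2" using R by (simp add: norm_mult \<eta>_def)
    moreover have "w * of_real t = of_real (x * t) + y * of_real t" using xy by (simp add: algebra_simps)
    moreover have "of_real (x * t) \<in> X0" using xy that by (auto simp: X0_def)
    ultimately show ?thesis unfolding X_def by auto
  qed
  have D_bounded: "bounded D"
  proof -
    have "D \<subseteq> {x + y |x y. x \<in> J' \<and> y \<in> cball 0 \<eta>}" unfolding D_def by force
    moreover have "compact {x + y |x y. x \<in> J' \<and> y \<in> cball 0 \<eta>}" using J' by (intro compact_sums) auto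
    ultimately show ?thesis using bounded_subset compact_imp_bounded by blast
  qed
  define K where "K = J' \<union> cball 0 (\<eta> / 2)"
  have K: "compact K" "K \<subseteq> D"
  proof -
    show "compact K" unfolding K_def using J' by (intro compact_Un) auto
    have "0 \<in> J'" using J by (auto simp: J'_def)
    show "K \<subseteq> D"
    proof
      fix z assume "z \<in> K"
      thus "z \<in> D"
        unfolding K_def
      proof
        assume "z \<in> J'"
        thus ?thesis unfolding D_def using \<eta> by (intro CollectI exI[of _ z] exI[of _ 0]) auto
      next
        assume "z \<in> cball 0 (\<eta> / 2)"
        thus ?thesis unfolding D_def using \<eta> \<open>0 \<in> J'\<close> by (intro CollectI exI[of _ 0] exI[of _ z]) auto
      qed
    qed
  qed
  have "D \<noteq> UNIV" using D_bounded not_bounded_UNIV by metis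
  then obtain q where q: "0 < q" "q < 1"
    "\<And>h M Z z. h holomorphic_on D \<Longrightarrow> (\<And>z. z \<in> D \<Longrightarrow> norm (h z) \<le> M) \<Longrightarrow> finite Z \<Longrightarrow> Z \<subseteq> K
       \<Longrightarrow> (\<And>a. a \<in> Z \<Longrightarrow> h a = 0) \<Longrightarrow> z \<in> K \<Longrightarrow> norm (h z) \<le> M * q ^ card Z"
    using bounded_holomorphic_many_zeros[OF D(1) convex_imp_simply_connected[OF D(2)] _ K] by blast
  have cont: "continuous_on X \<sigma>"
    using hol XS by (auto intro: holomorphic_on_imp_continuous_on holomorphic_on_subset)
  obtain A where A: "A > 0" "\<And>z. z \<in> X \<Longrightarrow> norm (\<sigma> z) \<le> A"
    using compact_imp_bounded[OF compact_continuous_image[OF cont X]] unfolding bounded_pos by auto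
  show thesis
  proof (rule that[of "A / c" "2 * \<rho> / \<eta>" q])
    fix M :: "'a measure" and g t :: "'a \<Rightarrow> real" and W l
    assume g: "integrable M g" and t: "t \<in> borel_measurable M"
      and gt: "\<And>x. x \<in> space M \<Longrightarrow> g x \<noteq> 0 \<Longrightarrow> t x \<in> T" and W: "finite W" "W \<subseteq> J"
      and orth: "\<And>w. w \<in> W \<Longrightarrow> (LINT x|M. g x * Re (\<sigma> (of_real (w * t x)))) = 0"
    have DX': "w * of_real (t x) \<in> X" if "w \<in> D" "x \<in> space M" "g x \<noteq> 0" for w x
      using DX that gt by blast
    have R': "\<bar>t x\<bar> \<le> R" if "x \<in> space M" "g x \<noteq> 0" for x using R(2) gt that by blast
    note ctx = g t X XS S D(1) DX' R' less_imp_le[OF R(1)]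
    define G where "G = dilation_transform M g t 0 \<sigma>"
    define N where "N = (LINT x|M. \<bar>g x\<bar>)"
    have holG: "G holomorphic_on D"
      unfolding G_def holomorphic_on_def field_differentiable_def
      using dilation_transform_has_derivative[OF ctx hol] has_field_derivative_at_within by blast
    have Gbd: "norm (G z) \<le> A * N" if "z \<in> D" for z
      using dilation_transform_le[OF ctx cont that A(2), of 0] by (simp add: G_def N_def)
    have G0: "G (of_real w) = 0" if w: "w \<in> W" for w
    proof -
      have "G (of_real w) = (LINT x|M. of_real (g x * Re (\<sigma> (of_real (w * t x)))))"
        unfolding G_def dilation_transform_def
      proof (rule Bochner_Integration.integral_cong[OF refl])
        fix x assume x: "x \<in> space M"
        show "of_real (g x * t x ^ 0) * \<sigma> (of_real w * of_real (t x))
            = complex_of_real (g x * Re (\<sigma> (of_real (w * t x))))"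
        proof (cases "g x = 0")
          case False
          hence "\<sigma> (of_real (w * t x)) \<in> \<real>" using real w W gt x by blast
          thus ?thesis by (simp add: of_real_Re)
        qed simp
      qed
      also have "\<dots> = 0" using orth[OF w] by (simp only: integral_complex_of_real of_real_0)
      finally show ?thesis .
    qed
    have card: "card (complex_of_real ` W) = card W" by (intro card_image inj_onI) auto
    have Gsmall: "norm (G z) \<le> A * N * q ^ card W" if "z \<in> K" for z
      unfolding card[symmetric]
      by (rule q(3)[OF holG Gbd _ _ _ that]) (use W G0 in \<open>auto simp: K_def J'_def\<close>)
    have cb: "cball 0 (\<eta> / 2) \<subseteq> D" using K by (auto simp: K_def)
    have "norm ((deriv ^^ l) G 0) \<le> fact l * (A * N * q ^ card W) / (\<eta> / 2) ^ l"
    proof (rule Cauchy_inequality)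
      show "G holomorphic_on ball 0 (\<eta> / 2)"
        using holG cb ball_subset_cball holomorphic_on_subset by blast
      show "continuous_on (cball 0 (\<eta> / 2)) G"
        using holG cb holomorphic_on_imp_continuous_on holomorphic_on_subset by blast
      show "norm (G x) \<le> A * N * q ^ card W" if "norm (0 - x) = \<eta> / 2" for x
        using that by (intro Gsmall) (auto simp: K_def)
    qed (use \<eta> in auto)
    moreover have "(deriv ^^ l) G 0 = (deriv ^^ l) \<sigma> 0 * of_real (LINT x|M. g x * t x ^ l)"
    proof -
      have "0 \<in> D" using cb \<eta> by auto
      hence "(deriv ^^ l) G 0 = dilation_transform M g t l ((deriv ^^ l) \<sigma>) 0"
        unfolding G_def by (intro dilation_transform_higher_deriv[OF ctx hol])
      also have "\<dots> = (LINT x|M. of_real (g x * t x ^ l)) * (deriv ^^ l) \<sigma> 0"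
        unfolding dilation_transform_def by simp
      also have "(LINT x|M. complex_of_real (g x * t x ^ l)) = of_real (LINT x|M. g x * t x ^ l)"
        by (rule integral_complex_of_real)
      finally show ?thesis by (simp add: mult.commute)
    qed
    ultimately have "norm ((deriv ^^ l) \<sigma> 0) * \<bar>LINT x|M. g x * t x ^ l\<bar>
        \<le> fact l * (A * N * q ^ card W) / (\<eta> / 2) ^ l"
      by (simp add: norm_mult)
    moreover have "fact l * c / \<rho> ^ l * \<bar>LINT x|M. g x * t x ^ l\<bar>
        \<le> norm ((deriv ^^ l) \<sigma> 0) * \<bar>LINT x|M. g x * t x ^ l\<bar>"
      using lower by (intro mult_right_mono) auto
    ultimately have "fact l * c / \<rho> ^ l * \<bar>LINT x|M. g x * t x ^ l\<bar>
        \<le> fact l * (A * N * q ^ card W) / (\<eta> / 2) ^ l"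
      by linarith
    hence "c / \<rho> ^ l * \<bar>LINT x|M. g x * t x ^ l\<bar> \<le> A * N * q ^ card W / (\<eta> / 2) ^ l"
      by (simp add: divide_right_mono mult_le_cancel_left_pos mult.assoc flip: times_divide_eq_right)
    hence "(c / \<rho> ^ l * \<bar>LINT x|M. g x * t x ^ l\<bar>) * (\<rho> ^ l / c)
        \<le> (A * N * q ^ card W / (\<eta> / 2) ^ l) * (\<rho> ^ l / c)"
      using c by (intro mult_right_mono) auto
    hence "\<bar>LINT x|M. g x * t x ^ l\<bar> \<le> (A * N * q ^ card W / (\<eta> / 2) ^ l) * (\<rho> ^ l / c)"
      using c by simp
    also have "\<dots> = A / c * (2 * \<rho> / \<eta>) ^ l * q ^ card W * N"
      using \<eta> by (simp add: power_divide power_mult_distrib mult_ac)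
    finally show "\<bar>LINT x|M. g x * t x ^ l\<bar> \<le> A / c * (2 * \<rho> / \<eta>) ^ l * q ^ card W * (LINT x|M. \<bar>g x\<bar>)"
      by (simp add: N_def)
  qed (use A c \<eta> q in auto)
qed

section \<open>Ridge moments on a net of the sphere\<close>

text \<open>The reversed polynomial \<open>u\<^sup>l p(1/u)\<close> has the same modulus on the unit circle, and the maximum
principle applies to it inside the disc.\<close>

lemma polynomial_growth_outside_disc:
  fixes c :: "nat \<Rightarrow> complex"
  assumes bd: "\<And>u. norm u = 1 \<Longrightarrow> norm (\<Sum>j\<le>l. c j * u ^ j) \<le> A" and u: "norm u \<ge> 1"
  shows "norm (\<Sum>j\<le>l. c j * u ^ j) \<le> A * norm u ^ l"
proof -
  have u0: "u \<noteq> 0" using u by auto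
  define S where "S w = (\<Sum>j\<le>l. c j * w ^ (l - j))" for w
  have S_inv: "(\<Sum>j\<le>l. c j * v ^ j) = v ^ l * S (inverse v)" if "v \<noteq> 0" for v
  proof -
    have "v ^ l * inverse v ^ (l - j) = v ^ j" if "j \<le> l" for j
    proof -
      have "v ^ l = v ^ j * v ^ (l - j)" using that by (simp flip: power_add)
      thus ?thesis using \<open>v \<noteq> 0\<close> by (simp add: power_inverse)
    qed
    thus ?thesis by (simp add: S_def sum_distrib_left mult.left_commute)
  qed
  have "norm (S (inverse u)) \<le> A"
  proof (rule maximum_modulus_frontier[of S "cball 0 1"])
    show "S holomorphic_on interior (cball 0 1)" unfolding S_def by (intro holomorphic_intros)
    show "continuous_on (closure (cball 0 1)) S" unfolding S_def by (intro continuous_intros)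
    show "norm (S z) \<le> A" if "z \<in> frontier (cball 0 1)" for z
    proof -
      have z: "norm z = 1" using that by (simp add: frontier_cball)
      hence "norm (\<Sum>j\<le>l. c j * inverse z ^ j) \<le> A" by (intro bd) (simp add: norm_inverse)
      moreover have "(\<Sum>j\<le>l. c j * inverse z ^ j) = inverse z ^ l * S z"
        using S_inv[of "inverse z"] z by fastforce
      ultimately show ?thesis using z by (simp add: norm_mult norm_power norm_inverse)
    qed
    show "inverse u \<in> cball 0 1" using u by (simp add: norm_inverse inverse_le_1_iff)
  qed auto
  thus ?thesis
    unfolding S_inv[OF u0] norm_mult norm_power by (subst mult.commute) (rule mult_right_mono, simp_all)
qed

text \<open>Bernstein's inequality with a non-sharp constant. On the disc of radius \<open>1 + 1/l\<close> the polynomial is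
still bounded by \<open>e A\<close>, so Cauchy's inequality on discs of radius \<open>1/l\<close> bounds its derivative by \<open>e l A\<close>.\<close>

lemma Bernstein_difference_on_disc:
  fixes c :: "nat \<Rightarrow> complex" and l :: nat
  defines "R \<equiv> (\<lambda>u. \<Sum>j\<le>l. c j * u ^ j)"
  assumes bd: "\<And>u. norm u = 1 \<Longrightarrow> norm (R u) \<le> A" and u: "norm u \<le> 1" "norm v \<le> 1"
  shows "norm (R u - R v) \<le> exp 1 * l * A * norm (u - v)"
proof (cases "l = 0")
  case False
  have A0: "A \<ge> 0" using order_trans[OF norm_ge_zero bd[of 1]] by simp
  have holR: "R holomorphic_on X" for X unfolding R_def by (intro holomorphic_intros)
  have disc: "norm (R z) \<le> A" if "norm z \<le> 1" for z
  proof (rule maximum_modulus_frontier[of R "cball 0 1"])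
    show "continuous_on (closure (cball 0 1)) R" using holR by (rule holomorphic_on_imp_continuous_on)
  qed (use holR bd that in \<open>auto simp: frontier_cball\<close>)
  have near: "norm (R z) \<le> exp 1 * A" if z: "norm z \<le> 1 + 1 / l" for z
  proof (cases "norm z \<le> 1")
    case True
    have "A \<le> exp 1 * A" using A0 by (simp add: mult_le_cancel_right1)
    thus ?thesis using disc[OF True] by linarith
  next
    case False
    have "norm (R z) \<le> A * norm z ^ l"
      unfolding R_def using False bd by (intro polynomial_growth_outside_disc) (auto simp: R_def)
    also have "norm z ^ l \<le> exp 1"
    proof -
      have "norm z ^ l \<le> (1 + 1 / l) ^ l" using z by (rule power_mono) simp
      also have "\<dots> \<le> exp (1 / l) ^ l"
        using exp_ge_add_one_self[of "1 / l"] by (intro power_mono) auto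
      also have "\<dots> = exp 1" using \<open>l \<noteq> 0\<close> by (simp flip: exp_of_nat_mult)
      finally show ?thesis .
    qed
    hence "A * norm z ^ l \<le> A * exp 1" using A0 by (rule mult_left_mono)
    finally show ?thesis by (simp add: mult.commute)
  qed
  show ?thesis
  proof (rule field_differentiable_bound[of "cball 0 1" R "deriv R"])
    show "(R has_field_derivative deriv R z) (at z within cball 0 1)" for z
      using holomorphic_derivI[OF holR open_UNIV] has_field_derivative_at_within by blast
    show "norm (deriv R z) \<le> exp 1 * l * A" if z: "z \<in> cball 0 1" for z
    proof -
      have "norm ((deriv ^^ 1) R z) \<le> fact 1 * (exp 1 * A) / (1 / l) ^ 1"
      proof (rule Cauchy_inequality)
        show "continuous_on (cball z (1 / l)) R" using holR by (rule holomorphic_on_imp_continuous_on)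
        show "norm (R x) \<le> exp 1 * A" if "norm (z - x) = 1 / l" for x
          using norm_triangle_sub[of x z] that z by (intro near) (simp add: norm_minus_commute)
      qed (use holR False in auto)
      thus ?thesis by (simp add: mult_ac)
    qed
  qed (use u in auto)
qed (simp add: R_def)

lemma norm_cis_minus_one_le: "norm (cis x - 1) \<le> \<bar>x\<bar>"
proof (rule power2_le_imp_le)
  have "(norm (cis x - 1))\<^sup>2 = (cos x - 1)\<^sup>2 + (sin x)\<^sup>2"
    by (simp add: cmod_power2)
  also have "\<dots> = 2 - 2 * cos (2 * (x / 2))"
    using sin_cos_squared_add[of x] by (simp add: power2_eq_square algebra_simps)
  also have "\<dots> = 4 * \<bar>sin (x / 2)\<bar>\<^sup>2"
    unfolding cos_double_sin by simp
  also have "\<dots> \<le> 4 * \<bar>x / 2\<bar>\<^sup>2"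
    by (intro mult_left_mono power_mono abs_sin_x_le_abs_x) auto
  finally show "(norm (cis x - 1))\<^sup>2 \<le> \<bar>x\<bar>\<^sup>2" by (simp add: power2_eq_square)
qed simp

lemma integrable_mult_continuous:
  fixes g :: "'a::euclidean_space \<Rightarrow> real" and k :: "'a \<Rightarrow> complex"
  assumes g: "integrable lborel g" and supp: "\<And>x. g x \<noteq> 0 \<Longrightarrow> norm x \<le> \<rho>" and k: "continuous_on UNIV k"
  shows "integrable lborel (\<lambda>x. of_real (g x) * k x)"
proof -
  have "bounded (k ` cball 0 \<rho>)"
    using k by (intro compact_imp_bounded compact_continuous_image) (auto intro: continuous_on_subset)
  then obtain B where B: "\<And>x. norm x \<le> \<rho> \<Longrightarrow> norm (k x) \<le> B"
    unfolding bounded_iff by (metis imageI mem_cball_0)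
  have [measurable]: "g \<in> borel_measurable borel" "k \<in> borel_measurable borel"
    using g borel_measurable_continuous_onI[OF k] borel_measurable_integrable[OF g] by auto
  show ?thesis
  proof (rule Bochner_Integration.integrable_bound)
    show "integrable lborel (\<lambda>x. B * \<bar>g x\<bar>)" using g by simp
    show "AE x in lborel. norm (of_real (g x) * k x) \<le> norm (B * \<bar>g x\<bar>)"
    proof (rule AE_I2)
      fix x
      show "norm (of_real (g x) * k x) \<le> norm (B * \<bar>g x\<bar>)"
      proof (cases "g x = 0")
        case False
        have "norm (k x) \<le> \<bar>B\<bar>" using B[OF supp[OF False]] by linarith
        from mult_left_mono[OF this, of "\<bar>g x\<bar>"] show ?thesis
          by (simp add: norm_mult abs_mult mult.commute)
      qed simp
    qed
  qed measurable
qed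

text \<open>With \<open>u = exp(2 \<i> \<phi>)\<close>, the number \<open>cos \<phi> (p \<bullet> x) + sin \<phi> (v \<bullet> x)\<close> is \<open>exp(-\<i> \<phi>)\<close> times a polynomial of
degree \<open>1\<close> in \<open>u\<close>. Along the great circle through \<open>p\<close> and \<open>v\<close> a ridge moment of order \<open>l\<close> is therefore,
up to a factor of modulus \<open>1\<close>, a polynomial of degree \<open>l\<close> in \<open>u\<close>, to which Bernstein's inequality applies.\<close>

lemma ridge_moment_along_great_circle:
  fixes g :: "real^'n \<Rightarrow> real" and l :: nat
  assumes g: "integrable lborel g" and supp: "\<And>x. g x \<noteq> 0 \<Longrightarrow> norm x \<le> \<rho>"
    and pv: "norm p = 1" "norm v = 1" "p \<bullet> v = 0"
    and bd: "\<And>w. norm w = 1 \<Longrightarrow> \<bar>LINT x|lborel. g x * (w \<bullet> x) ^ l\<bar> \<le> A"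
  shows "\<bar>LINT x|lborel. g x * (p \<bullet> x) ^ l\<bar>
    \<le> \<bar>LINT x|lborel. g x * ((cos \<phi> *\<^sub>R p + sin \<phi> *\<^sub>R v) \<bullet> x) ^ l\<bar> + exp 1 * l * A * (2 * \<bar>\<phi>\<bar>)"
proof -
  define \<alpha> \<beta> where "\<alpha> x = (complex_of_real (p \<bullet> x) - \<i> * complex_of_real (v \<bullet> x)) / 2"
    and "\<beta> x = (complex_of_real (p \<bullet> x) + \<i> * complex_of_real (v \<bullet> x)) / 2" for x
  define c where "c j = (LINT x|lborel. of_real (g x) * (of_nat (l choose j) * \<alpha> x ^ j * \<beta> x ^ (l - j)))" for j
  define Q where "Q w = (LINT x|lborel. g x * (w \<bullet> x) ^ l)" for w
  define \<gamma> where "\<gamma> t = cos t *\<^sub>R p + sin t *\<^sub>R v" for t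
  have R: "(\<Sum>j\<le>l. c j * cis (2 * t) ^ j) = cis t ^ l * of_real (Q (\<gamma> t))" for t
  proof -
    have cont: "continuous_on UNIV (\<lambda>x. of_nat (l choose j) * \<alpha> x ^ j * \<beta> x ^ (l - j))" for j
      unfolding \<alpha>_def \<beta>_def by (intro continuous_intros) auto
    have int: "integrable lborel (\<lambda>x. of_real (g x) * (of_nat (l choose j) * \<alpha> x ^ j * \<beta> x ^ (l - j)))" for j
      by (rule integrable_mult_continuous[OF g supp cont])
    have "(\<Sum>j\<le>l. c j * cis (2 * t) ^ j)
        = (\<Sum>j\<le>l. LINT x|lborel. of_real (g x) * (of_nat (l choose j) * \<alpha> x ^ j * \<beta> x ^ (l - j)) * cis (2 * t) ^ j)"
      unfolding c_def by simp
    also have "\<dots> = (LINT x|lborel. (\<Sum>j\<le>l. of_real (g x) * (of_nat (l choose j) * \<alpha> x ^ j * \<beta> x ^ (l - j)) * cis (2 * t) ^ j))"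
      by (intro Bochner_Integration.integral_sum[symmetric] integrable_mult_left int)
    also have "\<dots> = (LINT x|lborel. cis t ^ l * of_real (g x * (\<gamma> t \<bullet> x) ^ l))"
    proof (rule Bochner_Integration.integral_cong[OF refl])
      fix x
      have "(\<Sum>j\<le>l. of_real (g x) * (of_nat (l choose j) * \<alpha> x ^ j * \<beta> x ^ (l - j)) * cis (2 * t) ^ j)
          = of_real (g x) * (\<alpha> x * cis (2 * t) + \<beta> x) ^ l"
        unfolding binomial_ring by (simp add: sum_distrib_left power_mult_distrib mult_ac)
      also have "\<alpha> x * cis (2 * t) + \<beta> x = cis t * of_real (\<gamma> t \<bullet> x)"
      proof -
        have "cis (2 * t) = cis t * cis t" by (simp add: cis_mult)
        moreover have "\<beta> x = cis t * (cis (- t) * \<beta> x)" by (simp add: cis_mult flip: mult.assoc)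
        ultimately have "\<alpha> x * cis (2 * t) + \<beta> x = cis t * (\<alpha> x * cis t + cis (- t) * \<beta> x)"
          by (simp add: algebra_simps)
        also have "\<alpha> x * cis t + cis (- t) * \<beta> x = of_real (\<gamma> t \<bullet> x)"
          by (simp add: complex_eq_iff \<alpha>_def \<beta>_def \<gamma>_def inner_left_distrib field_simps)
        finally show ?thesis .
      qed
      finally show "(\<Sum>j\<le>l. of_real (g x) * (of_nat (l choose j) * \<alpha> x ^ j * \<beta> x ^ (l - j)) * cis (2 * t) ^ j)
          = cis t ^ l * of_real (g x * (\<gamma> t \<bullet> x) ^ l)"
        by (simp add: power_mult_distrib)
    qed
    also have "\<dots> = cis t ^ l * of_real (Q (\<gamma> t))"
      by (simp add: Q_def flip: integral_complex_of_real)
    finally show ?thesis .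
  qed
  have norm_R: "norm (\<Sum>j\<le>l. c j * cis (2 * t) ^ j) = \<bar>Q (\<gamma> t)\<bar>" for t
    unfolding R by (simp add: norm_mult norm_power)
  have \<gamma>: "norm (\<gamma> t) = 1" for t
  proof -
    have "\<gamma> t \<bullet> \<gamma> t = (cos t)\<^sup>2 + (sin t)\<^sup>2"
      using pv unfolding \<gamma>_def inner_left_distrib inner_right_distrib
      by (simp add: inner_commute[of v p] norm_eq_1 power2_eq_square)
    thus ?thesis by (simp add: norm_eq_1)
  qed
  have "norm ((\<Sum>j\<le>l. c j * 1 ^ j) - (\<Sum>j\<le>l. c j * cis (2 * \<phi>) ^ j)) \<le> exp 1 * l * A * norm (1 - cis (2 * \<phi>))"
  proof (rule Bernstein_difference_on_disc)
    fix u :: complex assume "norm u = 1"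
    then obtain s where "u = cis s" using complex_unit_circle by (metis Arg_eq cis_conv_exp mult_1 norm_zero of_real_1 zero_neq_one)
    hence "u = cis (2 * (s / 2))" by simp
    thus "norm (\<Sum>j\<le>l. c j * u ^ j) \<le> A"
      using norm_R[of "s / 2"] bd[OF \<gamma>[of "s / 2"]] by (simp add: Q_def)
  qed auto
  also have "norm (1 - cis (2 * \<phi>)) \<le> 2 * \<bar>\<phi>\<bar>"
    using norm_cis_minus_one_le[of "2 * \<phi>"] by (simp add: norm_minus_commute abs_mult)
  finally have "norm ((\<Sum>j\<le>l. c j * 1 ^ j) - (\<Sum>j\<le>l. c j * cis (2 * \<phi>) ^ j)) \<le> exp 1 * l * A * (2 * \<bar>\<phi>\<bar>)"
    using order_trans[OF abs_ge_zero bd[OF pv(1)]] by (simp add: mult_left_mono)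
  moreover have "norm (\<Sum>j\<le>l. c j * 1 ^ j) = \<bar>Q p\<bar>" using norm_R[of 0] by (simp add: \<gamma>_def)
  moreover have "norm (\<Sum>j\<le>l. c j * 1 ^ j) \<le> norm (\<Sum>j\<le>l. c j * cis (2 * \<phi>) ^ j)
      + norm ((\<Sum>j\<le>l. c j * 1 ^ j) - (\<Sum>j\<le>l. c j * cis (2 * \<phi>) ^ j))"
    by (rule norm_triangle_sub)
  ultimately show ?thesis unfolding norm_R by (simp add: Q_def \<gamma>_def)
qed

text \<open>Let \<open>A\<close> be the supremum of the moment over the sphere. Every point of the sphere is within \<open>h\<close> of the
net, and over that distance the moment changes by at most \<open>A / 2\<close>. Thus \<open>A \<le> \<epsilon> + A / 2\<close>.\<close>

lemma ridge_moment_le_on_net: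
  fixes g :: "real^'n \<Rightarrow> real" and l :: nat
  assumes g: "integrable lborel g" and supp: "\<And>x. g x \<noteq> 0 \<Longrightarrow> norm x \<le> \<rho>"
    and P: "P \<subseteq> sphere 0 1" and net: "\<And>w. w \<in> sphere 0 1 \<Longrightarrow> \<exists>p\<in>P. sphere_dist w p \<le> h"
    and h: "4 * exp 1 * l * h \<le> 1" and small: "\<And>p. p \<in> P \<Longrightarrow> \<bar>LINT x|lborel. g x * (p \<bullet> x) ^ l\<bar> \<le> \<epsilon>"
  shows "\<bar>LINT x|lborel. g x * (\<xi> \<bullet> x) ^ l\<bar> \<le> 2 * \<epsilon> * norm \<xi> ^ l"
proof -
  define Q where "Q w = (LINT x|lborel. g x * (w \<bullet> x) ^ l)" for w
  define A where "A = (SUP w\<in>sphere 0 1. \<bar>Q w\<bar>)"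
  obtain e :: "real^'n" where e: "norm e = 1" using norm_axis_1 by blast
  have int: "integrable lborel (\<lambda>x. g x * (w \<bullet> x) ^ l)" for w
  proof -
    have "integrable lborel (\<lambda>x. complex_of_real (g x) * of_real ((w \<bullet> x) ^ l))"
      by (rule integrable_mult_continuous[OF g supp]) (auto intro!: continuous_intros)
    thus ?thesis by (simp only: of_real_mult[symmetric] complex_of_real_integrable_eq)
  qed
  have bdd: "bdd_above ((\<lambda>w. \<bar>Q w\<bar>) ` sphere 0 1)"
  proof (rule bdd_aboveI2)
    fix w :: "real^'n" assume w: "w \<in> sphere 0 1"
    have "\<bar>Q w\<bar> \<le> (LINT x|lborel. \<bar>g x * (w \<bullet> x) ^ l\<bar>)"
      unfolding Q_def by (rule integral_abs_bound)
    also have "\<dots> \<le> (LINT x|lborel. \<bar>\<rho>\<bar> ^ l * \<bar>g x\<bar>)"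
    proof (rule integral_mono)
      fix x
      show "\<bar>g x * (w \<bullet> x) ^ l\<bar> \<le> \<bar>\<rho>\<bar> ^ l * \<bar>g x\<bar>"
      proof (cases "g x = 0")
        case False
        have "\<bar>w \<bullet> x\<bar> \<le> \<bar>\<rho>\<bar>"
          using Cauchy_Schwarz_ineq2[of w x] w supp[OF False] by simp
        hence "\<bar>w \<bullet> x\<bar> ^ l \<le> \<bar>\<rho>\<bar> ^ l" by (rule power_mono) simp
        from mult_left_mono[OF this, of "\<bar>g x\<bar>"] show ?thesis
          by (simp add: abs_mult power_abs mult.commute)
      qed simp
    qed (use int g in auto)
    finally show "\<bar>Q w\<bar> \<le> (LINT x|lborel. \<bar>\<rho>\<bar> ^ l * \<bar>g x\<bar>)" .
  qed
  have QA: "\<bar>Q w\<bar> \<le> A" if "norm w = 1" for w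
    unfolding A_def using that by (intro cSUP_upper bdd) auto
  have A0: "A \<ge> 0" using order_trans[OF abs_ge_zero QA[OF e]] .
  have step: "\<bar>Q p\<bar> \<le> \<epsilon> + A / 2" if p: "norm p = 1" for p
  proof -
    obtain y where y: "y \<in> P" "sphere_dist p y \<le> h" using net[of p] p by auto
    hence ny: "norm y = 1" using P by auto
    define \<phi> where "\<phi> = arccos (p \<bullet> y)"
    have py: "\<bar>p \<bullet> y\<bar> \<le> 1" using Cauchy_Schwarz_ineq2[of p y] p ny by simp
    have \<phi>: "0 \<le> \<phi>" "\<phi> \<le> h" "cos \<phi> = p \<bullet> y"
      using y py by (auto simp: \<phi>_def sphere_dist_def arccos_lbound cos_arccos)
    define r where "r = y - cos \<phi> *\<^sub>R p"
    have pp: "p \<bullet> p = 1" "y \<bullet> y = 1" using p ny by (simp_all add: norm_eq_1)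
    have nr: "(norm r)\<^sup>2 = (sin \<phi>)\<^sup>2"
      by (simp add: r_def power2_norm_eq_inner inner_diff_left inner_diff_right \<phi>(3) pp inner_commute
          sin_squared_eq) (simp add: power2_eq_square)
    have "\<bar>Q p\<bar> \<le> \<bar>Q y\<bar> + exp 1 * l * A * (2 * \<bar>\<phi>\<bar>)"
    proof (cases "r = 0")
      case True
      hence "sin \<phi> = 0" using nr by simp
      moreover have "\<phi> \<le> pi" using py by (auto simp: \<phi>_def arccos_ubound)
      ultimately have "\<phi> = 0 \<or> \<phi> = pi" using \<phi>(1) sin_gt_zero[of \<phi>] by fastforce
      hence "y = p \<or> y = - p" using True by (auto simp: r_def)
      hence "\<bar>Q y\<bar> = \<bar>Q p\<bar>" 
      proof
        assume "y = - p"
        hence "g x * (y \<bullet> x) ^ l = (-1) ^ l * (g x * (p \<bullet> x) ^ l)" for x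
          by (simp add: power_minus[of "_ \<bullet> _"])
        hence "Q y = (-1) ^ l * Q p"
          by (simp only: Q_def integral_mult_right_zero)
        thus ?thesis by (simp add: abs_mult power_abs)
      qed simp
      thus ?thesis using A0 by simp
    next
      case False
      have "norm r = \<bar>sin \<phi>\<bar>" using nr by (metis norm_ge_zero power2_abs power2_eq_iff_nonneg abs_ge_zero)
      moreover have "sin \<phi> \<ge> 0" using py by (auto simp: \<phi>_def arccos_lbound arccos_ubound intro!: sin_ge_zero)
      ultimately have sr: "sin \<phi> = norm r" by simp
      define v where "v = r /\<^sub>R norm r"
      have "y = cos \<phi> *\<^sub>R p + sin \<phi> *\<^sub>R v" unfolding v_def sr using False by (simp add: r_def)
      moreover have "norm v = 1" using False by (simp add: v_def)
      moreover have "p \<bullet> v = 0" by (simp add: v_def r_def inner_diff_right pp \<phi>(3))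
      ultimately show ?thesis
        using ridge_moment_along_great_circle[OF g supp p _ _ QA[unfolded Q_def], of v \<phi>] by (simp add: Q_def)
    qed
    also have "\<bar>Q y\<bar> \<le> \<epsilon>" using small y by (simp add: Q_def)
    also have "exp 1 * l * A * (2 * \<bar>\<phi>\<bar>) \<le> exp 1 * l * A * (2 * h)"
      using \<phi> A0 by (intro mult_left_mono) auto
    also have "\<dots> = (4 * exp 1 * l * h) * (A / 2)" by simp
    also have "\<dots> \<le> 1 * (A / 2)" using h A0 by (intro mult_right_mono) auto
    finally show ?thesis by simp
  qed
  have "A \<le> \<epsilon> + A / 2"
    unfolding A_def[symmetric] by (subst A_def, rule cSUP_least) (use e step in auto)
  hence A: "A \<le> 2 * \<epsilon>" by simp
  show ?thesis
  proof (cases "\<xi> = 0")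
    case True
    thus ?thesis using QA[OF e] A by (cases "l = 0") (auto simp: Q_def power_0_left)
  next
    case False
    have "\<bar>Q (\<xi> /\<^sub>R norm \<xi>)\<bar> \<le> 2 * \<epsilon>" using QA[of "\<xi> /\<^sub>R norm \<xi>"] False A by simp
    hence "norm \<xi> ^ l * \<bar>Q (\<xi> /\<^sub>R norm \<xi>)\<bar> \<le> norm \<xi> ^ l * (2 * \<epsilon>)" by (rule mult_left_mono) simp
    moreover have "Q \<xi> = norm \<xi> ^ l * Q (\<xi> /\<^sub>R norm \<xi>)"
    proof -
      have "g x * (\<xi> \<bullet> x) ^ l = norm \<xi> ^ l * (g x * ((\<xi> /\<^sub>R norm \<xi>) \<bullet> x) ^ l)" for x
      proof -
        have "\<xi> \<bullet> x = norm \<xi> * ((\<xi> /\<^sub>R norm \<xi>) \<bullet> x)" using False by simp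
        thus ?thesis by (metis power_mult_distrib mult.left_commute)
      qed
      thus ?thesis by (simp only: Q_def integral_mult_right_zero)
    qed
    ultimately show ?thesis by (simp add: Q_def abs_mult mult_ac)
  qed
qed

section \<open>Quasi-uniform and quasi-Chebyshev points\<close>

lemma sin_ge_half: "0 \<le> u \<Longrightarrow> u \<le> 1 \<Longrightarrow> u / 2 \<le> sin (u :: real)"
proof -
  assume u: "0 \<le> u" "u \<le> 1"
  have "(\<lambda>u. sin u - u / 2) 0 \<le> (\<lambda>u. sin u - u / 2) u"
  proof (rule DERIV_nonneg_imp_nondecreasing[of 0 u "\<lambda>u. sin u - u / 2"])
    fix v assume v: "0 \<le> v" "v \<le> u"
    have "cos v \<ge> cos (pi / 3)" using u v pi_gt3 by (intro cos_monotone_0_pi_le) auto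
    hence "cos v - 1 / 2 \<ge> 0" by (simp add: cos_60)
    moreover have "((\<lambda>u. sin u - u / 2) has_real_derivative cos v - 1 / 2) (at v)"
      by (auto intro!: derivative_eq_intros)
    ultimately show "\<exists>y. ((\<lambda>u. sin u - u / 2) has_real_derivative y) (at v) \<and> 0 \<le> y" by blast
  qed (use u in auto)
  thus ?thesis by simp
qed

text \<open>The balls of radius \<open>s / 2\<close> around the points are disjoint and lie in a shell of thickness \<open>s\<close>
around the sphere, whose volume is only \<open>O(s)\<close>; this yields the exponent \<open>DIM('a) - 1\<close>.\<close>

lemma sphere_packing:
  fixes p :: "'i \<Rightarrow> 'a::euclidean_space" and s :: real
  assumes A: "finite A" and p: "\<And>i. i \<in> A \<Longrightarrow> norm (p i) = 1" and s: "0 < s" "s \<le> 1"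
    and sep: "\<And>i j. i \<in> A \<Longrightarrow> j \<in> A \<Longrightarrow> i \<noteq> j \<Longrightarrow> dist (p i) (p j) \<ge> s"
  shows "card A * s ^ (DIM('a) - 1) \<le> DIM('a) * 2 ^ (2 * DIM('a))"
proof -
  define d where "d = DIM('a)"
  have d: "d \<ge> 1" using DIM_positive[where 'a = 'a] unfolding d_def by linarith
  define V where "V = unit_ball_vol (real d)"
  have V: "V > 0" by (simp add: V_def)
  define U where "U = (\<Union>i\<in>A. ball (p i) (s / 2))"
  have cb: "measure lborel (ball (x :: 'a) r) = V * r ^ d" if "r \<ge> 0" for x r
    using content_ball[OF that, of x] by (simp add: V_def d_def)
  have fin: "emeasure lborel (ball (x::'a) r) < \<infinity>" for x r
    by (rule emeasure_lborel_ball_finite)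
  have Uopen: "open U" unfolding U_def by auto
  have U: "measure lborel U = card A * (V * (s / 2) ^ d)"
  proof -
    have "disjoint_family_on (\<lambda>i. ball (p i) (s / 2)) A"
    proof (unfold disjoint_family_on_def, intro ballI impI)
      fix i j assume "i \<in> A" "j \<in> A" "i \<noteq> j"
      hence "dist (p i) (p j) \<ge> s" by (rule sep)
      thus "ball (p i) (s / 2) \<inter> ball (p j) (s / 2) = {}"
        by (intro disjoint_ballI) simp
    qed
    hence "measure lborel U = (\<Sum>i\<in>A. measure lborel (ball (p i) (s / 2)))"
      unfolding U_def using A by (intro measure_finite_Union) (use fin in \<open>auto simp: less_top\<close>)
    thus ?thesis using s by (simp add: cb)
  qed
  have disj: "U \<inter> ball 0 (1 - s / 2) = {}"
  proof -
    have False if "i \<in> A" "dist (p i) x < s / 2" "norm x < 1 - s / 2" for i x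
      using that p[of i] norm_triangle_sub[of "p i" x] by (simp add: dist_norm)
    thus ?thesis unfolding U_def by auto
  qed
  have sub: "U \<union> ball 0 (1 - s / 2) \<subseteq> ball 0 (1 + s / 2)"
  proof -
    have "norm x < 1 + s / 2" if "i \<in> A" "dist (p i) x < s / 2" for i x
      using that p[of i] norm_triangle_sub[of x "p i"] by (simp add: dist_norm norm_minus_commute)
    thus ?thesis unfolding U_def using s by auto
  qed
  have finU: "emeasure lborel U \<noteq> \<infinity>"
    using emeasure_mono[of U "ball 0 (1 + s / 2)" lborel] sub fin[of 0 "1 + s / 2"]
    by (auto simp: top_unique)
  have "measure lborel U + measure lborel (ball (0::'a) (1 - s / 2)) = measure lborel (U \<union> ball 0 (1 - s / 2))"
    by (rule measure_Union[symmetric]) (use finU fin[of 0 "1 - s / 2"] disj Uopen in auto)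
  also have "\<dots> \<le> measure lborel (ball (0::'a) (1 + s / 2))"
    by (rule measure_mono_fmeasurable[OF sub]) (use Uopen fin[of 0 "1 + s / 2"] in \<open>auto intro!: fmeasurableI\<close>)
  finally have "card A * (V * (s / 2) ^ d) + V * (1 - s / 2) ^ d \<le> V * (1 + s / 2) ^ d"
    unfolding U using s by (simp add: cb)
  hence "V * (card A * (s / 2) ^ d) \<le> V * ((1 + s / 2) ^ d - (1 - s / 2) ^ d)"
    by (simp add: algebra_simps)
  hence "card A * (s / 2) ^ d \<le> (1 + s / 2) ^ d - (1 - s / 2) ^ d"
    using V by simp
  also have "\<dots> = s * (\<Sum>i<d. (1 - s / 2) ^ (d - Suc i) * (1 + s / 2) ^ i)"
    unfolding power_diff_sumr2 by simp
  also have "\<dots> \<le> s * (\<Sum>i<d. 1 * 2 ^ d)"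
  proof (intro mult_left_mono sum_mono mult_mono)
    fix i assume i: "i \<in> {..<d}"
    show "(1 - s / 2) ^ (d - Suc i) \<le> 1" using s by (intro power_le_one) auto
    have "(1 + s / 2) ^ i \<le> 2 ^ i" using s by (intro power_mono) auto
    also have "\<dots> \<le> 2 ^ d" using i by (intro power_increasing) auto
    finally show "(1 + s / 2) ^ i \<le> 2 ^ d" .
  qed (use s in auto)
  also have "\<dots> = s * (d * 2 ^ d)" by simp
  finally have "card A * (s / 2) ^ d \<le> s * (d * 2 ^ d)" .
  moreover have "(s / 2) ^ d = s * s ^ (d - 1) / 2 ^ d"
    using d by (simp add: power_divide flip: power_Suc)
  ultimately have "s * (card A * s ^ (d - 1) / 2 ^ d) \<le> s * (d * 2 ^ d)"
    by (simp add: mult_ac)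
  hence "card A * s ^ (d - 1) / 2 ^ d \<le> d * 2 ^ d" using s by (simp only: mult_le_cancel_left_pos)
  hence "card A * s ^ (d - 1) \<le> d * 2 ^ d * 2 ^ d" by (simp add: pos_divide_le_eq)
  thus ?thesis by (simp add: d_def mult_2 power_add mult.assoc)
qed

lemma dist_ge_sphere_dist:
  assumes xy: "norm x = 1" "norm y = 1" and s: "0 \<le> s" "s \<le> 1" "s \<le> sphere_dist x y"
  shows "dist x y \<ge> s / 2"
proof -
  have xyb: "\<bar>x \<bullet> y\<bar> \<le> 1" using Cauchy_Schwarz_ineq2[of x y] xy by simp
  define \<gamma> where "\<gamma> = arccos (x \<bullet> y)"
  have \<gamma>: "s \<le> \<gamma>" "\<gamma> \<le> pi" "cos \<gamma> = x \<bullet> y"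
    using s xyb by (auto simp: \<gamma>_def sphere_dist_def arccos_ubound cos_arccos)
  have "x \<bullet> y \<le> cos s"
    unfolding \<gamma>(3)[symmetric] using \<gamma> s by (intro cos_monotone_0_pi_le) auto
  hence d: "(dist x y)\<^sup>2 \<ge> 2 - 2 * cos s"
    using xy by (simp add: dist_norm power2_norm_eq_inner inner_diff_left inner_diff_right norm_eq_1 inner_commute)
  have sin_ge: "sin (s / 2) \<ge> s / 4" using sin_ge_half[of "s / 2"] s by simp
  have "(s / 2)\<^sup>2 = 4 * (s / 4)\<^sup>2" by (simp add: power2_eq_square)
  also have "\<dots> \<le> 4 * (sin (s / 2))\<^sup>2" using sin_ge s by (intro mult_left_mono power_mono) auto
  also have "\<dots> = 2 - 2 * cos (2 * (s / 2))" unfolding cos_double_sin by simp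
  also have "\<dots> \<le> (dist x y)\<^sup>2" using d by simp
  finally show ?thesis by (rule power2_le_imp_le) simp
qed

text \<open>By packing, \<open>N m\<close> points, at least of the order of \<open>m ^ (d - 1)\<close>, cannot all be farther apart than
\<open>C / m\<close>, and quasi-uniformity turns a bound on the separation into one on the mesh size.\<close>

lemma quasi_uniform_sphere_mesh:
  fixes \<theta> :: "nat \<Rightarrow> nat \<Rightarrow> real^'n"
  assumes d: "CARD('n) \<ge> 2" and qu: "quasi_uniform (sphere 0 1) sphere_dist N \<theta>"
    and c: "c > 0" "\<And>m. m \<ge> 1 \<Longrightarrow> c * real m ^ (CARD('n) - 1) \<le> real (N m)"
  obtains C where "C > 0" "\<And>m w. real m \<ge> C \<Longrightarrow> w \<in> sphere 0 1
     \<Longrightarrow> \<exists>p\<in>\<theta> m ` {1..N m}. sphere_dist w p \<le> C / real m"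
proof -
  define d where "d = CARD('n)"
  obtain c' where c': "c' > 0" "\<And>m. m \<ge> 1 \<Longrightarrow>
        (SUP x\<in>sphere 0 1. INF j\<in>{1..N m}. ereal (sphere_dist x (\<theta> m j)))
        \<le> ereal c' * (INF (i, j)\<in>{(i, j). i \<in> {1..N m} \<and> j \<in> {1..N m} \<and> i \<noteq> j}.
                       ereal (sphere_dist (\<theta> m i) (\<theta> m j)))"
    using qu unfolding quasi_uniform_def by blast
  have \<theta>: "norm (\<theta> m j) = 1" if "m \<ge> 1" "j \<in> {1..N m}" for m j
    using qu that unfolding quasi_uniform_def by auto
  \<comment> \<open>For points at distance at least \<open>C / (2 m)\<close> the packing bound reads \<open>(C / 2) ^ (d - 1) \<le> Q\<close>, which fails for \<open>C / 2 = Q + 1\<close>.\<close>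
  define Q where "Q = max 1 (d * 2 ^ (2 * d) / c)"
  define C where "C = 2 * (Q + 1)"
  have Q: "Q \<ge> 1" "d * 2 ^ (2 * d) / c \<le> Q" by (simp_all add: Q_def)
  \<comment> \<open>Points farther apart than \<open>C / m\<close> would be fewer than there are.\<close>
  have close: "\<exists>i\<in>{1..N m}. \<exists>j\<in>{1..N m}. i \<noteq> j \<and> sphere_dist (\<theta> m i) (\<theta> m j) \<le> C / m"
    if m: "real m \<ge> C" for m
  proof (rule ccontr)
    assume "\<not> ?thesis"
    hence far: "sphere_dist (\<theta> m i) (\<theta> m j) \<ge> C / m" if "i \<in> {1..N m}" "j \<in> {1..N m}" "i \<noteq> j" for i j
      using that by force
    have m0: "real m > 0" "m \<ge> 1" using m Q by (auto simp: C_def intro: Suc_leI)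
    define s where "s = C / m"
    have s: "0 < s" "s \<le> 1" using m m0 Q by (auto simp: s_def C_def)
    have "real (card {1..N m}) * (s / 2) ^ (DIM(real^'n) - 1) \<le> DIM(real^'n) * 2 ^ (2 * DIM(real^'n))"
    proof (rule sphere_packing[where p = "\<theta> m"])
      show "dist (\<theta> m i) (\<theta> m j) \<ge> s / 2" if "i \<in> {1..N m}" "j \<in> {1..N m}" "i \<noteq> j" for i j
        using far[OF that] s \<theta>[OF m0(2)] that by (intro dist_ge_sphere_dist) (auto simp: s_def)
    qed (use s \<theta>[OF m0(2)] in auto)
    hence "real (N m) * (s / 2) ^ (d - 1) \<le> d * 2 ^ (2 * d)" by (simp add: d_def)
    moreover have "c * real m ^ (d - 1) * (s / 2) ^ (d - 1) \<le> real (N m) * (s / 2) ^ (d - 1)"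
      using c(2)[OF m0(2)] s by (intro mult_right_mono) (auto simp: d_def)
    moreover have "c * real m ^ (d - 1) * (s / 2) ^ (d - 1) = c * (C / 2) ^ (d - 1)"
      using m0 by (simp add: s_def power_divide)
    ultimately have "c * (C / 2) ^ (d - 1) \<le> d * 2 ^ (2 * d)" by linarith
    hence "(C / 2) ^ (d - 1) \<le> d * 2 ^ (2 * d) / c" using c by (simp add: pos_le_divide_eq mult.commute)
    hence "(C / 2) ^ (d - 1) \<le> Q" using Q by linarith
    moreover have "(C / 2) ^ 1 \<le> (C / 2) ^ (d - 1)"
      using Q d by (intro power_increasing) (auto simp: C_def d_def)
    ultimately show False by (simp add: C_def)
  qed
  define C' where "C' = C * max 1 (2 * c')"
  have C': "C > 0" "C \<le> C'" "2 * c' * C \<le> C'"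
    using Q by (auto simp: C'_def C_def mult.commute mult_le_cancel_left1)
  show thesis
  proof (rule that[of C'])
    show "C' > 0" using C' by simp
    fix m :: nat and w :: "real^'n" assume m: "real m \<ge> C'" and w: "w \<in> sphere 0 1"
    have m0: "real m > 0" "m \<ge> 1" "real m \<ge> C" using m C' by (auto intro: Suc_leI)
    obtain i j where ij: "i \<in> {1..N m}" "j \<in> {1..N m}" "i \<noteq> j" "sphere_dist (\<theta> m i) (\<theta> m j) \<le> C / m"
      using close[OF m0(3)] by blast
    have "(INF j\<in>{1..N m}. ereal (sphere_dist w (\<theta> m j)))
        \<le> (SUP x\<in>sphere 0 1. INF j\<in>{1..N m}. ereal (sphere_dist x (\<theta> m j)))"
      using w by (intro SUP_upper)
    also have "\<dots> \<le> ereal c' * (INF (i, j)\<in>{(i, j). i \<in> {1..N m} \<and> j \<in> {1..N m} \<and> i \<noteq> j}.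
                       ereal (sphere_dist (\<theta> m i) (\<theta> m j)))"
      by (rule c'(2)[OF m0(2)])
    also have "\<dots> \<le> ereal c' * ereal (C / m)"
    proof (rule ereal_mult_left_mono)
      have "(INF (i, j)\<in>{(i, j). i \<in> {1..N m} \<and> j \<in> {1..N m} \<and> i \<noteq> j}. ereal (sphere_dist (\<theta> m i) (\<theta> m j)))
          \<le> ereal (sphere_dist (\<theta> m i) (\<theta> m j))"
        by (rule INF_lower2[of "(i, j)"]) (use ij in auto)
      also have "\<dots> \<le> ereal (C / m)" using ij by simp
      finally show "(INF (i, j)\<in>{(i, j). i \<in> {1..N m} \<and> j \<in> {1..N m} \<and> i \<noteq> j}.
          ereal (sphere_dist (\<theta> m i) (\<theta> m j))) \<le> ereal (C / m)" .
    qed (use c' in simp)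
    also have "\<dots> < ereal (C' / m)"
    proof -
      have "c' * C < C'" using C' c' mult_pos_pos[of c' C] by linarith
      thus ?thesis using m0 by (simp add: divide_strict_right_mono)
    qed
    finally show "\<exists>p\<in>\<theta> m ` {1..N m}. sphere_dist w p \<le> C' / real m"
      unfolding INF_less_iff by (auto intro: less_imp_le)
  qed
qed

text \<open>If two of the angles coincided, the separation would be \<open>0\<close>, and so would be the mesh size.\<close>

lemma quasi_chebyshev_distinct:
  assumes qc: "quasi_chebyshev J (\<lambda>m. m) \<omega>" and J: "Inf J < Sup J" and m: "m \<ge> 1"
  shows "inj_on (\<omega> m) {1..m}"
proof -
  obtain \<theta> where \<theta>: "quasi_uniform {0..pi} dist (\<lambda>m. m) \<theta>"
    and \<omega>: "\<And>m j. m \<ge> 1 \<Longrightarrow> j \<in> {1..m} \<Longrightarrow> \<omega> m j = (Inf J + Sup J) / 2 + (Sup J - Inf J) / 2 * cos (\<theta> m j)"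
    using qc unfolding quasi_chebyshev_def by blast
  obtain c where c: "c > 0" "\<And>m. m \<ge> 1 \<Longrightarrow>
        (SUP x\<in>{0..pi}. INF j\<in>{1..m}. ereal (dist x (\<theta> m j)))
        \<le> ereal c * (INF (i, j)\<in>{(i, j). i \<in> {1..m} \<and> j \<in> {1..m} \<and> i \<noteq> j}. ereal (dist (\<theta> m i) (\<theta> m j)))"
    using \<theta> unfolding quasi_uniform_def by blast
  have range: "\<theta> m j \<in> {0..pi}" if "j \<in> {1..m}" for j
    using \<theta> m that unfolding quasi_uniform_def by blast
  show ?thesis
  proof (rule inj_onI, rule ccontr)
    fix i j assume ij: "i \<in> {1..m}" "j \<in> {1..m}" "\<omega> m i = \<omega> m j" "i \<noteq> j"
    hence "cos (\<theta> m i) = cos (\<theta> m j)" using \<omega>[OF m] J by simp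
    hence eq: "\<theta> m i = \<theta> m j" using range ij cos_inj_pi[of "\<theta> m i" "\<theta> m j"] by simp
    have "(INF (i, j)\<in>{(i, j). i \<in> {1..m} \<and> j \<in> {1..m} \<and> i \<noteq> j}. ereal (dist (\<theta> m i) (\<theta> m j))) \<le> 0"
      by (rule INF_lower2[of "(i, j)"]) (use ij eq in auto)
    hence "ereal c * (INF (i, j)\<in>{(i, j). i \<in> {1..m} \<and> j \<in> {1..m} \<and> i \<noteq> j}. ereal (dist (\<theta> m i) (\<theta> m j))) \<le> ereal c * 0"
      using c by (intro ereal_mult_left_mono) auto
    hence sup: "(SUP x\<in>{0..pi}. INF j\<in>{1..m}. ereal (dist x (\<theta> m j))) \<le> 0"
      using c(2)[OF m] by (auto intro: order_trans)
    \<comment> \<open>Then the finitely many points would cover the whole interval.\<close>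
    have "{0..pi} \<subseteq> \<theta> m ` {1..m}"
    proof
      fix x assume "x \<in> {0..pi}"
      hence "(INF j\<in>{1..m}. ereal (dist x (\<theta> m j))) \<le> 0"
        using sup by (meson SUP_upper order_trans)
      moreover have "(INF j\<in>{1..m}. ereal (dist x (\<theta> m j))) \<in> (\<lambda>j. ereal (dist x (\<theta> m j))) ` {1..m}"
        using m by (subst cInf_eq_Min) (auto intro!: Min_in)
      ultimately show "x \<in> \<theta> m ` {1..m}" by (auto simp: dist_le_zero_iff)
    qed
    hence "finite {0..pi}" by (rule finite_subset) simp
    thus False using infinite_Icc[of 0 pi] by simp
  qed
qed

section \<open>Exponentially small Fourier transforms\<close>

lemma power_div_fact_le_exp: "0 \<le> x \<Longrightarrow> x ^ n / fact n \<le> exp (x :: real)"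
proof -
  assume x: "0 \<le> x"
  have "x ^ n / fact n = (\<Sum>k\<in>{n}. x ^ k /\<^sub>R fact k)" by (simp add: field_simps)
  also have "\<dots> \<le> (\<Sum>k. x ^ k /\<^sub>R fact k)"
    using x summable_exp_generic[of x] by (intro sum_le_suminf) (auto simp: field_simps)
  also have "\<dots> = exp x" by (simp add: exp_def)
  finally show ?thesis .
qed

lemma sum_power_div_fact_le_exp: "0 \<le> x \<Longrightarrow> (\<Sum>k\<le>n. x ^ k / fact k) \<le> exp (x :: real)"
proof -
  assume x: "0 \<le> x"
  have "(\<Sum>k\<le>n. x ^ k / fact k) = (\<Sum>k\<le>n. x ^ k /\<^sub>R fact k)" by (simp add: field_simps)
  also have "\<dots> \<le> (\<Sum>k. x ^ k /\<^sub>R fact k)"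
    using x summable_exp_generic[of x] by (intro sum_le_suminf) (auto simp: field_simps)
  also have "\<dots> = exp x" by (simp add: exp_def)
  finally show ?thesis .
qed

text \<open>The remainder is at most \<open>Y\<^bsup>L+1\<^esup> / L!\<close>, and \<open>Y\<^sup>L / L! = e\<^bsup>-L\<^esup> (e Y)\<^sup>L / L!\<close>. So it decays
exponentially as soon as \<open>L\<close> exceeds a fixed multiple of \<open>Y\<close>.\<close>

lemma cis_Taylor_remainder_le:
  assumes y: "\<bar>y\<bar> \<le> Y"
  shows "norm (cis y - (\<Sum>l\<le>L. \<i> ^ l / fact l * of_real (y ^ l))) \<le> exp (4 * Y - real L)"
proof -
  have Y: "Y \<ge> 0" using y by linarith
  have "Y \<le> exp Y" using exp_ge_add_one_self[of Y] by linarith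
  have "norm (exp (\<i> * of_real y) - (\<Sum>l\<le>L. (\<i> * of_real y) ^ l / fact l))
      \<le> exp \<bar>Re (\<i> * of_real y)\<bar> * (norm (\<i> * of_real y)) ^ Suc L / fact L"
    by (rule Taylor_exp)
  also have "\<dots> = \<bar>y\<bar> ^ Suc L / fact L" by (simp add: norm_mult)
  also have "\<dots> \<le> Y ^ Suc L / fact L" using y by (intro divide_right_mono power_mono) auto
  also have "\<dots> = exp (- real L) * Y * ((exp 1 * Y) ^ L / fact L)"
    by (simp add: power_mult_distrib exp_minus flip: exp_of_nat_mult)
  also have "\<dots> \<le> exp (- real L) * exp Y * exp (exp 1 * Y)"
    using Y \<open>Y \<le> exp Y\<close> by (intro mult_mono power_div_fact_le_exp) auto
  also have "\<dots> = exp (Y + exp 1 * Y - real L)" by (simp flip: exp_add)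
  also have "\<dots> \<le> exp (4 * Y - real L)"
    using mult_right_mono[OF exp_le, of Y] Y by simp
  finally show ?thesis
    by (simp add: cis_conv_exp power_mult_distrib mult.commute)
qed

lemma fourier_le_moments:
  fixes g :: "real^'n \<Rightarrow> real"
  assumes g: "integrable lborel g" and supp: "\<And>x. g x \<noteq> 0 \<Longrightarrow> norm x \<le> \<rho>" and \<rho>: "\<rho> \<ge> 0"
    and mom: "\<And>l. l \<le> L \<Longrightarrow> \<bar>LINT x|lborel. g x * (\<xi> \<bullet> x) ^ l\<bar> \<le> E * b ^ l" and b: "b \<ge> 0"
  shows "norm (LINT x|lborel. of_real (g x) * cis (\<xi> \<bullet> x))
    \<le> E * exp b + exp (4 * (norm \<xi> * \<rho>) - real L) * (LINT x|lborel. \<bar>g x\<bar>)"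
proof -
  define p where "p x = (\<Sum>l\<le>L. \<i> ^ l / fact l * of_real ((\<xi> \<bullet> x) ^ l))" for x
  have cis_cont: "continuous_on UNIV (\<lambda>x. cis (\<xi> \<bullet> x))"
    by (intro continuous_intros)
  have int_c: "integrable lborel (\<lambda>x. of_real (g x) * cis (\<xi> \<bullet> x))"
    by (rule integrable_mult_continuous[OF g supp cis_cont])
  have int_l: "integrable lborel (\<lambda>x. of_real (g x) * of_real ((\<xi> \<bullet> x) ^ l) :: complex)" for l
    by (rule integrable_mult_continuous[OF g supp]) (auto intro!: continuous_intros)
  have int_p: "integrable lborel (\<lambda>x. of_real (g x) * p x)"
    unfolding p_def by (rule integrable_mult_continuous[OF g supp]) (auto intro!: continuous_intros)
  have E: "E \<ge> 0" using order_trans[OF abs_ge_zero mom[of 0]] by simp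
  have main: "norm (LINT x|lborel. of_real (g x) * p x) \<le> E * exp b"
  proof -
    have "(LINT x|lborel. of_real (g x) * p x)
        = (LINT x|lborel. (\<Sum>l\<le>L. \<i> ^ l / fact l * (of_real (g x) * of_real ((\<xi> \<bullet> x) ^ l))))"
      by (simp add: p_def sum_distrib_left mult_ac)
    also have "\<dots> = (\<Sum>l\<le>L. LINT x|lborel. \<i> ^ l / fact l * (of_real (g x) * of_real ((\<xi> \<bullet> x) ^ l)))"
      by (intro Bochner_Integration.integral_sum integrable_mult_right int_l)
    also have "\<dots> = (\<Sum>l\<le>L. \<i> ^ l / fact l * of_real (LINT x|lborel. g x * (\<xi> \<bullet> x) ^ l))"
      by (simp only: integral_mult_right_zero of_real_mult[symmetric] integral_complex_of_real)
    finally have "norm (LINT x|lborel. of_real (g x) * p x)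
        \<le> (\<Sum>l\<le>L. norm (\<i> ^ l / fact l * complex_of_real (LINT x|lborel. g x * (\<xi> \<bullet> x) ^ l)))"
      by (simp only: norm_sum)
    also have "\<dots> \<le> (\<Sum>l\<le>L. E * (b ^ l / fact l))"
    proof (rule sum_mono)
      fix l assume "l \<in> {..L}"
      hence "\<bar>LINT x|lborel. g x * (\<xi> \<bullet> x) ^ l\<bar> / fact l \<le> E * b ^ l / fact l"
        by (intro divide_right_mono mom) auto
      thus "norm (\<i> ^ l / fact l * complex_of_real (LINT x|lborel. g x * (\<xi> \<bullet> x) ^ l)) \<le> E * (b ^ l / fact l)"
        by (simp add: norm_mult norm_divide norm_power)
    qed
    also have "\<dots> = E * (\<Sum>l\<le>L. b ^ l / fact l)" by (simp add: sum_distrib_left)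
    also have "\<dots> \<le> E * exp b" using sum_power_div_fact_le_exp[OF b] E by (rule mult_left_mono)
    finally show ?thesis .
  qed
  have rem: "norm (LINT x|lborel. of_real (g x) * (cis (\<xi> \<bullet> x) - p x))
      \<le> exp (4 * (norm \<xi> * \<rho>) - real L) * (LINT x|lborel. \<bar>g x\<bar>)"
  proof -
    have int: "integrable lborel (\<lambda>x. of_real (g x) * (cis (\<xi> \<bullet> x) - p x))"
      using int_c int_p by (simp add: right_diff_distrib)
    have "norm (LINT x|lborel. of_real (g x) * (cis (\<xi> \<bullet> x) - p x))
        \<le> (LINT x|lborel. norm (of_real (g x) * (cis (\<xi> \<bullet> x) - p x)))"
      by (rule integral_norm_bound)
    also have "\<dots> \<le> (LINT x|lborel. exp (4 * (norm \<xi> * \<rho>) - real L) * \<bar>g x\<bar>)"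
    proof (rule integral_mono[OF integrable_norm[OF int]])
      fix x
      show "norm (of_real (g x) * (cis (\<xi> \<bullet> x) - p x)) \<le> exp (4 * (norm \<xi> * \<rho>) - real L) * \<bar>g x\<bar>"
      proof (cases "g x = 0")
        case False
        have "\<bar>\<xi> \<bullet> x\<bar> \<le> norm \<xi> * norm x" by (rule Cauchy_Schwarz_ineq2)
        also have "\<dots> \<le> norm \<xi> * \<rho>" using supp[OF False] by (rule mult_left_mono) simp
        finally have "norm (cis (\<xi> \<bullet> x) - p x) \<le> exp (4 * (norm \<xi> * \<rho>) - real L)"
          unfolding p_def by (rule cis_Taylor_remainder_le)
        from mult_left_mono[OF this, of "\<bar>g x\<bar>"] show ?thesis by (simp add: norm_mult mult.commute)
      qed simp
    qed (use g in simp)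
    finally show ?thesis by simp
  qed
  have "(LINT x|lborel. of_real (g x) * cis (\<xi> \<bullet> x))
      = (LINT x|lborel. of_real (g x) * p x) + (LINT x|lborel. of_real (g x) * (cis (\<xi> \<bullet> x) - p x))"
    using int_c int_p by (simp add: right_diff_distrib)
  thus ?thesis using norm_triangle_le[OF add_mono[OF main rem]] by simp
qed

text \<open>The orders \<open>l \<le> L\<close> of the moments that enter are limited to \<open>\<epsilon> m\<close>, where \<open>\<epsilon>\<close> is determined by the mesh
size of the directions. The radius \<open>\<kappa> m\<close> is then chosen so small that the Taylor remainder of degree
\<open>L\<close> decays exponentially and that the growth \<open>exp(B |\<xi>|)\<close>, caused by the factors \<open>B\<^sup>l\<close>, uses up only half of
the gain \<open>q\<^sup>m\<close>.\<close>

lemma fourier_transform_exponentially_small: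
  fixes \<Omega> :: "(real^'n) set" and N :: "nat \<Rightarrow> nat" and \<theta> :: "nat \<Rightarrow> nat \<Rightarrow> real^'n" and \<omega> :: "nat \<Rightarrow> nat \<Rightarrow> real"
    and \<sigma> :: "complex \<Rightarrow> complex" and a c \<rho> :: real
  assumes d: "CARD('n) \<ge> 2" and \<Omega>: "bounded \<Omega>" "\<Omega> \<noteq> {}"
    and hol: "\<sigma> holomorphic_on S" and S: "open S" and J: "compact J" "convex J" "0 \<in> J"
    and JT: "\<And>w \<eta> x. w \<in> J \<Longrightarrow> \<eta> \<in> sphere 0 1 \<Longrightarrow> x \<in> closure \<Omega> \<Longrightarrow> of_real (w * (\<eta> \<bullet> x)) \<in> S"
    and real: "\<And>w \<eta> x. w \<in> J \<Longrightarrow> \<eta> \<in> sphere 0 1 \<Longrightarrow> x \<in> closure \<Omega> \<Longrightarrow> \<sigma> (of_real (w * (\<eta> \<bullet> x))) \<in> \<real>"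
    and c: "c > 0" "\<rho> > 0" and lower: "\<And>k. norm ((deriv ^^ k) \<sigma> 0) \<ge> fact k * c / \<rho> ^ k"
    and qu: "quasi_uniform (sphere 0 1) sphere_dist N \<theta>"
    and N: "a > 0" "\<And>m. m \<ge> 1 \<Longrightarrow> a * real m ^ (CARD('n) - 1) \<le> real (N m)"
    and \<omega>: "\<And>m. m \<ge> 1 \<Longrightarrow> \<omega> m ` {1..m} \<subseteq> J" "\<And>m. m \<ge> 1 \<Longrightarrow> inj_on (\<omega> m) {1..m}"
  obtains \<kappa> \<gamma> C M :: real where "\<kappa> > 0" "\<gamma> > 0" "C > 0"
    "\<And>m g \<xi>. real m \<ge> M \<Longrightarrow> integrable lborel g \<Longrightarrow> (\<And>x. g x \<noteq> 0 \<Longrightarrow> x \<in> \<Omega>)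
      \<Longrightarrow> (\<And>i j. i \<in> {1..N m} \<Longrightarrow> j \<in> {1..m} \<Longrightarrow>
            (LINT x|lborel. g x * Re (\<sigma> (of_real (\<omega> m j * (\<theta> m i \<bullet> x))))) = 0)
      \<Longrightarrow> norm \<xi> \<le> \<kappa> * m
      \<Longrightarrow> norm (LINT x|lborel. of_real (g x) * cis (\<xi> \<bullet> x)) \<le> C * exp (- \<gamma> * m) * (LINT x|lborel. \<bar>g x\<bar>)"
proof -
  define T where "T = (\<lambda>(\<eta>, x). \<eta> \<bullet> x) ` (sphere 0 1 \<times> closure \<Omega>)"
  have cl: "compact (closure \<Omega>)" using \<Omega> by (simp add: compact_closure)
  have T: "compact T" "T \<noteq> {}"
  proof -
    show "compact T" unfolding T_def split_def using cl
      by (intro compact_continuous_image continuous_intros compact_Times) auto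
    have "axis undefined 1 \<in> sphere (0 :: real^'n) 1" by (simp add: norm_axis_1)
    thus "T \<noteq> {}" unfolding T_def using \<Omega>(2) by auto
  qed
  have JT': "of_real (w * t) \<in> S" and real': "\<sigma> (of_real (w * t)) \<in> \<real>" if "w \<in> J" "t \<in> T" for w t
    using JT real that unfolding T_def by auto
  obtain A B q where AB: "A > 0" "B > 0" "0 < q" "q < 1" and mom:
    "\<And>(M :: (real^'n) measure) g t W l. integrable M g \<Longrightarrow> t \<in> borel_measurable M
       \<Longrightarrow> (\<And>x. x \<in> space M \<Longrightarrow> g x \<noteq> 0 \<Longrightarrow> t x \<in> T) \<Longrightarrow> finite W \<Longrightarrow> W \<subseteq> J
       \<Longrightarrow> (\<And>w. w \<in> W \<Longrightarrow> (LINT x|M. g x * Re (\<sigma> (of_real (w * t x)))) = 0)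
       \<Longrightarrow> \<bar>LINT x|M. g x * t x ^ l\<bar> \<le> A * B ^ l * q ^ card W * (LINT x|M. \<bar>g x\<bar>)"
    by (rule moments_of_orthogonal_function[OF hol S J T JT' real' c lower]) blast+
  obtain H where H: "H > 0" "\<And>m w. real m \<ge> H \<Longrightarrow> w \<in> sphere 0 1
     \<Longrightarrow> \<exists>p\<in>\<theta> m ` {1..N m}. sphere_dist w p \<le> H / real m"
    using quasi_uniform_sphere_mesh[OF d qu N] by blast
  obtain R where R: "R > 0" "\<And>x. x \<in> \<Omega> \<Longrightarrow> norm x \<le> R" using \<Omega>(1) unfolding bounded_pos by auto
  \<comment> \<open>Orders \<open>l \<le> \<epsilon> m\<close> satisfy \<open>4 e l h \<le> 1\<close> for the mesh size \<open>h = H / m\<close>.\<close>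
  define \<epsilon> where "\<epsilon> = 1 / (4 * exp 1 * H)"
  define \<mu> where "\<mu> = - ln q"
  define \<kappa> where "\<kappa> = min (\<epsilon> / (8 * R)) (\<mu> / (2 * B))"
  define \<gamma> where "\<gamma> = min (\<epsilon> / 2) (\<mu> / 2)"
  have \<epsilon>: "\<epsilon> > 0" using H by (simp add: \<epsilon>_def)
  have \<mu>: "\<mu> > 0" using AB by (simp add: \<mu>_def)
  have q: "q ^ m = exp (- \<mu> * m)" for m :: nat
    using AB by (simp add: \<mu>_def exp_of_nat2_mult)
  show thesis
  proof (rule that[of \<kappa> \<gamma> "2 * A + exp 1" "max 1 H"])
    show "\<kappa> > 0" "\<gamma> > 0" "2 * A + exp 1 > 0"
      using \<epsilon> \<mu> R AB by (auto simp: \<kappa>_def \<gamma>_def add_pos_pos)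
    fix m :: nat and g :: "real^'n \<Rightarrow> real" and \<xi> :: "real^'n"
    assume m: "real m \<ge> max 1 H" and g: "integrable lborel g" and supp: "\<And>x. g x \<noteq> 0 \<Longrightarrow> x \<in> \<Omega>"
      and orth: "\<And>i j. i \<in> {1..N m} \<Longrightarrow> j \<in> {1..m} \<Longrightarrow>
            (LINT x|lborel. g x * Re (\<sigma> (of_real (\<omega> m j * (\<theta> m i \<bullet> x))))) = 0"
      and \<xi>: "norm \<xi> \<le> \<kappa> * m"
    have m1: "m \<ge> 1" "real m > 0" "real m \<ge> H" using m by auto
    define n where "n = (LINT x|lborel. \<bar>g x\<bar>)"
    have n: "n \<ge> 0" by (simp add: n_def)
    have supp': "norm x \<le> R" if "g x \<noteq> 0" for x using R(2) supp that by blast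
    have \<theta>: "\<theta> m ` {1..N m} \<subseteq> sphere 0 1" using qu m1 unfolding quasi_uniform_def by auto
    define L where "L = nat \<lfloor>\<epsilon> * m\<rfloor>"
    have L: "real L \<le> \<epsilon> * m" "\<epsilon> * m - 1 \<le> real L" using \<epsilon> m1 by (auto simp: L_def)
    have on_net: "\<bar>LINT x|lborel. g x * (p \<bullet> x) ^ l\<bar> \<le> A * B ^ l * q ^ m * n" if p: "p \<in> \<theta> m ` {1..N m}" for p l
    proof -
      obtain i where i: "i \<in> {1..N m}" "p = \<theta> m i" using p by auto
      have "\<bar>LINT x|lborel. g x * (p \<bullet> x) ^ l\<bar> \<le> A * B ^ l * q ^ card (\<omega> m ` {1..m}) * n"
        unfolding n_def
      proof (rule mom[OF g])
        show "p \<bullet> x \<in> T" if "g x \<noteq> 0" for x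
          using supp[OF that] closure_subset[of \<Omega>] p \<theta> unfolding T_def by (auto intro!: image_eqI[of _ _ "(p, x)"])
        show "(LINT x|lborel. g x * Re (\<sigma> (of_real (w * (p \<bullet> x))))) = 0" if "w \<in> \<omega> m ` {1..m}" for w
          using that orth[OF i(1)] i(2) by auto
      qed (use \<omega>(1)[OF m1(1)] in auto)
      thus ?thesis using \<omega>(2)[OF m1(1)] by (simp add: card_image)
    qed
    have "\<bar>LINT x|lborel. g x * (\<xi> \<bullet> x) ^ l\<bar> \<le> (2 * A * q ^ m * n) * (B * norm \<xi>) ^ l" if l: "l \<le> L" for l
    proof -
      have "4 * exp 1 * real l * (H / m) \<le> 4 * exp 1 * (\<epsilon> * m) * (H / m)"
        using l L m1 H by (intro mult_right_mono mult_left_mono) auto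
      also have "\<dots> = 1" using m1 H by (simp add: \<epsilon>_def)
      finally have "\<bar>LINT x|lborel. g x * (\<xi> \<bullet> x) ^ l\<bar> \<le> 2 * (A * B ^ l * q ^ m * n) * norm \<xi> ^ l"
        using ridge_moment_le_on_net[OF g supp' \<theta> H(2)[OF m1(3)] _ on_net] by blast
      thus ?thesis by (simp add: power_mult_distrib mult_ac)
    qed
    hence "norm (LINT x|lborel. of_real (g x) * cis (\<xi> \<bullet> x))
        \<le> 2 * A * q ^ m * n * exp (B * norm \<xi>) + exp (4 * (norm \<xi> * R) - real L) * n"
      unfolding n_def using R AB by (intro fourier_le_moments[OF g supp']) auto
    also have "2 * A * q ^ m * n * exp (B * norm \<xi>) \<le> 2 * A * n * exp (- \<gamma> * m)"
    proof -
      have "B * norm \<xi> \<le> B * ((\<mu> / (2 * B)) * m)"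
        using \<xi> AB m1 by (intro mult_left_mono order_trans[OF \<xi>] mult_right_mono) (auto simp: \<kappa>_def)
      hence "- \<mu> * m + B * norm \<xi> \<le> - (\<mu> / 2) * m" using AB by simp
      also have "\<dots> \<le> - \<gamma> * m" using m1 by (simp add: \<gamma>_def)
      finally have "exp (- \<mu> * m + B * norm \<xi>) \<le> exp (- \<gamma> * m)" by simp
      hence "2 * A * n * exp (- \<mu> * m + B * norm \<xi>) \<le> 2 * A * n * exp (- \<gamma> * m)"
        using AB n by (intro mult_left_mono) auto
      thus ?thesis unfolding q exp_add by (simp add: mult_ac)
    qed
    also have "exp (4 * (norm \<xi> * R) - real L) * n \<le> exp (1 - \<gamma> * m) * n"
    proof -
      have "norm \<xi> * R \<le> (\<epsilon> / (8 * R)) * m * R"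
        using R m1 by (intro mult_right_mono order_trans[OF \<xi>]) (auto simp: \<kappa>_def)
      hence "4 * (norm \<xi> * R) \<le> \<epsilon> / 2 * m" using R by simp
      moreover have "\<gamma> * m \<le> \<epsilon> / 2 * m" unfolding \<gamma>_def using m1 by (intro mult_right_mono) auto
      ultimately have "4 * (norm \<xi> * R) - real L \<le> 1 - \<gamma> * m" using L by simp
      thus ?thesis using n by (intro mult_right_mono) auto
    qed
    also have "2 * A * n * exp (- \<gamma> * m) + exp (1 - \<gamma> * m) * n = (2 * A + exp 1) * exp (- \<gamma> * m) * n"
      by (simp add: exp_diff exp_minus field_simps)
    finally show "norm (LINT x|lborel. of_real (g x) * cis (\<xi> \<bullet> x))
        \<le> (2 * A + exp 1) * exp (- \<gamma> * m) * (LINT x|lborel. \<bar>g x\<bar>)"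
      by (simp add: n_def)
  qed
qed

section \<open>A nonnegative band-limited kernel\<close>

lemma
  fixes t :: "'a::euclidean_space" and c :: real
  assumes c: "c \<noteq> 0"
  shows nn_integral_lborel_affine:
      "\<And>f. f \<in> borel_measurable borel \<Longrightarrow>
        (\<integral>\<^sup>+x. f x \<partial>lborel) = ennreal (\<bar>c\<bar> ^ DIM('a)) * (\<integral>\<^sup>+x. f (t + c *\<^sub>R x) \<partial>lborel)"
    and integral_lborel_affine:
      "\<And>f :: 'a \<Rightarrow> 'b::{banach,second_countable_topology}. f \<in> borel_measurable borel \<Longrightarrow>
        (LINT x|lborel. f x) = \<bar>c\<bar> ^ DIM('a) *\<^sub>R (LINT x|lborel. f (t + c *\<^sub>R x))"
    and integrable_lborel_affine:
      "\<And>f :: 'a \<Rightarrow> 'b::{banach,second_countable_topology}. f \<in> borel_measurable borel \<Longrightarrow>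
        integrable lborel (\<lambda>x. f (t + c *\<^sub>R x)) \<longleftrightarrow> integrable lborel f"
proof -
  have m: "(\<lambda>x. t + c *\<^sub>R x) \<in> lborel \<rightarrow>\<^sub>M borel" by simp
  show "(\<integral>\<^sup>+x. f x \<partial>lborel) = ennreal (\<bar>c\<bar> ^ DIM('a)) * (\<integral>\<^sup>+x. f (t + c *\<^sub>R x) \<partial>lborel)"
    if [measurable]: "f \<in> borel_measurable borel" for f
    by (subst lborel_affine[OF c, of t])
      (simp add: nn_integral_density nn_integral_distr[OF m] nn_integral_cmult ennreal_power)
  fix f :: "'a \<Rightarrow> 'b" assume f[measurable]: "f \<in> borel_measurable borel"
  show "(LINT x|lborel. f x) = \<bar>c\<bar> ^ DIM('a) *\<^sub>R (LINT x|lborel. f (t + c *\<^sub>R x))"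
    by (subst lborel_affine[OF c, of t])
      (simp add: integral_density integral_distr[OF m])
  have "integrable lborel f \<longleftrightarrow> integrable lborel (\<lambda>x. \<bar>c\<bar> ^ DIM('a) *\<^sub>R f (t + c *\<^sub>R x))"
    by (subst lborel_affine[OF c, of t])
      (simp add: integrable_density integrable_distr_eq[OF m])
  thus "integrable lborel (\<lambda>x. f (t + c *\<^sub>R x)) \<longleftrightarrow> integrable lborel f"
    using c integrable_scaleR_right[of "inverse (\<bar>c\<bar> ^ DIM('a))" lborel "\<lambda>x. \<bar>c\<bar> ^ DIM('a) *\<^sub>R f (t + c *\<^sub>R x)"]
    by auto
qed

lemma nn_integral_inverse_1_plus_square_finite:
  "(\<integral>\<^sup>+t. ennreal (inverse (1 + t\<^sup>2)) \<partial>lborel) < \<infinity>"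
proof -
  let ?f = "\<lambda>t::real. ennreal (inverse (1 + t\<^sup>2))"
  have pos: "1 + x\<^sup>2 > 0" for x :: real by (simp add: add_pos_nonneg)
  have half: "(\<integral>\<^sup>+t. ?f t * indicator {0..} t \<partial>lborel) = ennreal (pi / 2 - arctan 0)"
  proof (rule nn_integral_FTC_atLeast)
    show "(arctan \<longlongrightarrow> pi / 2) at_top" by (rule tendsto_arctan_at_top)
  qed (use pos in \<open>auto intro!: DERIV_arctan less_imp_le\<close>)
  have "(\<integral>\<^sup>+t. ?f t * indicator {..0} t \<partial>lborel) = (\<integral>\<^sup>+t. ?f t * indicator {0..} t \<partial>lborel)"
    by (subst nn_integral_lborel_affine[of "-1" _ 0]) (auto intro!: nn_integral_cong simp: indicator_def)
  hence "(\<integral>\<^sup>+t. ?f t * indicator {..0} t \<partial>lborel) + (\<integral>\<^sup>+t. ?f t * indicator {0..} t \<partial>lborel) < \<infinity>"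
    unfolding half by (simp add: ennreal_add_eq_top less_top)
  moreover have "(\<integral>\<^sup>+t. ?f t \<partial>lborel) \<le> (\<integral>\<^sup>+t. ?f t * indicator {..0} t + ?f t * indicator {0..} t \<partial>lborel)"
    by (intro nn_integral_mono) (auto simp: indicator_def)
  ultimately show ?thesis
    by (subst (asm) nn_integral_add) (auto intro: le_less_trans)
qed

text \<open>A radial majorant of the kernel: \<open>(1 + a\<^sup>2 |y|\<^sup>2)\<^bsup>-p\<^esup>\<close>, concentrated at scale \<open>1 / a\<close>.\<close>

definition decay :: "nat \<Rightarrow> real \<Rightarrow> 'a::real_normed_vector \<Rightarrow> real" where
  "decay p a y = inverse ((1 + (a * norm y)\<^sup>2) ^ p)"

lemma decay_measurable [measurable]: "(decay p a :: 'a::euclidean_space \<Rightarrow> real) \<in> borel_measurable borel"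
  unfolding decay_def by measurable

lemma decay_nonneg [simp]: "decay p a y \<ge> 0"
  by (simp add: decay_def)

lemma decay_antimono: "p \<le> q \<Longrightarrow> decay q a y \<le> decay p a y"
  unfolding decay_def by (intro le_imp_inverse_le power_increasing) (auto simp: add_pos_nonneg)

text \<open>Every power of \<open>a |y|\<close> is worth a power of \<open>a\<close> in the final estimate and is paid for by a lower
exponent of decay.\<close>

lemma decay_mult_power_le:
  assumes "2 * (p - q) \<ge> k" "q \<le> p"
  shows "decay p a y * \<bar>a * norm y\<bar> ^ k \<le> decay q a y"
proof -
  define t where "t = 1 + (a * norm y)\<^sup>2"
  have t: "t \<ge> 1" by (simp add: t_def)
  have "\<bar>a * norm y\<bar> ^ k \<le> sqrt t ^ k"
    by (intro power_mono real_le_rsqrt) (auto simp: t_def)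
  also have "\<dots> \<le> sqrt t ^ (2 * (p - q))" using assms t by (intro power_increasing) auto
  also have "\<dots> = t ^ (p - q)" using t by (simp add: power_mult)
  finally have "inverse (t ^ p) * \<bar>a * norm y\<bar> ^ k \<le> inverse (t ^ p) * t ^ (p - q)"
    using t by (intro mult_left_mono) auto
  also have "t ^ p = t ^ q * t ^ (p - q)" using assms by (simp flip: power_add)
  hence "inverse (t ^ p) * t ^ (p - q) = inverse (t ^ q)" using t by (simp add: field_simps)
  finally show ?thesis by (simp add: decay_def t_def)
qed

text \<open>Since \<open>1 + |y|\<^sup>2\<close> is at least \<open>1 + y\<^sub>b\<^sup>2\<close> for each coordinate, the function with \<open>p = DIM('a)\<close> is bounded
by a product of one-dimensional functions.\<close>

lemma integrable_decay:
  fixes a :: real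
  assumes p: "p \<ge> DIM('a)" and a: "a > 0"
  shows "integrable lborel (decay p a :: 'a::euclidean_space \<Rightarrow> real)"
proof -
  have "(\<integral>\<^sup>+y. ennreal (decay DIM('a) 1 (y :: 'a)) \<partial>lborel)
      \<le> (\<integral>\<^sup>+y. (\<Prod>b\<in>Basis. ennreal (inverse (1 + (y \<bullet> b)\<^sup>2))) \<partial>(lborel :: 'a measure))"
  proof (rule nn_integral_mono)
    fix y :: 'a
    have "(\<Prod>b\<in>(Basis :: 'a set). 1 + (y \<bullet> b)\<^sup>2) \<le> (\<Prod>b\<in>(Basis :: 'a set). 1 + (norm y)\<^sup>2)"
      using Basis_le_norm by (intro prod_mono conjI add_left_mono) (auto simp: add_nonneg_nonneg abs_le_square_iff[symmetric])
    moreover have "(\<Prod>b\<in>(Basis :: 'a set). 1 + (y \<bullet> b)\<^sup>2) > 0" by (intro prod_pos) (auto simp: add_pos_nonneg)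
    ultimately have "decay DIM('a) 1 y \<le> inverse (\<Prod>b\<in>(Basis :: 'a set). 1 + (y \<bullet> b)\<^sup>2)"
      unfolding decay_def by (intro le_imp_inverse_le) auto
    also have "\<dots> = (\<Prod>b\<in>(Basis :: 'a set). inverse (1 + (y \<bullet> b)\<^sup>2))"
      by (rule prod_inversef[symmetric, unfolded o_def])
    finally show "ennreal (decay DIM('a) 1 y) \<le> (\<Prod>b\<in>Basis. ennreal (inverse (1 + (y \<bullet> b)\<^sup>2)))"
      by (subst prod_ennreal) (auto intro: ennreal_leI)
  qed
  also have "\<dots> = (\<Prod>b\<in>(Basis :: 'a set). \<integral>\<^sup>+t. ennreal (inverse (1 + t\<^sup>2)) \<partial>lborel)"
    by (rule nn_integral_lborel_prod) auto
  also have "\<dots> < \<infinity>"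
    using nn_integral_inverse_1_plus_square_finite by (simp add: power_less_top_ennreal)
  finally have "integrable lborel (decay DIM('a) 1 :: 'a \<Rightarrow> real)"
    by (intro integrableI_bounded) auto
  hence "integrable lborel (\<lambda>x. (decay DIM('a) 1 :: 'a \<Rightarrow> real) (0 + a *\<^sub>R x))"
    using a by (subst integrable_lborel_affine) auto
  moreover have "decay DIM('a) 1 (0 + a *\<^sub>R x) = decay DIM('a) a x" for x :: 'a
    using a by (simp add: decay_def)
  ultimately have int: "integrable lborel (decay DIM('a) a :: 'a \<Rightarrow> real)" by simp
  show ?thesis
    by (rule Bochner_Integration.integrable_bound[OF int]) (use decay_antimono[OF p] in auto)
qed

lemma integral_decay_le:
  fixes a :: real
  assumes p: "p \<ge> DIM('a)" and a: "a > 0"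
  shows "(LINT y|lborel. decay p a (y :: 'a)) \<le> (LINT y|lborel. decay DIM('a) 1 (y :: 'a::euclidean_space)) / a ^ DIM('a)"
proof -
  have "(LINT y|lborel. decay p a (y :: 'a)) \<le> (LINT y|lborel. decay DIM('a) a (y :: 'a))"
    using decay_antimono[OF p] integrable_decay[of p a] integrable_decay[of "DIM('a)" a] p a
    by (intro integral_mono) auto
  also have "decay DIM('a) a = (\<lambda>x :: 'a. decay DIM('a) 1 (0 + a *\<^sub>R x))"
    using a by (auto simp: decay_def)
  also have "(LINT y|lborel. decay DIM('a) 1 (0 + a *\<^sub>R y :: 'a)) = (LINT y|lborel. decay DIM('a) 1 (y :: 'a)) / a ^ DIM('a)"
    using a integral_lborel_affine[of a "decay DIM('a) 1" "0 :: 'a"] by (simp add: field_simps)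
  finally show ?thesis .
qed

definition cardinal_sine :: "real \<Rightarrow> real" where
  "cardinal_sine t = (if t = 0 then 1 else sin t / t)"

lemma cardinal_sine_measurable [measurable]: "cardinal_sine \<in> borel_measurable borel"
  unfolding cardinal_sine_def by measurable

lemma cardinal_sine_minus [simp]: "cardinal_sine (- t) = cardinal_sine t"
  by (simp add: cardinal_sine_def)

lemma abs_cardinal_sine_le_1: "\<bar>cardinal_sine t\<bar> \<le> 1"
  using abs_sin_x_le_abs_x[of t] by (simp add: cardinal_sine_def divide_simps)

lemma cardinal_sine_power2_le: "(cardinal_sine t)\<^sup>2 \<le> 2 / (1 + t\<^sup>2)"
proof (cases "\<bar>t\<bar> \<le> 1")
  case True
  have "(cardinal_sine t)\<^sup>2 \<le> 1" using abs_cardinal_sine_le_1 by (simp add: abs_square_le_1)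
  also have "1 \<le> 2 / (1 + t\<^sup>2)" using True by (simp add: abs_square_le_1 add_pos_nonneg pos_le_divide_eq)
  finally show ?thesis .
next
  case False
  hence t: "t \<noteq> 0" "t\<^sup>2 \<ge> 1" using abs_square_less_1[of t] by (auto simp: not_le)
  have "(sin t)\<^sup>2 \<le> 1" by (simp add: abs_square_le_1)
  hence "(cardinal_sine t)\<^sup>2 \<le> 1 / t\<^sup>2" using t by (simp add: cardinal_sine_def power_divide divide_right_mono)
  also have "1 / t\<^sup>2 \<le> 2 / (1 + t\<^sup>2)" using t by (simp add: divide_simps add_pos_nonneg)
  finally show ?thesis .
qed

lemma cardinal_sine_ge_half:
  assumes "\<bar>t\<bar> \<le> 1"
  shows "cardinal_sine t \<ge> 1 / 2"
proof (cases "t = 0")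
  case False
  have "cardinal_sine \<bar>t\<bar> \<ge> 1 / 2"
    using sin_ge_half[of "\<bar>t\<bar>"] assms False by (simp add: cardinal_sine_def field_simps)
  thus ?thesis by (cases "t \<ge> 0") auto
qed (simp add: cardinal_sine_def)

text \<open>The cardinal sine is the average of the frequencies in \<open>[-1, 1]\<close>; this is what makes the kernel
below band-limited.\<close>

lemma cardinal_sine_eq_integral:
  "complex_of_real (cardinal_sine t) = (LINT s|lborel. indicator {-1..1} s *\<^sub>R cis (t * s)) / 2"
proof (cases "t = 0")
  case True
  have "(LINT s|lborel. indicator {-1..1::real} s *\<^sub>R (1 :: complex)) = 2"
    by (simp add: scaleR_conv_of_real)
  thus ?thesis using True by (simp add: cardinal_sine_def)
next
  case False
  have "(LINT s|lborel. indicator {-1..1} s *\<^sub>R cis (t * s)) = cis (t * 1) / (\<i> * t) - cis (t * (-1)) / (\<i> * t)"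
  proof (rule integral_FTC_Icc)
    fix s :: real
    have "((\<lambda>s. exp (\<i> * t * s) / (\<i> * t)) has_field_derivative exp (\<i> * t * of_real s)) (at (of_real s))"
      using False by (auto intro!: derivative_eq_intros)
    hence "((\<lambda>s. exp (\<i> * t * of_real s) / (\<i> * t)) has_vector_derivative exp (\<i> * t * of_real s)) (at s within {-1..1})"
      by (rule has_vector_derivative_real_field)
    thus "((\<lambda>s. cis (t * s) / (\<i> * t)) has_vector_derivative cis (t * s)) (at s within {-1..1})"
      by (simp add: cis_conv_exp mult.assoc)
  qed (auto intro!: continuous_intros)
  also have "\<dots> = of_real (2 * sin t / t)"
    using False by (simp add: complex_eq_iff Re_divide Im_divide power2_eq_square)
  finally show ?thesis using False by (simp add: cardinal_sine_def)
qed

lemma integrable_mult_bounded: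
  fixes g k :: "'a \<Rightarrow> 'b::{real_normed_field,banach,second_countable_topology}"
  assumes g: "integrable M g" and k: "k \<in> borel_measurable M" "\<And>x. x \<in> space M \<Longrightarrow> norm (k x) \<le> B"
  shows "integrable M (\<lambda>x. g x * k x)"
proof (rule Bochner_Integration.integrable_bound)
  show "integrable M (\<lambda>x. B * norm (g x))" using g by simp
  show "(\<lambda>x. g x * k x) \<in> borel_measurable M" using g k(1) by auto
  show "AE x in M. norm (g x * k x) \<le> norm (B * norm (g x))"
  proof (rule AE_I2)
    fix x assume "x \<in> space M"
    hence "norm (k x) \<le> \<bar>B\<bar>" using k(2) abs_ge_self order_trans by blast
    from mult_left_mono[OF this, of "norm (g x)"] show "norm (g x * k x) \<le> norm (B * norm (g x))"
      by (simp add: norm_mult abs_mult mult.commute)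
  qed
qed

text \<open>In essence, the Fourier transform of \<open>k\<close> is a complex measure of total variation at most \<open>1\<close>
supported in the ball of radius \<open>D\<close>. The definition avoids measures and asks for the consequence that
matters: convolutions with \<open>k\<close> are bounded by the values of the Fourier transform in that ball.\<close>

definition band_limited :: "real \<Rightarrow> ('a::euclidean_space \<Rightarrow> real) \<Rightarrow> bool" where
  "band_limited D k \<longleftrightarrow> k \<in> borel_measurable borel \<and> (\<forall>y. \<bar>k y\<bar> \<le> 1) \<and>
     (\<forall>g A z. integrable lborel g \<longrightarrow>
        (\<forall>\<xi>. norm \<xi> \<le> D \<longrightarrow> norm (LINT x|lborel. g x * cis (\<xi> \<bullet> x)) \<le> A) \<longrightarrow>
        norm (LINT x|lborel. g x * complex_of_real (k (z - x))) \<le> A)"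

text \<open>Multiplication by \<open>exp(\<i> a s (e \<bullet> y))\<close> shifts frequencies by at most \<open>a\<close>, and the cardinal sine averages
these factors over \<open>s\<close>.\<close>

lemma band_limited_mult_cardinal_sine:
  fixes k :: "'a::euclidean_space \<Rightarrow> real"
  assumes k: "band_limited D k" and e: "norm e \<le> 1" and a: "a \<ge> 0"
  shows "band_limited (D + a) (\<lambda>y. k y * cardinal_sine (a * (e \<bullet> y)))"
proof -
  have km [measurable]: "k \<in> borel_measurable borel" and k1: "\<And>y. \<bar>k y\<bar> \<le> 1"
    and kf: "\<And>g A z. integrable lborel g \<Longrightarrow>
        (\<And>\<xi>. norm \<xi> \<le> D \<Longrightarrow> norm (LINT x|lborel. g x * cis (\<xi> \<bullet> x)) \<le> A) \<Longrightarrow>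
        norm (LINT x|lborel. g x * complex_of_real (k (z - x))) \<le> A"
    using k unfolding band_limited_def by blast+
  have [measurable]: "cis \<in> borel_measurable borel"
    by (intro borel_measurable_continuous_onI continuous_intros)
  have "norm (LINT x|lborel. g x * complex_of_real (k (z - x) * cardinal_sine (a * (e \<bullet> (z - x))))) \<le> A"
    if g: "integrable lborel g"
      and small: "\<And>\<xi>. norm \<xi> \<le> D + a \<Longrightarrow> norm (LINT x|lborel. g x * cis (\<xi> \<bullet> x)) \<le> A" for g A z
  proof -
    have [measurable]: "g \<in> borel_measurable borel" using borel_measurable_integrable[OF g] by simp
    define F where "F x s = indicator {-1..1} s *\<^sub>R (g x * complex_of_real (k (z - x)) * cis (a * (e \<bullet> (z - x)) * s))"
      for x s
    have Fbd: "norm (F x s) \<le> norm (g x) * indicator {-1..1} s" for x s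
      using k1[of "z - x"] by (auto simp: F_def norm_mult indicator_def mult_le_cancel_left2)
    have Fm [measurable]: "case_prod F \<in> borel_measurable (lborel \<Otimes>\<^sub>M lborel)"
      unfolding F_def split_def by measurable
    have Fs: "integrable lborel (F x)" for x
    proof (rule Bochner_Integration.integrable_bound)
      show "integrable lborel (\<lambda>s. norm (g x) * indicator {-1..1::real} s)" by simp
      show "F x \<in> borel_measurable lborel" unfolding F_def by measurable
    qed (use Fbd in auto)
    have int: "integrable (lborel \<Otimes>\<^sub>M lborel) (case_prod F)"
    proof (rule lborel_pair.Fubini_integrable[OF Fm])
      show "integrable lborel (\<lambda>x. LINT s|lborel. norm (case_prod F (x, s)))"
      proof (rule Bochner_Integration.integrable_bound)
        show "integrable lborel (\<lambda>x. 2 * norm (g x))" using g by simp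
        show "(\<lambda>x. LINT s|lborel. norm (case_prod F (x, s))) \<in> borel_measurable lborel" by measurable
        show "AE x in lborel. norm (LINT s|lborel. norm (case_prod F (x, s))) \<le> norm (2 * norm (g x))"
        proof (rule AE_I2)
          fix x
          have "(LINT s|lborel. norm (F x s)) \<le> (LINT s|lborel. norm (g x) * indicator {-1..1::real} s)"
            using Fs Fbd by (intro integral_mono) auto
          thus "norm (LINT s|lborel. norm (case_prod F (x, s))) \<le> norm (2 * norm (g x))" by simp
        qed
      qed
      show "AE x in lborel. integrable lborel (\<lambda>s. case_prod F (x, s))" using Fs by simp
    qed
    have inner: "norm (LINT x|lborel. F x s) \<le> A * indicator {-1..1} s" for s
    proof (cases "s \<in> {-1..1}")
      case True
      \<comment> \<open>The modulation is absorbed into \<open>g\<close>, to which the hypothesis on \<open>k\<close> is applied.\<close>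
      define g' where "g' x = g x * cis (- (a * s * (e \<bullet> x)))" for x
      have g': "integrable lborel g'"
        unfolding g'_def by (rule integrable_mult_bounded[OF g, of _ 1]) auto
      have "norm (LINT x|lborel. g' x * complex_of_real (k (z - x))) \<le> A"
      proof (rule kf[OF g'])
        fix \<xi> :: 'a assume \<xi>: "norm \<xi> \<le> D"
        have "norm (\<xi> - (a * s) *\<^sub>R e) \<le> norm \<xi> + \<bar>a * s\<bar> * norm e"
          using norm_triangle_ineq4[of \<xi> "(a * s) *\<^sub>R e"] by simp
        also have "\<bar>a * s\<bar> * norm e \<le> a * 1"
          using True a e mult_left_mono[of "\<bar>s\<bar>" 1 a] by (intro mult_mono) (auto simp: abs_mult)
        finally have "norm (LINT x|lborel. g x * cis ((\<xi> - (a * s) *\<^sub>R e) \<bullet> x)) \<le> A"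
          using \<xi> by (intro small) auto
        thus "norm (LINT x|lborel. g' x * cis (\<xi> \<bullet> x)) \<le> A"
          by (simp add: g'_def mult.assoc cis_mult inner_diff_left add.commute)
      qed
      moreover have "(LINT x|lborel. F x s) = cis (a * s * (e \<bullet> z)) * (LINT x|lborel. g' x * complex_of_real (k (z - x)))"
      proof -
        have "F x s = cis (a * s * (e \<bullet> z)) * (g' x * complex_of_real (k (z - x)))" for x
        proof -
          have "cis (a * (e \<bullet> (z - x)) * s) = cis (a * s * (e \<bullet> z)) * cis (- (a * s * (e \<bullet> x)))"
            unfolding cis_mult by (simp add: inner_diff_right algebra_simps)
          thus ?thesis using True by (simp add: F_def g'_def mult_ac)
        qed
        thus ?thesis by simp
      qed
      ultimately show ?thesis using True by (simp add: norm_mult)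
    qed (simp add: F_def)
    have "(LINT x|lborel. g x * complex_of_real (k (z - x) * cardinal_sine (a * (e \<bullet> (z - x)))))
        = (LINT x|lborel. (LINT s|lborel. F x s) / 2)"
    proof (rule Bochner_Integration.integral_cong[OF refl])
      fix x
      have "(LINT s|lborel. F x s) = g x * complex_of_real (k (z - x)) *
          (LINT s|lborel. indicator {-1..1} s *\<^sub>R cis (a * (e \<bullet> (z - x)) * s))"
      proof -
        have "F x s = g x * complex_of_real (k (z - x)) * (indicator {-1..1} s *\<^sub>R cis (a * (e \<bullet> (z - x)) * s))" for s
          by (simp add: F_def)
        thus ?thesis by (simp only: integral_mult_right_zero)
      qed
      thus "g x * complex_of_real (k (z - x) * cardinal_sine (a * (e \<bullet> (z - x)))) = (LINT s|lborel. F x s) / 2"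
        by (simp add: cardinal_sine_eq_integral)
    qed
    also have "\<dots> = (LINT x|lborel. (LINT s|lborel. F x s)) / 2" by simp
    also have "(LINT x|lborel. (LINT s|lborel. F x s)) = (LINT s|lborel. (LINT x|lborel. F x s))"
      by (rule lborel_pair.Fubini_integral[OF int, symmetric])
    finally have "norm (LINT x|lborel. g x * complex_of_real (k (z - x) * cardinal_sine (a * (e \<bullet> (z - x)))))
        = norm (LINT s|lborel. (LINT x|lborel. F x s)) / 2" by (simp only: norm_divide) simp
    also have "\<dots> \<le> (LINT s|lborel. norm (LINT x|lborel. F x s)) / 2"
      by (intro divide_right_mono integral_norm_bound) auto
    also have "\<dots> \<le> (LINT s|lborel. A * indicator {-1..1::real} s) / 2"
    proof (intro divide_right_mono integral_mono)
      show "integrable lborel (\<lambda>s. norm (LINT x|lborel. F x s))"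
      proof (rule Bochner_Integration.integrable_bound)
        show "integrable lborel (\<lambda>s. A * indicator {-1..1::real} s)" by simp
        show "(\<lambda>s. norm (LINT x|lborel. F x s)) \<in> borel_measurable lborel" by measurable
        show "AE s in lborel. norm (norm (LINT x|lborel. F x s)) \<le> norm (A * indicator {-1..1} s)"
          using inner order_trans[OF inner abs_ge_self] by (intro AE_I2) simp
      qed
    qed (use inner in auto)
    also have "\<dots> = A" by simp
    finally show ?thesis .
  qed
  moreover have "\<bar>k y * cardinal_sine (a * (e \<bullet> y))\<bar> \<le> 1" for y
    using k1[of y] abs_cardinal_sine_le_1[of "a * (e \<bullet> y)"] by (simp add: abs_mult mult_le_one)
  ultimately show ?thesis unfolding band_limited_def by simp
qed

lemma band_limited_const_1: "band_limited 0 (\<lambda>y. 1)"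
proof -
  have "norm (LINT x|lborel. g x) \<le> A"
    if "\<And>\<xi>. norm \<xi> \<le> 0 \<Longrightarrow> norm (LINT x|lborel. g x * cis (\<xi> \<bullet> x)) \<le> A" for g and A :: real
    using that[of 0] by simp
  thus ?thesis unfolding band_limited_def by simp
qed

lemma band_limited_mult_cardinal_sine_power:
  fixes k :: "'a::euclidean_space \<Rightarrow> real"
  assumes k: "band_limited D k" and e: "norm e \<le> 1" and a: "a \<ge> 0"
  shows "band_limited (D + n * a) (\<lambda>y. k y * cardinal_sine (a * (e \<bullet> y)) ^ n)"
proof (induction n)
  case (Suc n)
  from band_limited_mult_cardinal_sine[OF Suc e a] show ?case
    by (simp add: algebra_simps)
qed (use k in simp)

text \<open>A Jackson kernel. The even exponent makes it nonnegative, and a large \<open>p\<close> gives any polynomial decay.\<close>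

definition sine_kernel :: "nat \<Rightarrow> real \<Rightarrow> 'a::euclidean_space \<Rightarrow> real" where
  "sine_kernel p a y = (\<Prod>b\<in>Basis. cardinal_sine (a * (b \<bullet> y)) ^ (2 * p))"

lemma sine_kernel_measurable [measurable]: "sine_kernel p a \<in> borel_measurable borel"
  unfolding sine_kernel_def by measurable

lemma sine_kernel_nonneg [simp]: "sine_kernel p a y \<ge> 0"
  unfolding sine_kernel_def power_mult by (intro prod_nonneg) simp

lemma sine_kernel_scale: "sine_kernel p a (y /\<^sub>R j) = sine_kernel p (a / j) y"
  by (simp add: sine_kernel_def field_simps)

lemma band_limited_sine_kernel:
  fixes a :: real
  assumes a: "a \<ge> 0"
  shows "band_limited (DIM('a) * (2 * p * a)) (sine_kernel p a :: 'a::euclidean_space \<Rightarrow> real)"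
proof -
  have "band_limited (card A * (2 * p * a)) (\<lambda>y :: 'a. \<Prod>b\<in>A. cardinal_sine (a * (b \<bullet> y)) ^ (2 * p))"
    if "A \<subseteq> Basis" "finite A" for A
    using that(2,1)
  proof (induction A rule: finite_induct)
    case empty
    show ?case using band_limited_const_1 by simp
  next
    case (insert b A)
    have "norm b \<le> 1" using insert.prems by simp
    from band_limited_mult_cardinal_sine_power[OF insert.IH this a, of "2 * p"] insert
    show ?case by (simp add: algebra_simps)
  qed
  from this[of Basis] show ?thesis by (simp add: sine_kernel_def[abs_def])
qed

lemma sine_kernel_le_decay: "sine_kernel p a (y :: 'a::euclidean_space) \<le> 2 ^ (p * DIM('a)) * decay p a y"
proof -
  have pos: "1 + t\<^sup>2 > 0" for t :: real by (simp add: add_pos_nonneg)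
  have "sine_kernel p a y = (\<Prod>b\<in>Basis. ((cardinal_sine (a * (b \<bullet> y)))\<^sup>2) ^ p)"
    unfolding sine_kernel_def by (simp add: power_mult)
  also have "\<dots> \<le> (\<Prod>b\<in>(Basis :: 'a set). (2 / (1 + (a * (b \<bullet> y))\<^sup>2)) ^ p)"
    by (intro prod_mono conjI power_mono cardinal_sine_power2_le) auto
  also have "\<dots> = 2 ^ (p * DIM('a)) * inverse ((\<Prod>b\<in>(Basis :: 'a set). 1 + (a * (b \<bullet> y))\<^sup>2) ^ p)"
    by (simp only: prod_power_distrib[symmetric] prod_dividef prod_constant power_divide power_mult[symmetric]
        mult.commute[of p]) (simp only: divide_inverse)
  also have "\<dots> \<le> 2 ^ (p * DIM('a)) * inverse ((1 + (a * norm y)\<^sup>2) ^ p)"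
  proof (intro mult_left_mono le_imp_inverse_le power_mono)
    have "(norm y)\<^sup>2 = (\<Sum>b\<in>Basis. (b \<bullet> y)\<^sup>2)"
      unfolding power2_norm_eq_inner by (subst euclidean_inner) (simp add: inner_commute power2_eq_square)
    hence "(a * norm y)\<^sup>2 = (\<Sum>b\<in>Basis. (a * (b \<bullet> y))\<^sup>2)"
      by (simp add: power_mult_distrib sum_distrib_left)
    moreover have "1 + (\<Sum>b\<in>A. (a * (b \<bullet> y))\<^sup>2) \<le> (\<Prod>b\<in>A. 1 + (a * (b \<bullet> y))\<^sup>2)" if "finite A" for A
      using that
    proof (induction A rule: finite_induct)
      case (insert b A)
      let ?t = "(a * (b \<bullet> y))\<^sup>2"
      have "1 \<le> (\<Prod>b\<in>A. 1 + (a * (b \<bullet> y))\<^sup>2)" by (intro prod_ge_1) simp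
      hence "?t \<le> ?t * (\<Prod>b\<in>A. 1 + (a * (b \<bullet> y))\<^sup>2)" by (simp add: mult_le_cancel_left1)
      thus ?case using insert by (simp add: algebra_simps)
    qed simp
    ultimately show "1 + (a * norm y)\<^sup>2 \<le> (\<Prod>b\<in>Basis. 1 + (a * (b \<bullet> y))\<^sup>2)" by simp
  qed (use pos in auto)
  finally show ?thesis by (simp add: decay_def)
qed

lemma integrable_sine_kernel:
  assumes "p \<ge> DIM('a)" "a > 0"
  shows "integrable lborel (sine_kernel p a :: 'a::euclidean_space \<Rightarrow> real)"
proof (rule Bochner_Integration.integrable_bound)
  show "integrable lborel (\<lambda>y :: 'a. 2 ^ (p * DIM('a)) * decay p a y)"
    using integrable_decay[OF assms] by simp
qed (use sine_kernel_le_decay in auto)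

text \<open>On the ball of radius \<open>1 / a\<close> the kernel is bounded below by a constant.\<close>

lemma integral_sine_kernel_ge:
  obtains c :: real where "c > 0"
    "\<And>a. a > 0 \<Longrightarrow> p \<ge> DIM('a) \<Longrightarrow> c / a ^ DIM('a) \<le> (LINT y|lborel. sine_kernel p a (y :: 'a::euclidean_space))"
proof (rule that[of "(1 / 2) ^ (2 * p * DIM('a)) * unit_ball_vol DIM('a)"])
  fix a :: real assume a: "a > 0" and p: "p \<ge> DIM('a)"
  have "(1 / 2) ^ (2 * p * DIM('a)) * unit_ball_vol DIM('a) / a ^ DIM('a)
      = (LINT y|lborel. (1 / 2) ^ (2 * p * DIM('a)) * indicator (ball (0::'a) (1 / a)) y)"
    using a content_ball[of "1 / a" "0 :: 'a"] by (simp add: power_divide)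
  also have "\<dots> \<le> (LINT y|lborel. sine_kernel p a (y :: 'a))"
  proof (rule integral_mono)
    show "integrable lborel (\<lambda>y :: 'a. (1 / 2) ^ (2 * p * DIM('a)) * indicator (ball 0 (1 / a)) y :: real)"
      using emeasure_lborel_ball_finite[of "0::'a" "1 / a"] by (intro integrable_mult_right) (simp add: integrable_indicator_iff)
    show "integrable lborel (sine_kernel p a :: 'a \<Rightarrow> real)" by (rule integrable_sine_kernel[OF p a])
    fix y :: 'a
    show "(1 / 2) ^ (2 * p * DIM('a)) * indicator (ball 0 (1 / a)) y \<le> sine_kernel p a y"
    proof (cases "y \<in> ball 0 (1 / a)")
      case True
      have "(1 / 2) ^ (2 * p) \<le> cardinal_sine (a * (b \<bullet> y)) ^ (2 * p)" if b: "b \<in> Basis" for b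
      proof (intro power_mono cardinal_sine_ge_half)
        have "\<bar>b \<bullet> y\<bar> \<le> norm y" using Basis_le_norm[OF b, of y] by (simp add: inner_commute)
        also have "norm y \<le> 1 / a" using True by simp
        finally show "\<bar>a * (b \<bullet> y)\<bar> \<le> 1" using a by (simp add: abs_mult field_simps)
      qed simp
      hence "(\<Prod>b\<in>(Basis :: 'a set). (1 / 2) ^ (2 * p)) \<le> sine_kernel p a y"
        unfolding sine_kernel_def by (intro prod_mono) auto
      thus ?thesis using True by (simp add: power_mult[symmetric] mult_ac)
    qed simp
  qed
  finally show "(1 / 2) ^ (2 * p * DIM('a)) * unit_ball_vol DIM('a) / a ^ DIM('a)
      \<le> (LINT y|lborel. sine_kernel p a (y :: 'a))" .
qed simp

section \<open>Test functions and their density\<close>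

lemma partial_deriv_eq:
  assumes "(f has_derivative f') (at x)"
  shows "partial_deriv i f x = f' (axis i 1)"
  using frechet_derivative_at[OF assms] by (simp add: partial_deriv_def)

text \<open>The functions \<open>exp(-1/t) t\<^bsup>-n\<^esup>\<close>, extended by \<open>0\<close>. Their derivatives are linear combinations of functions
of the same kind, and so smoothness of everything built from them follows from a closure property.\<close>

definition flat_exp :: "nat \<Rightarrow> real \<Rightarrow> real" where
  "flat_exp n t = (if t > 0 then exp (- 1 / t) / t ^ n else 0)"

lemma flat_exp_le: "flat_exp n t \<le> fact (Suc n) * \<bar>t\<bar>"
proof (cases "t > 0")
  case True
  have "(1 / t) ^ Suc n / fact (Suc n) \<le> exp (1 / t)"
    using True by (intro power_div_fact_le_exp) simp
  hence "1 / t ^ Suc n \<le> fact (Suc n) * exp (1 / t)"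
    by (simp only: power_divide power_one divide_le_eq fact_gt_zero if_True mult.commute)
  hence "exp (- 1 / t) * (1 / t ^ Suc n) \<le> exp (- 1 / t) * (fact (Suc n) * exp (1 / t))"
    by (intro mult_left_mono) auto
  also have "\<dots> = fact (Suc n)" by (simp flip: exp_add)
  finally have "exp (- 1 / t) * (1 / t ^ Suc n) * t \<le> fact (Suc n) * t" using True by (intro mult_right_mono) auto
  moreover have "exp (- 1 / t) * (1 / t ^ Suc n) * t = exp (- 1 / t) / t ^ n" using True by simp
  ultimately show ?thesis using True by (simp add: flat_exp_def)
next
  case False
  have "0 \<le> (fact (Suc n) :: real) * \<bar>t\<bar>" by (intro mult_nonneg_nonneg) auto
  thus ?thesis using False by (simp only: flat_exp_def if_False)
qed

lemma flat_exp_has_derivative: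
  "(flat_exp n has_field_derivative flat_exp (n + 2) t - n * flat_exp (n + 1) t) (at t)"
proof (cases t "0::real" rule: linorder_cases)
  case greater
  have "((\<lambda>t. exp (- 1 / t) / t ^ n) has_field_derivative
      (exp (- 1 / t) * (1 / t\<^sup>2) * t ^ n - exp (- 1 / t) * (n * t ^ (n - 1))) / (t ^ n * t ^ n)) (at t)"
    using greater by (auto intro!: derivative_eq_intros simp: power2_eq_square)
  moreover have "(exp (- 1 / t) * (1 / t\<^sup>2) * t ^ n - exp (- 1 / t) * (n * t ^ (n - 1))) / (t ^ n * t ^ n)
      = flat_exp (n + 2) t - n * flat_exp (n + 1) t"
    using greater by (cases n) (simp_all add: flat_exp_def field_simps power2_eq_square)
  ultimately have "((\<lambda>t. exp (- 1 / t) / t ^ n) has_field_derivative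
      flat_exp (n + 2) t - n * flat_exp (n + 1) t) (at t)" by simp
  thus ?thesis
    by (rule has_field_derivative_transform_within_open[of _ _ _ "{0<..}"]) (use greater in \<open>auto simp: flat_exp_def\<close>)
next
  case less
  have "((\<lambda>t. 0) has_field_derivative flat_exp (n + 2) t - n * flat_exp (n + 1) t) (at t)"
    using less by (simp add: flat_exp_def)
  thus ?thesis
    by (rule has_field_derivative_transform_within_open[of _ _ _ "{..<0}"]) (use less in \<open>auto simp: flat_exp_def\<close>)
next
  case equal
  have "((\<lambda>h. flat_exp n h / h) \<longlongrightarrow> 0) (at 0)"
  proof (rule Lim_null_comparison)
    show "\<forall>\<^sub>F h in at 0. norm (flat_exp n h / h) \<le> fact (Suc (Suc n)) * \<bar>h\<bar>"
    proof (intro always_eventually allI)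
      fix h :: real
      have "norm (flat_exp n h / h) = flat_exp (Suc n) h" by (simp add: flat_exp_def field_simps)
      thus "norm (flat_exp n h / h) \<le> fact (Suc (Suc n)) * \<bar>h\<bar>" using flat_exp_le[of "Suc n" h] by (simp del: fact_Suc)
    qed
    show "((\<lambda>h. fact (Suc (Suc n)) * \<bar>h\<bar> :: real) \<longlongrightarrow> 0) (at 0)"
      by (rule tendsto_eq_intros refl | simp)+
  qed
  thus ?thesis using equal by (simp add: has_field_derivative_iff flat_exp_def)
qed

lemma real_polynomial_function_partial_deriv:
  fixes P :: "real^'n \<Rightarrow> real"
  assumes "real_polynomial_function P"
  shows "(\<forall>x. P differentiable (at x)) \<and> real_polynomial_function (partial_deriv i P)"
  using assms
proof (induction P)
  case (linear f)
  have d: "(f has_derivative f) (at x)" for x using linear by (rule bounded_linear_imp_has_derivative)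
  hence "partial_deriv i f = (\<lambda>x. f (axis i 1))" using partial_deriv_eq[OF d] by auto
  thus ?case using d by (auto simp: differentiable_def)
next
  case (const c)
  have "partial_deriv i (\<lambda>x. c) = (\<lambda>x. 0)" using partial_deriv_eq[OF has_derivative_const] by auto
  thus ?case by auto
next
  case (add f g)
  have "partial_deriv i (\<lambda>x. f x + g x) = (\<lambda>x. partial_deriv i f x + partial_deriv i g x)"
  proof
    fix x
    have "(f has_derivative frechet_derivative f (at x)) (at x)" "(g has_derivative frechet_derivative g (at x)) (at x)"
      using add.IH frechet_derivative_works by blast+
    from partial_deriv_eq[OF has_derivative_add[OF this]]
    show "partial_deriv i (\<lambda>x. f x + g x) x = partial_deriv i f x + partial_deriv i g x"
      by (simp add: partial_deriv_def)
  qed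
  thus ?case using add by auto
next
  case (mult f g)
  have "partial_deriv i (\<lambda>x. f x * g x) = (\<lambda>x. f x * partial_deriv i g x + partial_deriv i f x * g x)"
  proof
    fix x
    have "(f has_derivative frechet_derivative f (at x)) (at x)" "(g has_derivative frechet_derivative g (at x)) (at x)"
      using mult.IH frechet_derivative_works by blast+
    from partial_deriv_eq[OF has_derivative_mult[OF this]]
    show "partial_deriv i (\<lambda>x. f x * g x) x = f x * partial_deriv i g x + partial_deriv i f x * g x"
      by (simp add: partial_deriv_def)
  qed
  thus ?case using mult by (auto intro!: differentiable_mult)
qed

text \<open>A class of differentiable functions that is closed under partial derivatives; its members are
therefore smooth.\<close>

inductive flat_polynomial :: "(real^'n \<Rightarrow> real) \<Rightarrow> (real^'n \<Rightarrow> real) \<Rightarrow> bool" for q where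
  base: "real_polynomial_function P \<Longrightarrow> flat_polynomial q (\<lambda>x. P x * flat_exp n (q x))"
| add: "flat_polynomial q f \<Longrightarrow> flat_polynomial q g \<Longrightarrow> flat_polynomial q (\<lambda>x. f x + g x)"

lemma flat_polynomial_partial_deriv:
  assumes q: "real_polynomial_function q" and "flat_polynomial q f"
  shows "(\<forall>x. f differentiable (at x)) \<and> flat_polynomial q (partial_deriv i f)"
  using assms(2)
proof (induction f)
  case (base P n)
  have P: "real_polynomial_function (partial_deriv i P)" "\<And>x. P differentiable (at x)"
    using real_polynomial_function_partial_deriv[OF base] by auto
  have q': "real_polynomial_function (partial_deriv i q)" "\<And>x. q differentiable (at x)"
    using real_polynomial_function_partial_deriv[OF q] by auto
  have der: "((\<lambda>x. P x * flat_exp n (q x)) has_derivative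
      (\<lambda>h. P x * ((flat_exp (n + 2) (q x) - n * flat_exp (n + 1) (q x)) * frechet_derivative q (at x) h)
        + frechet_derivative P (at x) h * flat_exp n (q x))) (at x)" for x
  proof -
    have dP: "(P has_derivative frechet_derivative P (at x)) (at x)"
      and dq: "(q has_derivative frechet_derivative q (at x)) (at x)"
      using P q' frechet_derivative_works by blast+
    have "((\<lambda>x. flat_exp n (q x)) has_derivative
        (\<lambda>h. (flat_exp (n + 2) (q x) - n * flat_exp (n + 1) (q x)) * frechet_derivative q (at x) h)) (at x)"
      by (rule has_derivative_compose[OF dq flat_exp_has_derivative[unfolded has_field_derivative_def]])
    from has_derivative_mult[OF dP this] show ?thesis .
  qed
  have "partial_deriv i (\<lambda>x. P x * flat_exp n (q x)) = (\<lambda>x. ((P x * partial_deriv i q x) * flat_exp (n + 2) (q x)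
      + ((- real n) * (P x * partial_deriv i q x)) * flat_exp (n + 1) (q x)) + partial_deriv i P x * flat_exp n (q x))"
    using partial_deriv_eq[OF der, of i] by (auto simp: partial_deriv_def algebra_simps)
  moreover have "flat_polynomial q (\<lambda>x. ((P x * partial_deriv i q x) * flat_exp (n + 2) (q x)
      + ((- real n) * (P x * partial_deriv i q x)) * flat_exp (n + 1) (q x)) + partial_deriv i P x * flat_exp n (q x))"
    by (intro flat_polynomial.intros real_polynomial_function.intros base q' P)
  ultimately show ?case using der by (auto simp: differentiable_def)
next
  case (add f g)
  have "partial_deriv i (\<lambda>x. f x + g x) = (\<lambda>x. partial_deriv i f x + partial_deriv i g x)"
  proof
    fix x
    have "(f has_derivative frechet_derivative f (at x)) (at x)" "(g has_derivative frechet_derivative g (at x)) (at x)"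
      using add.IH frechet_derivative_works by blast+
    from partial_deriv_eq[OF has_derivative_add[OF this]]
    show "partial_deriv i (\<lambda>x. f x + g x) x = partial_deriv i f x + partial_deriv i g x"
      by (simp add: partial_deriv_def)
  qed
  thus ?case using add by (auto intro: flat_polynomial.add)
qed

lemma smooth_flat_polynomial:
  assumes "real_polynomial_function q" "flat_polynomial q f"
  shows "smooth f"
proof -
  have "flat_polynomial q (partial_derivs ds f)" for ds
    unfolding partial_derivs_def
    by (induction ds) (use assms flat_polynomial_partial_deriv in auto)
  thus ?thesis using flat_polynomial_partial_deriv[OF assms(1)] unfolding smooth_def by blast
qed

text \<open>Smooth functions supported in the ball of radius \<open>R\<close>, which increase to the indicator of the open ball as
\<open>c\<close> tends to infinity.\<close>

definition bump :: "real \<Rightarrow> real \<Rightarrow> 'a::real_normed_vector \<Rightarrow> real" where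
  "bump R c x = flat_exp 0 (c * (R\<^sup>2 - (norm x)\<^sup>2))"

lemma polynomial_times_bump_test_function:
  fixes P :: "real^'n \<Rightarrow> real"
  assumes P: "real_polynomial_function P" and c: "c > 0" and R: "R > 0"
  shows "(\<lambda>x. P x * bump R c x) \<in> test_functions UNIV"
proof -
  have "real_polynomial_function (\<lambda>x :: real^'n. c * (R\<^sup>2 + (- 1) * (\<Sum>i\<in>UNIV. x $ i * x $ i)))"
    by (intro real_polynomial_function.intros real_polynomial_function_sum bounded_linear_vec_nth) auto
  moreover have "(norm x)\<^sup>2 = (\<Sum>i\<in>UNIV. x $ i * x $ i)" for x :: "real^'n"
    by (simp add: power2_norm_eq_inner inner_vec_def)
  ultimately have q: "real_polynomial_function (\<lambda>x :: real^'n. c * (R\<^sup>2 - (norm x)\<^sup>2))" by simp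
  have "smooth (\<lambda>x. P x * bump R c x)"
    unfolding bump_def by (rule smooth_flat_polynomial[OF q flat_polynomial.base[OF P]])
  moreover have "{x. P x * bump R c x \<noteq> 0} \<subseteq> cball 0 R"
  proof
    fix x :: "real^'n" assume "x \<in> {x. P x * bump R c x \<noteq> 0}"
    hence "c * (R\<^sup>2 - (norm x)\<^sup>2) > 0" by (auto simp: bump_def flat_exp_def split: if_splits)
    hence "(norm x)\<^sup>2 < R\<^sup>2" using c by (simp add: zero_less_mult_iff)
    thus "x \<in> cball 0 R" using R by (simp add: power2_less_imp_less less_imp_le)
  qed
  hence "bounded {x. P x * bump R c x \<noteq> 0}" using bounded_cball bounded_subset by blast
  ultimately show ?thesis by (simp add: test_functions_def compact_closure)
qed

lemma bump_bounds: "0 \<le> bump R c x" "bump R c x \<le> 1"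
  by (simp_all add: bump_def flat_exp_def)

lemma bump_eq_0: "R \<le> norm x \<Longrightarrow> R > 0 \<Longrightarrow> c > 0 \<Longrightarrow> bump R c x = 0"
  by (simp add: bump_def flat_exp_def not_less mult_nonneg_nonpos power_mono)

lemma bump_tendsto_1:
  assumes "norm x < R"
  shows "(\<lambda>n. bump R (real (Suc n)) x) \<longlonglongrightarrow> 1"
proof -
  define q where "q = R\<^sup>2 - (norm x)\<^sup>2"
  have q: "q > 0" unfolding q_def using assms by (simp add: power_strict_mono)
  have "(\<lambda>n. exp (- (1 / q) * inverse (real (Suc n)))) \<longlonglongrightarrow> exp (- (1 / q) * 0)"
    by (intro tendsto_intros LIMSEQ_inverse_real_of_nat)
  moreover have "bump R (real (Suc n)) x = exp (- (1 / q) * inverse (real (Suc n)))" for n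
    using q by (simp add: bump_def flat_exp_def q_def[symmetric] field_simps add_pos_nonneg)
  ultimately show ?thesis by simp
qed

lemma test_function_continuous:
  assumes "\<phi> \<in> test_functions S"
  shows "continuous_on UNIV \<phi>"
proof -
  have "\<phi> differentiable (at x)" for x
  proof -
    have "partial_derivs [] \<phi> differentiable (at x)"
      using assms unfolding test_functions_def smooth_def by blast
    thus ?thesis by (simp add: partial_derivs_def)
  qed
  thus ?thesis
    by (intro continuous_at_imp_continuous_on) (auto intro: differentiable_imp_continuous_within)
qed

lemma continuous_compact_support_square_integrable:
  fixes \<phi> :: "'a::euclidean_space \<Rightarrow> real"
  assumes c: "continuous_on UNIV \<phi>" and b: "bounded {x. \<phi> x \<noteq> 0}"
  shows "square_integrable lborel \<phi>"
proof -
  have K: "compact (closure {x. \<phi> x \<noteq> 0})" using b by (simp add: compact_closure)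
  have int: "integrable lborel (\<lambda>x. indicator (closure {x. \<phi> x \<noteq> 0}) x *\<^sub>R (\<phi> x)\<^sup>2)"
    by (rule borel_integrable_compact[OF K]) (intro continuous_intros continuous_on_subset[OF c], simp)
  have "indicator (closure {x. \<phi> x \<noteq> 0}) x *\<^sub>R (\<phi> x)\<^sup>2 = (\<phi> x)\<^sup>2" for x
    using closure_subset[of "{x. \<phi> x \<noteq> 0}"] by (cases "\<phi> x = 0") (auto simp: subset_iff)
  hence "(\<lambda>x. indicator (closure {x. \<phi> x \<noteq> 0}) x *\<^sub>R (\<phi> x)\<^sup>2) = (\<lambda>x. (\<phi> x)\<^sup>2)" by blast
  with int show ?thesis
    using borel_measurable_continuous_onI[OF c] by (simp only: square_integrable_def) simp
qed

lemma test_function_bounded_support: "\<phi> \<in> test_functions S \<Longrightarrow> bounded {x. \<phi> x \<noteq> 0}"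
  unfolding test_functions_def using compact_imp_bounded bounded_subset closure_subset by blast

lemma test_function_square_integrable: "\<phi> \<in> test_functions S \<Longrightarrow> square_integrable lborel \<phi>"
  by (intro continuous_compact_support_square_integrable test_function_continuous test_function_bounded_support)

text \<open>Density of the test functions in \<open>L\<^sup>2\<close>, in the dual form in which it is used. A truncation \<open>v\<close> of \<open>u\<close>,
bounded and with bounded support, is almost everywhere the limit of uniformly bounded test functions:
\<open>u\<close> is a limit of continuous functions, these are approximated on a ball by polynomials (Stone-Weierstrass),
and the polynomials are cut off by bumps. Testing with them gives \<open>\<parallel>v\<parallel>\<^sup>2 \<le> C \<parallel>v\<parallel>\<close>.\<close>

lemma test_functions_dense:
  fixes u :: "real^'n \<Rightarrow> real"
  assumes u: "square_integrable lborel u" and C: "C \<ge> 0"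
    and test: "\<And>\<phi>. \<phi> \<in> test_functions UNIV \<Longrightarrow> \<bar>LINT x|lborel. u x * \<phi> x\<bar> \<le> C * l2_norm lborel \<phi>"
  shows "l2_norm lborel u \<le> C"
proof -
  have um [measurable]: "u \<in> borel_measurable borel" using u by (simp add: square_integrable_def)
  have "u measurable_on UNIV"
  proof -
    have "u \<in> borel_measurable lebesgue" using um by (simp add: measurable_completion)
    thus ?thesis by (intro lebesgue_measurable_imp_measurable_on_real) (auto simp: lebesgue_on_UNIV_eq)
  qed
  then obtain Z G where Z: "negligible Z" and G: "\<And>n. continuous_on UNIV (G n)"
    and Gu: "\<And>x. x \<notin> Z \<Longrightarrow> (\<lambda>n. G n x) \<longlonglongrightarrow> u x"
    unfolding measurable_on_def by auto
  define B where "B k = real (Suc k)" for k :: nat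
  have B: "B k > 0" for k by (simp add: B_def)
  define clip where "clip k t = max (- B k) (min t (B k))" for k t
  define v where "v k x = (if norm x < B k then clip k (u x) else 0)" for k x
  have clip_le: "\<bar>clip k t\<bar> \<le> B k" "\<bar>clip k t\<bar> \<le> \<bar>t\<bar>" "(clip k t)\<^sup>2 \<le> t * clip k t" for k t
  proof -
    show "\<bar>clip k t\<bar> \<le> B k" "\<bar>clip k t\<bar> \<le> \<bar>t\<bar>" using B[of k] by (auto simp: clip_def)
    show "(clip k t)\<^sup>2 \<le> t * clip k t"
    proof (cases "t < - B k")
      case True
      hence "clip k t = - B k" using B[of k] by (simp add: clip_def)
      thus ?thesis using True B[of k] mult_right_mono[of "B k" "- t" "B k"] by (simp add: power2_eq_square)
    next
      case False
      hence "clip k t = min t (B k)" using B[of k] by (auto simp: clip_def)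
      thus ?thesis using B[of k] by (auto simp: power2_eq_square min_def mult_right_mono)
    qed
  qed
  have v_meas [measurable]: "v k \<in> borel_measurable borel" for k
    unfolding v_def clip_def by measurable
  have v_le: "\<bar>v k x\<bar> \<le> \<bar>u x\<bar>" for k x using clip_le by (simp add: v_def)
  have v_sq: "square_integrable lborel (v k)" for k
    unfolding square_integrable_def
  proof (intro conjI Bochner_Integration.integrable_bound[OF square_integrable_integrable_power2[OF u]] AE_I2)
    show "norm ((v k x)\<^sup>2) \<le> norm ((u x)\<^sup>2)" for x using v_le by (simp add: abs_le_square_iff)
  qed measurable
  have bound: "l2_norm lborel (v k) \<le> C" for k
  proof -
    \<comment> \<open>Polynomial approximations of the clipped continuous approximations of \<open>u\<close>, cut off by bumps.\<close>
    have "\<exists>P. \<forall>n. real_polynomial_function (P n) \<and> (\<forall>x. norm x \<le> B k \<longrightarrow> \<bar>clip k (G n x) - P n x\<bar> < inverse (real (Suc n)))"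
    proof (intro choice allI)
      fix n
      have "continuous_on (cball 0 (B k)) (\<lambda>x. clip k (G n x))"
        unfolding clip_def by (intro continuous_intros continuous_on_subset[OF G]) auto
      from Stone_Weierstrass_real_polynomial_function[OF compact_cball this, of "inverse (real (Suc n))"]
      show "\<exists>P. real_polynomial_function P \<and> (\<forall>x. norm x \<le> B k \<longrightarrow> \<bar>clip k (G n x) - P x\<bar> < inverse (real (Suc n)))"
        by (metis mem_cball_0 inverse_positive_iff_positive of_nat_0_less_iff zero_less_Suc)
    qed
    then obtain P where P: "\<And>n. real_polynomial_function (P n)"
      "\<And>n x. norm x \<le> B k \<Longrightarrow> \<bar>clip k (G n x) - P n x\<bar> < inverse (real (Suc n))" by blast
    define \<phi> where "\<phi> n x = P n x * bump (B k) (real (Suc n)) x" for n x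
    have \<phi>_test: "\<phi> n \<in> test_functions UNIV" for n
      unfolding \<phi>_def by (rule polynomial_times_bump_test_function[OF P(1) _ B]) simp
    have \<phi>_sq: "square_integrable lborel (\<phi> n)" for n by (rule test_function_square_integrable[OF \<phi>_test])
    have \<phi>_m [measurable]: "\<phi> n \<in> borel_measurable borel" for n
      using \<phi>_sq[of n] by (simp add: square_integrable_def)
    define I where "I = (indicator (ball 0 (B k)) :: real^'n \<Rightarrow> real)"
    have I_sq: "square_integrable lborel (\<lambda>x. (B k + 1) * I x)"
    proof -
      have "integrable lborel (indicator (ball (0::real^'n) (B k)) :: _ \<Rightarrow> real)"
        using emeasure_lborel_ball_finite[of "0::real^'n" "B k"] by (simp add: integrable_indicator_iff)
      thus ?thesis by (intro square_integrable_cmult) (simp add: square_integrable_def I_def power2_eq_square flip: indicator_inter_arith)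
    qed
    have \<phi>_le: "\<bar>\<phi> n x\<bar> \<le> (B k + 1) * I x" for n x
    proof (cases "norm x < B k")
      case True
      have "inverse (real (Suc n)) \<le> 1" by (simp add: field_simps)
      hence "\<bar>P n x\<bar> \<le> B k + 1" using P(2)[of x n] True clip_le(1)[of k "G n x"] by linarith
      hence "\<bar>P n x\<bar> * bump (B k) (real (Suc n)) x \<le> (B k + 1) * 1"
        using B[of k] bump_bounds by (intro mult_mono) auto
      thus ?thesis using True by (simp add: \<phi>_def I_def abs_mult abs_of_nonneg[OF bump_bounds(1)])
    next
      case False
      thus ?thesis using bump_eq_0[OF _ B, of k x] by (simp add: \<phi>_def I_def)
    qed
    have \<phi>_lim: "(\<lambda>n. \<phi> n x) \<longlonglongrightarrow> v k x" if x: "x \<notin> Z" for x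
    proof (cases "norm x < B k")
      case True
      have "(\<lambda>n. clip k (G n x)) \<longlonglongrightarrow> clip k (u x)"
        unfolding clip_def by (intro tendsto_intros Gu x)
      moreover have "(\<lambda>n. P n x - clip k (G n x)) \<longlonglongrightarrow> 0"
      proof (rule Lim_null_comparison[OF _ LIMSEQ_inverse_real_of_nat], intro always_eventually allI)
        show "norm (P n x - clip k (G n x)) \<le> inverse (real (Suc n))" for n
          using P(2)[of x n] True by (simp add: abs_minus_commute less_imp_le)
      qed
      ultimately have "(\<lambda>n. (P n x - clip k (G n x)) + clip k (G n x)) \<longlonglongrightarrow> 0 + clip k (u x)"
        by (intro tendsto_add)
      hence "(\<lambda>n. P n x) \<longlonglongrightarrow> clip k (u x)" by simp
      from tendsto_mult[OF this bump_tendsto_1[OF True]] show ?thesis using True by (simp add: \<phi>_def v_def)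
    next
      case False
      thus ?thesis using bump_eq_0[OF _ B, of k x] by (simp add: \<phi>_def v_def)
    qed
    have AE_lim: "AE x in lborel. x \<notin> Z"
    proof -
      have "Z \<in> null_sets lebesgue" using Z by (simp add: negligible_iff_null_sets)
      hence "AE x in lebesgue. x \<notin> Z" by (rule AE_not_in)
      thus ?thesis by (simp add: AE_completion_iff)
    qed
    have lim1: "(\<lambda>n. LINT x|lborel. u x * \<phi> n x) \<longlonglongrightarrow> (LINT x|lborel. u x * v k x)"
    proof (rule integral_dominated_convergence[where w = "\<lambda>x. \<bar>u x * ((B k + 1) * I x)\<bar>"])
      show "integrable lborel (\<lambda>x. \<bar>u x * ((B k + 1) * I x)\<bar>)"
        using square_integrable_mult_integrable[OF u I_sq] by (rule integrable_abs)
      show "AE x in lborel. (\<lambda>n. u x * \<phi> n x) \<longlonglongrightarrow> u x * v k x"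
        using AE_lim by eventually_elim (intro tendsto_intros \<phi>_lim)
      show "AE x in lborel. norm (u x * \<phi> n x) \<le> \<bar>u x * ((B k + 1) * I x)\<bar>" for n
        using \<phi>_le[of n] B[of k] by (intro AE_I2) (simp add: abs_mult I_def mult_left_mono)
    qed measurable
    have lim2: "(\<lambda>n. LINT x|lborel. (\<phi> n x)\<^sup>2) \<longlonglongrightarrow> (LINT x|lborel. (v k x)\<^sup>2)"
    proof (rule integral_dominated_convergence[where w = "\<lambda>x. ((B k + 1) * I x)\<^sup>2"])
      show "integrable lborel (\<lambda>x. ((B k + 1) * I x)\<^sup>2)"
        by (rule square_integrable_integrable_power2[OF I_sq])
      show "AE x in lborel. (\<lambda>n. (\<phi> n x)\<^sup>2) \<longlonglongrightarrow> (v k x)\<^sup>2"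
        using AE_lim by eventually_elim (intro tendsto_intros \<phi>_lim)
      show "AE x in lborel. norm ((\<phi> n x)\<^sup>2) \<le> ((B k + 1) * I x)\<^sup>2" for n
        using power_mono[OF \<phi>_le[of n], of _ 2] by (intro AE_I2) simp
    qed measurable
    have "(LINT x|lborel. u x * v k x) \<le> C * l2_norm lborel (v k)"
    proof (rule LIMSEQ_le[OF lim1])
      show "(\<lambda>n. C * l2_norm lborel (\<phi> n)) \<longlonglongrightarrow> C * l2_norm lborel (v k)"
        unfolding l2_norm_def by (intro tendsto_intros lim2)
      show "\<exists>N. \<forall>n\<ge>N. (LINT x|lborel. u x * \<phi> n x) \<le> C * l2_norm lborel (\<phi> n)"
        using test[OF \<phi>_test] by (auto intro: order_trans[OF abs_ge_self])
    qed
    moreover have "(l2_norm lborel (v k))\<^sup>2 \<le> (LINT x|lborel. u x * v k x)"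
      unfolding l2_norm_power2
      using square_integrable_mult_integrable[OF u v_sq] square_integrable_integrable_power2[OF v_sq] clip_le
      by (intro integral_mono) (auto simp: v_def)
    ultimately have le: "l2_norm lborel (v k) * l2_norm lborel (v k) \<le> C * l2_norm lborel (v k)"
      by (simp add: power2_eq_square)
    show ?thesis
    proof (cases "l2_norm lborel (v k) = 0")
      case True
      thus ?thesis using C by simp
    next
      case False
      hence "l2_norm lborel (v k) > 0" using l2_norm_nonneg[of lborel "v k"] by linarith
      thus ?thesis using le by simp
    qed
  qed
  have "(\<lambda>k. LINT x|lborel. (v k x)\<^sup>2) \<longlonglongrightarrow> (LINT x|lborel. (u x)\<^sup>2)"
  proof (rule integral_dominated_convergence[where w = "\<lambda>x. (u x)\<^sup>2"])
    show "AE x in lborel. (\<lambda>k. (v k x)\<^sup>2) \<longlonglongrightarrow> (u x)\<^sup>2"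
    proof (rule AE_I2)
      fix x
      have "\<forall>\<^sub>F k in sequentially. v k x = u x"
        unfolding eventually_sequentially
      proof (intro exI allI impI)
        fix k assume "nat \<lceil>norm x + \<bar>u x\<bar>\<rceil> \<le> k"
        hence "norm x + \<bar>u x\<bar> < B k" unfolding B_def by linarith
        hence "norm x < B k" "\<bar>u x\<bar> < B k" using norm_ge_zero[of x] abs_ge_zero[of "u x"] by linarith+
        thus "v k x = u x" by (auto simp: v_def clip_def)
      qed
      hence "(\<lambda>k. v k x) \<longlonglongrightarrow> u x" by (rule tendsto_eventually)
      thus "(\<lambda>k. (v k x)\<^sup>2) \<longlonglongrightarrow> (u x)\<^sup>2" by (rule tendsto_power)
    qed
    show "AE x in lborel. norm ((v k x)\<^sup>2) \<le> (u x)\<^sup>2" for k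
      using v_le by (intro AE_I2) (simp add: abs_le_square_iff)
  qed (use square_integrable_integrable_power2[OF u] in auto)
  hence "(\<lambda>k. l2_norm lborel (v k)) \<longlonglongrightarrow> l2_norm lborel u"
    unfolding l2_norm_def by (intro tendsto_intros)
  thus ?thesis using bound by (intro LIMSEQ_le_const2) auto
qed

section \<open>Finite differences and weak derivatives\<close>

lemma partial_derivs_Cons: "partial_derivs (i # ds) \<phi> = partial_deriv i (partial_derivs ds \<phi>)"
  by (simp add: partial_derivs_def)

lemma partial_derivs_append: "partial_derivs (ds @ es) \<phi> = partial_derivs ds (partial_derivs es \<phi>)"
  by (simp add: partial_derivs_def)

lemma partial_derivs_Nil [simp]: "partial_derivs [] \<phi> = \<phi>"
  by (simp add: partial_derivs_def)

lemma test_functionsI: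
  "smooth \<phi> \<Longrightarrow> bounded {x. \<phi> x \<noteq> 0} \<Longrightarrow> \<phi> \<in> test_functions UNIV"
  by (simp add: test_functions_def compact_closure)

lemma test_function_has_derivative:
  assumes "\<phi> \<in> test_functions S"
  shows "(partial_derivs ds \<phi> has_derivative frechet_derivative (partial_derivs ds \<phi>) (at x)) (at x)"
  using assms unfolding test_functions_def smooth_def frechet_derivative_works by blast

lemma partial_derivs_test_function:
  assumes \<phi>: "\<phi> \<in> test_functions UNIV"
  shows "partial_derivs ds \<phi> \<in> test_functions UNIV"
proof (rule test_functionsI)
  show "smooth (partial_derivs ds \<phi>)"
    using \<phi> unfolding test_functions_def smooth_def by (simp flip: partial_derivs_append)
  have "{x. partial_derivs ds \<phi> x \<noteq> 0} \<subseteq> closure {x. \<phi> x \<noteq> 0}"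
  proof (induction ds)
    case (Cons i ds)
    show ?case
    proof
      fix x assume x: "x \<in> {x. partial_derivs (i # ds) \<phi> x \<noteq> 0}"
      show "x \<in> closure {x. \<phi> x \<noteq> 0}"
      proof (rule ccontr)
        assume n: "x \<notin> closure {x. \<phi> x \<noteq> 0}"
        have "((\<lambda>y. 0) has_derivative (\<lambda>h. 0)) (at x)" by simp
        moreover have "open (- closure {x. \<phi> x \<noteq> 0})" by (intro open_Compl closed_closure)
        moreover have "x \<in> - closure {x. \<phi> x \<noteq> 0}" using n by simp
        moreover have "0 = partial_derivs ds \<phi> y" if "y \<in> - closure {x. \<phi> x \<noteq> 0}" for y
        proof (rule ccontr)
          assume "0 \<noteq> partial_derivs ds \<phi> y"
          hence "y \<in> {x. partial_derivs ds \<phi> x \<noteq> 0}" by simp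
          thus False using that Cons.IH by blast
        qed
        ultimately have "(partial_derivs ds \<phi> has_derivative (\<lambda>h. 0)) (at x)"
          by (rule has_derivative_transform_within_open)
        from partial_deriv_eq[OF this, of i] show False using x by (simp add: partial_derivs_Cons)
      qed
    qed
  next
    case Nil
    show ?case unfolding partial_derivs_Nil by (rule closure_subset)
  qed
  thus "bounded {x. partial_derivs ds \<phi> x \<noteq> 0}"
    using test_function_bounded_support[OF \<phi>] bounded_closure bounded_subset by blast
qed

lemma partial_derivs_shift:
  assumes \<phi>: "\<phi> \<in> test_functions UNIV"
  shows "partial_derivs ds (\<lambda>x. \<phi> (x + a)) = (\<lambda>x. partial_derivs ds \<phi> (x + a))"
proof (induction ds)
  case (Cons i ds)
  have "((\<lambda>x. partial_derivs ds \<phi> (x + a)) has_derivative frechet_derivative (partial_derivs ds \<phi>) (at (x + a))) (at x)" for x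
  proof (rule has_derivative_compose[where f = "\<lambda>x. x + a" and f' = "\<lambda>h. h" and g = "partial_derivs ds \<phi>"])
    show "((\<lambda>x. x + a) has_derivative (\<lambda>h. h)) (at x)" by (auto intro!: derivative_eq_intros)
  qed (rule test_function_has_derivative[OF \<phi>])
  hence "partial_deriv i (\<lambda>x. partial_derivs ds \<phi> (x + a)) x = partial_deriv i (partial_derivs ds \<phi>) (x + a)" for x
    unfolding partial_deriv_def[of i "partial_derivs ds \<phi>"] by (rule partial_deriv_eq)
  thus ?case by (simp add: partial_derivs_Cons Cons.IH)
qed simp

lemma shift_test_function:
  assumes \<phi>: "\<phi> \<in> test_functions UNIV"
  shows "(\<lambda>x. \<phi> (x + a)) \<in> test_functions UNIV"
proof (rule test_functionsI)
  have "(\<lambda>x. partial_derivs ds \<phi> (x + a)) differentiable (at x)" for ds x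
  proof (rule differentiableI, rule has_derivative_compose[where f = "\<lambda>x. x + a" and f' = "\<lambda>h. h" and g = "partial_derivs ds \<phi>"])
    show "((\<lambda>x. x + a) has_derivative (\<lambda>h. h)) (at x)" by (auto intro!: derivative_eq_intros)
  qed (rule test_function_has_derivative[OF \<phi>])
  thus "smooth (\<lambda>x. \<phi> (x + a))" unfolding smooth_def partial_derivs_shift[OF \<phi>] by blast
  have "{x. \<phi> (x + a) \<noteq> 0} \<subseteq> (\<lambda>x. x - a) ` {x. \<phi> x \<noteq> 0}"
    by (force intro: image_eqI[of _ _ "_ + a"])
  thus "bounded {x. \<phi> (x + a) \<noteq> 0}"
    using test_function_bounded_support[OF \<phi>] bounded_translation_minus bounded_subset by blast
qed

lemma partial_derivs_diff:
  assumes \<phi>: "\<phi> \<in> test_functions UNIV" and \<psi>: "\<psi> \<in> test_functions UNIV"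
  shows "partial_derivs ds (\<lambda>x. \<phi> x - \<psi> x) = (\<lambda>x. partial_derivs ds \<phi> x - partial_derivs ds \<psi> x)"
proof (induction ds)
  case (Cons i ds)
  have "((\<lambda>x. partial_derivs ds \<phi> x - partial_derivs ds \<psi> x) has_derivative
      (\<lambda>h. frechet_derivative (partial_derivs ds \<phi>) (at x) h - frechet_derivative (partial_derivs ds \<psi>) (at x) h)) (at x)" for x
    by (intro has_derivative_diff test_function_has_derivative[OF \<phi>] test_function_has_derivative[OF \<psi>])
  hence "partial_deriv i (\<lambda>x. partial_derivs ds \<phi> x - partial_derivs ds \<psi> x) x
      = partial_deriv i (partial_derivs ds \<phi>) x - partial_deriv i (partial_derivs ds \<psi>) x" for x
    unfolding partial_deriv_def[of i "partial_derivs ds \<phi>"] partial_deriv_def[of i "partial_derivs ds \<psi>"]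
    by (rule partial_deriv_eq)
  thus ?case by (simp add: partial_derivs_Cons Cons.IH)
qed simp

lemma diff_test_function:
  assumes \<phi>: "\<phi> \<in> test_functions UNIV" and \<psi>: "\<psi> \<in> test_functions UNIV"
  shows "(\<lambda>x. \<phi> x - \<psi> x) \<in> test_functions UNIV"
proof (rule test_functionsI)
  show "smooth (\<lambda>x. \<phi> x - \<psi> x)"
    using \<phi> \<psi> unfolding smooth_def partial_derivs_diff[OF \<phi> \<psi>] test_functions_def
    by (auto intro!: differentiable_diff)
  have "{x. \<phi> x - \<psi> x \<noteq> 0} \<subseteq> {x. \<phi> x \<noteq> 0} \<union> {x. \<psi> x \<noteq> 0}" by auto
  thus "bounded {x. \<phi> x - \<psi> x \<noteq> 0}"
    using test_function_bounded_support[OF \<phi>] test_function_bounded_support[OF \<psi>] bounded_Un bounded_subset by blast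
qed

definition forward_diff :: "'a::plus \<Rightarrow> ('a \<Rightarrow> real) \<Rightarrow> 'a \<Rightarrow> real" where
  "forward_diff h f x = f (x + h) - f x"

lemma forward_diff_test_function:
  "\<phi> \<in> test_functions UNIV \<Longrightarrow> forward_diff h \<phi> \<in> test_functions UNIV"
  unfolding forward_diff_def[abs_def] by (intro diff_test_function shift_test_function)

lemma partial_derivs_forward_diff:
  "\<phi> \<in> test_functions UNIV \<Longrightarrow> partial_derivs ds (forward_diff h \<phi>) = forward_diff h (partial_derivs ds \<phi>)"
  unfolding forward_diff_def[abs_def]
  by (simp add: partial_derivs_diff shift_test_function partial_derivs_shift)

text \<open>The coefficients are signed binomial coefficients. The one at \<open>j = 0\<close> is \<open>\<plusminus>1\<close>, so that \<open>f\<close> can be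
recovered from its difference and its proper translates.\<close>

lemma forward_diff_power_expansion:
  obtains c :: "nat \<Rightarrow> real" where "c 0 = (-1) ^ n"
    "\<And>(f :: 'a::real_vector \<Rightarrow> real) h x. (forward_diff h ^^ n) f x = (\<Sum>j\<le>n. c j * f (x + real j *\<^sub>R h))"
proof -
  have "\<exists>c :: nat \<Rightarrow> real. c 0 = (-1) ^ n \<and>
    (\<forall>(f :: 'a \<Rightarrow> real) h x. (forward_diff h ^^ n) f x = (\<Sum>j\<le>n. c j * f (x + real j *\<^sub>R h)))"
  proof (induction n)
    case 0
    show ?case by (intro exI[of _ "\<lambda>j. 1"]) simp
  next
    case (Suc n)
    then obtain c where c: "c 0 = (-1) ^ n"
      "\<And>(f :: 'a \<Rightarrow> real) h x. (forward_diff h ^^ n) f x = (\<Sum>j\<le>n. c j * f (x + real j *\<^sub>R h))" by blast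
    define c' where "c' j = (if j = 0 then 0 else c (j - 1)) - (if j \<le> n then c j else 0)" for j
    have "(forward_diff h ^^ Suc n) f x = (\<Sum>j\<le>Suc n. c' j * f (x + real j *\<^sub>R h))" for f :: "'a \<Rightarrow> real" and h x
    proof -
      have "(forward_diff h ^^ Suc n) f x = (\<Sum>j\<le>n. c j * f (x + h + real j *\<^sub>R h)) - (\<Sum>j\<le>n. c j * f (x + real j *\<^sub>R h))"
        by (simp add: forward_diff_def[of h "(forward_diff h ^^ n) f"] c(2))
      also have "(\<Sum>j\<le>n. c j * f (x + h + real j *\<^sub>R h)) = (\<Sum>j\<le>n. c j * f (x + real (Suc j) *\<^sub>R h))"
        by (simp add: algebra_simps)
      also have "\<dots> = (\<Sum>j\<le>Suc n. (if j = 0 then 0 else c (j - 1)) * f (x + real j *\<^sub>R h))"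
        by (subst sum.atMost_Suc_shift) simp
      also have "(\<Sum>j\<le>n. c j * f (x + real j *\<^sub>R h)) = (\<Sum>j\<le>Suc n. (if j \<le> n then c j else 0) * f (x + real j *\<^sub>R h))"
        by simp
      finally show ?thesis by (simp only: c'_def left_diff_distrib sum_subtractf)
    qed
    moreover have "c' 0 = (-1) ^ Suc n" using c(1) by (simp add: c'_def)
    ultimately show ?case by blast
  qed
  thus ?thesis using that by blast
qed

lemma square_integrable_shift:
  fixes f :: "'a::euclidean_space \<Rightarrow> real"
  assumes "square_integrable lborel f"
  shows "square_integrable lborel (\<lambda>x. f (x + a))"
proof -
  have [measurable]: "f \<in> borel_measurable borel" using assms by (simp add: square_integrable_def)
  have "integrable lborel (\<lambda>x. (f (x + a))\<^sup>2)"
    using integrable_lborel_affine[of 1 "\<lambda>x. (f x)\<^sup>2" a] assms by (simp add: square_integrable_def add.commute)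
  thus ?thesis by (simp add: square_integrable_def)
qed

lemma integral_shift:
  fixes f :: "'a::euclidean_space \<Rightarrow> real"
  assumes "f \<in> borel_measurable borel"
  shows "(LINT x|lborel. f (x + a)) = (LINT x|lborel. f x)"
  using integral_lborel_affine[of 1 f a] assms by (simp add: add.commute)

lemma l2_norm_shift:
  fixes f :: "'a::euclidean_space \<Rightarrow> real"
  assumes "square_integrable lborel f"
  shows "l2_norm lborel (\<lambda>x. f (x + a)) = l2_norm lborel f"
  using integral_shift[of "\<lambda>x. (f x)\<^sup>2" a] assms unfolding l2_norm_def square_integrable_def
  by (simp add: borel_measurable_power)

lemma square_integrable_forward_diff:
  fixes f :: "'a::euclidean_space \<Rightarrow> real"
  shows "square_integrable lborel f \<Longrightarrow> square_integrable lborel (forward_diff h f)"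
  unfolding forward_diff_def[abs_def] by (intro square_integrable_diff square_integrable_shift)

lemma square_integrable_forward_diff_power:
  fixes f :: "'a::euclidean_space \<Rightarrow> real"
  shows "square_integrable lborel f \<Longrightarrow> square_integrable lborel ((forward_diff h ^^ n) f)"
  by (induction n) (simp_all add: square_integrable_forward_diff)

lemma forward_diff_adjoint:
  fixes f g :: "'a::euclidean_space \<Rightarrow> real"
  assumes f: "square_integrable lborel f" and g: "square_integrable lborel g"
  shows "(LINT x|lborel. forward_diff h f x * g x) = (LINT x|lborel. f x * forward_diff (- h) g x)"
proof -
  have [measurable]: "f \<in> borel_measurable borel" "g \<in> borel_measurable borel"
    using f g by (simp_all add: square_integrable_def)
  have "(LINT x|lborel. f (x + h) * g x) = (LINT x|lborel. f x * g (x + - h))"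
    using integral_shift[of "\<lambda>x. f (x + h) * g x" "- h"] by simp
  thus ?thesis
    unfolding forward_diff_def left_diff_distrib right_diff_distrib
    using square_integrable_mult_integrable[OF square_integrable_shift[OF f, of h] g]
      square_integrable_mult_integrable[OF f g] square_integrable_mult_integrable[OF f square_integrable_shift[OF g, of "- h"]]
    by simp
qed

lemma forward_diff_power_adjoint:
  fixes f g :: "'a::euclidean_space \<Rightarrow> real"
  assumes "square_integrable lborel f" "square_integrable lborel g"
  shows "(LINT x|lborel. (forward_diff h ^^ n) f x * g x) = (LINT x|lborel. f x * (forward_diff (- h) ^^ n) g x)"
  using assms
proof (induction n arbitrary: g)
  case (Suc n)
  have "(LINT x|lborel. (forward_diff h ^^ Suc n) f x * g x)
      = (LINT x|lborel. (forward_diff h ^^ n) f x * forward_diff (- h) g x)"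
    using forward_diff_adjoint[OF square_integrable_forward_diff_power[OF Suc.prems(1)] Suc.prems(2)] by simp
  also have "\<dots> = (LINT x|lborel. f x * (forward_diff (- h) ^^ n) (forward_diff (- h) g) x)"
    by (rule Suc.IH[OF Suc.prems(1) square_integrable_forward_diff[OF Suc.prems(2)]])
  finally show ?case by (simp only: funpow_swap1 funpow.simps o_def)
qed simp

lemma test_function_directional_derivative:
  fixes \<phi> :: "real^'n \<Rightarrow> real"
  assumes \<phi>: "\<phi> \<in> test_functions UNIV"
  shows "((\<lambda>\<tau>. \<phi> (x + \<tau> *\<^sub>R h)) has_real_derivative (\<Sum>i\<in>UNIV. h $ i * partial_deriv i \<phi> (x + \<tau> *\<^sub>R h))) (at \<tau>)"
proof -
  define y where "y = x + \<tau> *\<^sub>R h"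
  have \<phi>': "(\<phi> has_derivative frechet_derivative \<phi> (at y)) (at y)"
    using test_function_has_derivative[OF \<phi>, of "[]"] by simp
  interpret D: bounded_linear "frechet_derivative \<phi> (at y)" using \<phi>' by (rule has_derivative_bounded_linear)
  have "((\<lambda>\<tau>. \<phi> (x + \<tau> *\<^sub>R h)) has_derivative (\<lambda>t. frechet_derivative \<phi> (at y) (t *\<^sub>R h))) (at \<tau>)"
    unfolding y_def
    by (rule has_derivative_compose[of "\<lambda>\<tau>. x + \<tau> *\<^sub>R h" "\<lambda>t. t *\<^sub>R h" _ _ \<phi>])
      (auto intro!: derivative_eq_intros \<phi>'[unfolded y_def])
  moreover have "frechet_derivative \<phi> (at y) (t *\<^sub>R h) = (\<Sum>i\<in>UNIV. h $ i * partial_deriv i \<phi> y) * t" for t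
  proof -
    have "frechet_derivative \<phi> (at y) h = frechet_derivative \<phi> (at y) (\<Sum>i\<in>UNIV. h $ i *\<^sub>R axis i 1)"
      using basis_expansion[of h] by (simp add: scalar_mult_eq_scaleR)
    also have "\<dots> = (\<Sum>i\<in>UNIV. h $ i * partial_deriv i \<phi> y)"
      by (simp add: D.sum D.scaleR partial_deriv_def)
    finally show ?thesis by (simp add: D.scaleR mult.commute)
  qed
  ultimately show ?thesis by (simp add: has_field_derivative_def y_def)
qed

lemma integral_against_shifted_test_function_derivative:
  fixes F \<zeta> :: "real^'n \<Rightarrow> real"
  assumes F: "square_integrable lborel F" and \<zeta>: "\<zeta> \<in> test_functions UNIV"
  shows "((\<lambda>\<tau>. LINT x|lborel. F x * \<zeta> (x + \<tau> *\<^sub>R h)) has_real_derivative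
    (\<Sum>i\<in>UNIV. h $ i * (LINT x|lborel. F x * partial_deriv i \<zeta> (x + \<tau> *\<^sub>R h)))) (at \<tau>)"
proof -
  have \<zeta>i: "partial_deriv i \<zeta> \<in> test_functions UNIV" for i
    using partial_derivs_test_function[OF \<zeta>, of "[i]"] by (simp add: partial_derivs_Cons)
  have sq: "square_integrable lborel (\<lambda>x. \<psi> (x + v *\<^sub>R h))" if "\<psi> \<in> test_functions UNIV" for \<psi> :: "real^'n \<Rightarrow> real" and v
    by (intro square_integrable_shift test_function_square_integrable[OF that])
  have int: "integrable lborel (\<lambda>x. F x * \<psi> (x + v *\<^sub>R h))" if "\<psi> \<in> test_functions UNIV" for \<psi> :: "real^'n \<Rightarrow> real" and v
    by (rule square_integrable_mult_integrable[OF F sq[OF that]])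
  define D where "D y = (\<Sum>i\<in>UNIV. h $ i * partial_deriv i \<zeta> y)" for y
  have D_cont: "continuous_on UNIV D"
    unfolding D_def by (intro continuous_intros test_function_continuous[OF \<zeta>i])
  obtain R where R: "R > 0" "\<And>x. \<zeta> x \<noteq> 0 \<Longrightarrow> norm x \<le> R"
    using test_function_bounded_support[OF \<zeta>] unfolding bounded_pos by auto
  \<comment> \<open>Outside the ball of radius \<open>R'\<close> the translates by \<open>v h\<close> with \<open>\<bar>v - \<tau>\<bar> < 1\<close> vanish.\<close>
  define R' where "R' = R + (\<bar>\<tau>\<bar> + 1) * norm h"
  have "bounded (D ` cball 0 (R' + (\<bar>\<tau>\<bar> + 1) * norm h))"
    using D_cont by (intro compact_imp_bounded compact_continuous_image) (auto intro: continuous_on_subset)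
  then obtain B where B: "\<And>y. norm y \<le> R' + (\<bar>\<tau>\<bar> + 1) * norm h \<Longrightarrow> \<bar>D y\<bar> \<le> B"
    unfolding bounded_iff by (metis imageI mem_cball_0 real_norm_def)
  have B0: "B \<ge> 0"
  proof -
    have "\<bar>D 0\<bar> \<le> B" using R by (intro B) (simp add: R'_def add_nonneg_nonneg)
    thus ?thesis using abs_ge_zero order_trans by blast
  qed
  define I where "I = (indicator (cball 0 R') :: real^'n \<Rightarrow> real)"
  have I: "square_integrable lborel I"
  proof -
    have "integrable lborel I"
      using emeasure_compact_finite[of "cball (0::real^'n) R'"] by (simp add: I_def integrable_indicator_iff)
    thus ?thesis by (simp add: square_integrable_def I_def power2_eq_square flip: indicator_inter_arith)
  qed
  have "((\<lambda>v. LINT x|lborel. F x * \<zeta> (x + v *\<^sub>R h)) has_real_derivative (LINT x|lborel. F x * D (x + \<tau> *\<^sub>R h))) (at \<tau>)"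
  proof (rule has_field_derivative_integral[where U = "ball \<tau> 1" and B = "\<lambda>x. B * \<bar>F x * I x\<bar>"])
    show "integrable lborel (\<lambda>x. F x * \<zeta> (x + v *\<^sub>R h))" for v by (rule int[OF \<zeta>])
    show "(\<lambda>x. F x * D (x + \<tau> *\<^sub>R h)) \<in> borel_measurable lborel"
    proof -
      have [measurable]: "F \<in> borel_measurable borel" "D \<in> borel_measurable borel"
        using F borel_measurable_continuous_onI[OF D_cont] by (simp_all add: square_integrable_def)
      show ?thesis by measurable
    qed
    show "integrable lborel (\<lambda>x. B * \<bar>F x * I x\<bar>)"
      using square_integrable_mult_integrable[OF F I] by (intro integrable_mult_right integrable_abs)
    show "((\<lambda>v. F x * \<zeta> (x + v *\<^sub>R h)) has_field_derivative F x * D (x + \<tau> *\<^sub>R h)) (at \<tau>)" for x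
      unfolding D_def by (rule DERIV_cmult[OF test_function_directional_derivative[OF \<zeta>]])
    show "norm (F x * \<zeta> (x + v *\<^sub>R h) - F x * \<zeta> (x + \<tau> *\<^sub>R h)) \<le> B * \<bar>F x * I x\<bar> * norm (v - \<tau>)"
      if v: "v \<in> ball \<tau> 1" for v x
    proof -
      have vb: "\<bar>u\<bar> \<le> \<bar>\<tau>\<bar> + 1" if "u \<in> ball \<tau> 1" for u using that by (auto simp: dist_real_def)
      have "\<bar>\<zeta> (x + v *\<^sub>R h) - \<zeta> (x + \<tau> *\<^sub>R h)\<bar> \<le> B * I x * \<bar>v - \<tau>\<bar>"
      proof (cases "norm x \<le> R'")
        case True
        have "norm (\<zeta> (x + v *\<^sub>R h) - \<zeta> (x + \<tau> *\<^sub>R h)) \<le> B * norm (v - \<tau>)"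
        proof (rule field_differentiable_bound[of "ball \<tau> 1" "\<lambda>v. \<zeta> (x + v *\<^sub>R h)" "\<lambda>v. D (x + v *\<^sub>R h)"])
          show "((\<lambda>v. \<zeta> (x + v *\<^sub>R h)) has_field_derivative D (x + u *\<^sub>R h)) (at u within ball \<tau> 1)" for u
            unfolding D_def by (rule has_field_derivative_at_within[OF test_function_directional_derivative[OF \<zeta>]])
          show "norm (D (x + u *\<^sub>R h)) \<le> B" if "u \<in> ball \<tau> 1" for u
          proof -
            have "norm (x + u *\<^sub>R h) \<le> norm x + \<bar>u\<bar> * norm h" using norm_triangle_ineq[of x "u *\<^sub>R h"] by simp
            also have "\<dots> \<le> R' + (\<bar>\<tau>\<bar> + 1) * norm h" using vb[OF that] True by (intro add_mono mult_right_mono) auto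
            finally show ?thesis using B by simp
          qed
        qed (use v in auto)
        thus ?thesis using True by (simp add: I_def)
      next
        case False
        have z: "\<zeta> (x + u *\<^sub>R h) = 0" if u: "u \<in> ball \<tau> 1" for u
        proof (rule ccontr)
          assume "\<zeta> (x + u *\<^sub>R h) \<noteq> 0"
          hence "norm (x + u *\<^sub>R h) \<le> R" by (rule R)
          moreover have "norm x \<le> norm (x + u *\<^sub>R h) + \<bar>u\<bar> * norm h"
            using norm_triangle_ineq4[of "x + u *\<^sub>R h" "u *\<^sub>R h"] by simp
          moreover have "\<bar>u\<bar> * norm h \<le> (\<bar>\<tau>\<bar> + 1) * norm h" using vb[OF u] by (intro mult_right_mono) auto
          ultimately show False using False by (simp add: R'_def)
        qed
        show ?thesis using z[OF v] z[of \<tau>] B0 by (simp add: I_def)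
      qed
      from mult_left_mono[OF this, of "\<bar>F x\<bar>"]
      show ?thesis by (simp add: abs_mult I_def mult_ac flip: right_diff_distrib)
    qed
  qed auto
  also have "(LINT x|lborel. F x * D (x + \<tau> *\<^sub>R h))
      = (LINT x|lborel. (\<Sum>i\<in>UNIV. h $ i * (F x * partial_deriv i \<zeta> (x + \<tau> *\<^sub>R h))))"
    by (simp add: D_def sum_distrib_left mult.left_commute)
  also have "\<dots> = (\<Sum>i\<in>UNIV. LINT x|lborel. h $ i * (F x * partial_deriv i \<zeta> (x + \<tau> *\<^sub>R h)))"
    by (intro Bochner_Integration.integral_sum integrable_mult_right int \<zeta>i)
  also have "\<dots> = (\<Sum>i\<in>UNIV. h $ i * (LINT x|lborel. F x * partial_deriv i \<zeta> (x + \<tau> *\<^sub>R h)))" by simp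
  finally show ?thesis .
qed

text \<open>By induction on \<open>n\<close>: the integral of \<open>F\<close> against a test function translated by \<open>s h\<close> is differentiable in
\<open>s\<close>, so by the mean value theorem one difference costs a factor \<open>norm h\<close> and one partial
derivative for each of the \<open>CARD('n)\<close> coordinates. The bound \<open>B\<close> is uniform in \<open>s\<close> because the
mean value theorem gives no control over the intermediate point.\<close>

lemma integral_against_forward_diff_power_le:
  fixes F \<psi> :: "real^'n \<Rightarrow> real"
  assumes F: "square_integrable lborel F" and "\<psi> \<in> test_functions UNIV"
    and "\<And>ds s. length ds = n \<Longrightarrow> \<bar>LINT x|lborel. F x * partial_derivs ds \<psi> (x + s *\<^sub>R h)\<bar> \<le> B"
  shows "\<bar>LINT x|lborel. F x * (forward_diff h ^^ n) \<psi> (x + s *\<^sub>R h)\<bar> \<le> (CARD('n) * norm h) ^ n * B"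
  using assms(2,3)
proof (induction n arbitrary: \<psi> B)
  case 0
  thus ?case using "0.prems"(2)[of "[]"] by simp
next
  case (Suc n)
  have "\<bar>LINT x|lborel. F x * (forward_diff h ^^ n) (forward_diff h \<psi>) (x + s *\<^sub>R h)\<bar>
      \<le> (CARD('n) * norm h) ^ n * (CARD('n) * norm h * B)"
  proof (rule Suc.IH[OF forward_diff_test_function[OF Suc.prems(1)]])
    fix ds :: "'n list" and s assume ds: "length ds = n"
    define \<zeta> where "\<zeta> = partial_derivs ds \<psi>"
    have \<zeta>: "\<zeta> \<in> test_functions UNIV" unfolding \<zeta>_def by (rule partial_derivs_test_function[OF Suc.prems(1)])
    define u where "u \<tau> = (LINT x|lborel. F x * \<zeta> (x + \<tau> *\<^sub>R h))" for \<tau>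
    define u' where "u' \<tau> = (\<Sum>i\<in>UNIV. h $ i * (LINT x|lborel. F x * partial_deriv i \<zeta> (x + \<tau> *\<^sub>R h)))" for \<tau>
    have "(u has_real_derivative u' \<tau>) (at \<tau>)" for \<tau>
      unfolding u_def u'_def by (rule integral_against_shifted_test_function_derivative[OF F \<zeta>])
    then obtain \<xi> where "u (s + 1) - u s = (s + 1 - s) * u' \<xi>"
      using MVT2[of s "s + 1" u u'] by auto
    hence "\<bar>u (s + 1) - u s\<bar> = \<bar>u' \<xi>\<bar>" by simp
    also have "\<dots> \<le> (\<Sum>i\<in>UNIV. \<bar>h $ i * (LINT x|lborel. F x * partial_deriv i \<zeta> (x + \<xi> *\<^sub>R h))\<bar>)"
      unfolding u'_def by (rule sum_abs)
    also have "\<dots> \<le> (\<Sum>i\<in>(UNIV :: 'n set). norm h * B)"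
    proof (rule sum_mono)
      fix i :: 'n
      have "\<bar>LINT x|lborel. F x * partial_deriv i \<zeta> (x + \<xi> *\<^sub>R h)\<bar> \<le> B"
        using Suc.prems(2)[of "i # ds" \<xi>] ds by (simp add: \<zeta>_def partial_derivs_Cons)
      moreover have "\<bar>h $ i\<bar> \<le> norm h" by (rule component_le_norm_cart)
      ultimately show "\<bar>h $ i * (LINT x|lborel. F x * partial_deriv i \<zeta> (x + \<xi> *\<^sub>R h))\<bar> \<le> norm h * B"
        unfolding abs_mult by (intro mult_mono) auto
    qed
    also have "\<dots> = CARD('n) * norm h * B" by simp
    also have "u (s + 1) - u s = (LINT x|lborel. F x * partial_derivs ds (forward_diff h \<psi>) (x + s *\<^sub>R h))"
    proof -
      have int: "integrable lborel (\<lambda>x. F x * \<zeta> (x + \<tau> *\<^sub>R h))" for \<tau>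
        by (intro square_integrable_mult_integrable[OF F] square_integrable_shift test_function_square_integrable[OF \<zeta>])
      have "partial_derivs ds (forward_diff h \<psi>) (x + s *\<^sub>R h) = \<zeta> (x + (s + 1) *\<^sub>R h) - \<zeta> (x + s *\<^sub>R h)" for x
        unfolding partial_derivs_forward_diff[OF Suc.prems(1)] forward_diff_def \<zeta>_def
        by (simp add: scaleR_add_left add.assoc)
      thus ?thesis
        using int[of "s + 1"] int[of s] by (simp add: u_def right_diff_distrib)
    qed
    finally show "\<bar>LINT x|lborel. F x * partial_derivs ds (forward_diff h \<psi>) (x + s *\<^sub>R h)\<bar> \<le> CARD('n) * norm h * B" .
  qed
  thus ?case by (simp add: funpow_swap1 mult_ac)
qed

text \<open>Tested against \<open>\<phi>\<close>, the \<open>n\<close> outer differences fall on \<open>\<phi>\<close> and become derivatives, which the weak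
derivatives \<open>G ds\<close> absorb. The remaining difference is moved back to \<open>G ds\<close>. Since the
\<open>L\<^sup>2\<close> norm is invariant under translation, the unknown intermediate points do no harm.\<close>

lemma forward_diff_power_le_weak_derivatives:
  fixes F :: "real^'n \<Rightarrow> real" and G :: "'n list \<Rightarrow> real^'n \<Rightarrow> real"
  assumes F: "square_integrable lborel F" and G: "\<And>ds. length ds = n \<Longrightarrow> square_integrable lborel (G ds)"
    and weak: "\<And>ds \<phi>. length ds = n \<Longrightarrow> \<phi> \<in> test_functions UNIV \<Longrightarrow>
       (LINT x|lborel. F x * partial_derivs ds \<phi> x) = (-1) ^ n * (LINT x|lborel. G ds x * \<phi> x)"
  shows "l2_norm lborel ((forward_diff h ^^ Suc n) F)
    \<le> (CARD('n) * norm h) ^ n * (\<Sum>ds | length ds = n. l2_norm lborel (forward_diff h (G ds)))"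
proof (rule test_functions_dense)
  define A where "A = (\<Sum>ds | length ds = n. l2_norm lborel (forward_diff h (G ds)))"
  have fin: "finite {ds :: 'n list. length ds = n}" using finite_lists_length_eq[of "UNIV :: 'n set" n] by simp
  show "square_integrable lborel ((forward_diff h ^^ Suc n) F)"
    by (rule square_integrable_forward_diff_power[OF F])
  show "0 \<le> (CARD('n) * norm h) ^ n * (\<Sum>ds | length ds = n. l2_norm lborel (forward_diff h (G ds)))"
    by (intro mult_nonneg_nonneg sum_nonneg) auto
  fix \<phi> :: "real^'n \<Rightarrow> real" assume \<phi>: "\<phi> \<in> test_functions UNIV"
  define \<psi> where "\<psi> = forward_diff (- h) \<phi>"
  have \<psi>: "\<psi> \<in> test_functions UNIV" unfolding \<psi>_def by (rule forward_diff_test_function[OF \<phi>])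
  have "\<bar>LINT x|lborel. F x * (forward_diff (- h) ^^ n) \<psi> (x + 0 *\<^sub>R (- h))\<bar> \<le> (CARD('n) * norm (- h)) ^ n * (A * l2_norm lborel \<phi>)"
  proof (rule integral_against_forward_diff_power_le[OF F \<psi>])
    fix ds :: "'n list" and s :: real assume ds: "length ds = n"
    define \<phi>' where "\<phi>' = (\<lambda>x. \<phi> (x + s *\<^sub>R (- h)))"
    have \<phi>': "\<phi>' \<in> test_functions UNIV" unfolding \<phi>'_def by (rule shift_test_function[OF \<phi>])
    have \<phi>'_sq: "square_integrable lborel \<phi>'" by (rule test_function_square_integrable[OF \<phi>'])
    have "(\<lambda>x. partial_derivs ds \<psi> (x + s *\<^sub>R (- h))) = partial_derivs ds (forward_diff (- h) \<phi>')"
      unfolding partial_derivs_shift[OF \<psi>, symmetric]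
      by (rule arg_cong[of _ _ "partial_derivs ds"]) (auto simp: \<psi>_def \<phi>'_def forward_diff_def algebra_simps)
    hence "\<bar>LINT x|lborel. F x * partial_derivs ds \<psi> (x + s *\<^sub>R (- h))\<bar>
        = \<bar>LINT x|lborel. F x * partial_derivs ds (forward_diff (- h) \<phi>') x\<bar>" by (metis (no_types, lifting))
    also have "\<dots> = \<bar>LINT x|lborel. G ds x * forward_diff (- h) \<phi>' x\<bar>"
      using weak[OF ds forward_diff_test_function[OF \<phi>']] by (simp add: abs_mult power_abs)
    also have "\<dots> = \<bar>LINT x|lborel. forward_diff h (G ds) x * \<phi>' x\<bar>"
      by (simp add: forward_diff_adjoint[OF G[OF ds] \<phi>'_sq])
    also have "\<dots> \<le> l2_norm lborel (forward_diff h (G ds)) * l2_norm lborel \<phi>'"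
      by (rule l2_Cauchy_Schwarz[OF square_integrable_forward_diff[OF G[OF ds]] \<phi>'_sq])
    also have "l2_norm lborel \<phi>' = l2_norm lborel \<phi>"
      unfolding \<phi>'_def by (rule l2_norm_shift[OF test_function_square_integrable[OF \<phi>]])
    also have "l2_norm lborel (forward_diff h (G ds)) * l2_norm lborel \<phi> \<le> A * l2_norm lborel \<phi>"
      unfolding A_def using fin ds by (intro mult_right_mono member_le_sum) auto
    finally show "\<bar>LINT x|lborel. F x * partial_derivs ds \<psi> (x + s *\<^sub>R (- h))\<bar> \<le> A * l2_norm lborel \<phi>" .
  qed
  moreover have "(LINT x|lborel. (forward_diff h ^^ Suc n) F x * \<phi> x) = (LINT x|lborel. F x * (forward_diff (- h) ^^ n) \<psi> x)"
    unfolding forward_diff_power_adjoint[OF F test_function_square_integrable[OF \<phi>]]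
    by (simp only: \<psi>_def funpow_swap1 funpow.simps o_def)
  ultimately show "\<bar>LINT x|lborel. (forward_diff h ^^ Suc n) F x * \<phi> x\<bar>
      \<le> (CARD('n) * norm h) ^ n * (\<Sum>ds | length ds = n. l2_norm lborel (forward_diff h (G ds))) * l2_norm lborel \<phi>"
    by (simp add: A_def mult.assoc)
qed

section \<open>Sobolev functions on the whole space\<close>

lemma lebesgue_integral_eq_lborel:
  fixes f f' :: "'a::euclidean_space \<Rightarrow> real"
  assumes f: "f \<in> borel_measurable lebesgue" and f': "f' \<in> borel_measurable borel"
    and eq: "AE x in lborel. f x = f' x"
  shows "(LINT x|lebesgue. f x) = (LINT x|lborel. f' x)"
    and "integrable lebesgue f \<longleftrightarrow> integrable lborel f'"
proof -
  have m: "f' \<in> borel_measurable lebesgue" using f' by (simp add: measurable_completion)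
  have eq': "AE x in lebesgue. f x = f' x" using eq by (rule AE_completion)
  show "(LINT x|lebesgue. f x) = (LINT x|lborel. f' x)"
    using integral_cong_AE[OF f m eq'] integral_completion[of f' lborel] f' by simp
  show "integrable lebesgue f \<longleftrightarrow> integrable lborel f'"
    using integrable_cong_AE[OF f m eq'] integrable_completion[of f' lborel] f' by simp
qed

text \<open>Tonelli's theorem needs measurability with respect to the product of the sigma algebras, which
\<open>(x, h) \<mapsto> f(x + h)\<close> may lack for a Lebesgue measurable \<open>f\<close>. Hence the passage to Borel functions.\<close>

lemma L2_space_borel_representative:
  fixes f :: "real^'n \<Rightarrow> real"
  assumes f: "f \<in> L2_space UNIV"
  obtains F where "square_integrable lborel F" "AE x in lborel. f x = F x"
    "norm_L2 UNIV f = l2_norm lborel F"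
    "\<And>\<psi>. \<psi> \<in> borel_measurable borel \<Longrightarrow> (LINT x|lebesgue_on UNIV. f x * \<psi> x) = (LINT x|lborel. F x * \<psi> x)"
proof -
  have f: "f \<in> borel_measurable lebesgue" "integrable lebesgue (\<lambda>x. (f x)\<^sup>2)"
    using f by (simp_all add: L2_space_def lebesgue_on_UNIV_eq)
  obtain F where F: "F \<in> borel_measurable borel" "AE x in lborel. f x = F x"
    using completion_ex_borel_measurable_real[OF f(1)] by auto
  have sq: "AE x in lborel. (f x)\<^sup>2 = (F x)\<^sup>2" using F(2) by eventually_elim simp
  note L = lebesgue_integral_eq_lborel[of "\<lambda>x. (f x)\<^sup>2" "\<lambda>x. (F x)\<^sup>2", OF _ _ sq]
  show ?thesis
  proof (rule that[OF _ F(2)])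
    show "square_integrable lborel F"
      using L(2) f F(1) by (simp add: square_integrable_def)
    show "norm_L2 UNIV f = l2_norm lborel F"
      using L(1) f F(1) by (simp add: norm_L2_def l2_norm_def lebesgue_on_UNIV_eq)
    fix \<psi> :: "real^'n \<Rightarrow> real" assume \<psi>: "\<psi> \<in> borel_measurable borel"
    have "AE x in lborel. f x * \<psi> x = F x * \<psi> x" using F(2) by eventually_elim simp
    moreover have "\<psi> \<in> borel_measurable lebesgue" using \<psi> by (simp add: measurable_completion)
    ultimately show "(LINT x|lebesgue_on UNIV. f x * \<psi> x) = (LINT x|lborel. F x * \<psi> x)"
      using f(1) F(1) \<psi> unfolding lebesgue_on_UNIV_eq by (intro lebesgue_integral_eq_lborel) auto
  qed
qed

lemma l2_norm_forward_diff_measurable: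
  fixes G :: "'a::euclidean_space \<Rightarrow> real"
  assumes [measurable]: "G \<in> borel_measurable borel"
  shows "(\<lambda>h. l2_norm lborel (forward_diff h G)) \<in> borel_measurable borel"
proof -
  have "(\<lambda>h. LINT x|lborel. (G (x + h) - G x)\<^sup>2) \<in> borel_measurable lborel" by measurable
  thus ?thesis unfolding l2_norm_def forward_diff_def by simp
qed

text \<open>Substituting \<open>y = x + h\<close> and exchanging the integrals turns the Gagliardo seminorm into a weighted
\<open>L\<^sup>2\<close> norm of the modulus of continuity \<open>h \<mapsto> \<parallel>G(x + h) - G(x)\<parallel>\<close>.\<close>

lemma gagliardo_sq_eq_forward_diff:
  fixes g G :: "real^'n \<Rightarrow> real" and t :: real
  assumes G: "square_integrable lborel G" and gG: "AE x in lborel. g x = G x"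
  shows "gagliardo_sq t UNIV g =
    (\<integral>\<^sup>+h. ennreal ((l2_norm lborel (forward_diff h G))\<^sup>2 / norm h powr (CARD('n) + 2 * t)) \<partial>lborel)"
proof -
  define s where "s = real CARD('n) + 2 * t"
  have [measurable]: "G \<in> borel_measurable borel" using G by (simp add: square_integrable_def)
  have "gagliardo_sq t UNIV g = (\<integral>\<^sup>+x. \<integral>\<^sup>+y. ennreal ((g x - g y)\<^sup>2 / norm (x - y) powr s) \<partial>lborel \<partial>lborel)"
    by (simp add: gagliardo_sq_def lebesgue_on_UNIV_eq nn_integral_completion s_def)
  also have "\<dots> = (\<integral>\<^sup>+x. \<integral>\<^sup>+y. ennreal ((G x - G y)\<^sup>2 / norm (x - y) powr s) \<partial>lborel \<partial>lborel)"
  proof (rule nn_integral_cong_AE)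
    show "AE x in lborel. (\<integral>\<^sup>+y. ennreal ((g x - g y)\<^sup>2 / norm (x - y) powr s) \<partial>lborel)
        = (\<integral>\<^sup>+y. ennreal ((G x - G y)\<^sup>2 / norm (x - y) powr s) \<partial>lborel)"
      using gG
    proof eventually_elim
      case (elim x)
      show ?case
      proof (rule nn_integral_cong_AE)
        show "AE y in lborel. ennreal ((g x - g y)\<^sup>2 / norm (x - y) powr s) = ennreal ((G x - G y)\<^sup>2 / norm (x - y) powr s)"
          using gG by eventually_elim (simp add: elim)
      qed
    qed
  qed
  also have "\<dots> = (\<integral>\<^sup>+x. \<integral>\<^sup>+h. ennreal ((G (x + h) - G x)\<^sup>2 / norm h powr s) \<partial>lborel \<partial>lborel)"
  proof (rule nn_integral_cong)
    fix x :: "real^'n"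
    have "(\<integral>\<^sup>+y. ennreal ((G x - G y)\<^sup>2 / norm (x - y) powr s) \<partial>lborel)
        = (\<integral>\<^sup>+h. ennreal ((G x - G (x + h))\<^sup>2 / norm (x - (x + h)) powr s) \<partial>lborel)"
      using nn_integral_lborel_affine[of 1 "\<lambda>y. ennreal ((G x - G y)\<^sup>2 / norm (x - y) powr s)" x] by simp
    thus "(\<integral>\<^sup>+y. ennreal ((G x - G y)\<^sup>2 / norm (x - y) powr s) \<partial>lborel)
        = (\<integral>\<^sup>+h. ennreal ((G (x + h) - G x)\<^sup>2 / norm h powr s) \<partial>lborel)"
      by (simp add: power2_commute)
  qed
  also have "\<dots> = (\<integral>\<^sup>+h. \<integral>\<^sup>+x. ennreal ((G (x + h) - G x)\<^sup>2 / norm h powr s) \<partial>lborel \<partial>lborel)"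
    by (rule lborel_pair.Fubini') measurable
  also have "\<dots> = (\<integral>\<^sup>+h. ennreal ((l2_norm lborel (forward_diff h G))\<^sup>2 / norm h powr s) \<partial>lborel)"
  proof (rule nn_integral_cong)
    fix h :: "real^'n"
    have "integrable lborel (\<lambda>x. (forward_diff h G x)\<^sup>2)"
      using square_integrable_forward_diff[OF G] by (rule square_integrable_integrable_power2)
    hence "integrable lborel (\<lambda>x. (forward_diff h G x)\<^sup>2 / norm h powr s)" by simp
    hence "(\<integral>\<^sup>+x. ennreal ((forward_diff h G x)\<^sup>2 / norm h powr s) \<partial>lborel)
        = ennreal (LINT x|lborel. (forward_diff h G x)\<^sup>2 / norm h powr s)"
      by (intro nn_integral_eq_integral) auto
    thus "(\<integral>\<^sup>+x. ennreal ((G (x + h) - G x)\<^sup>2 / norm h powr s) \<partial>lborel)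
        = ennreal ((l2_norm lborel (forward_diff h G))\<^sup>2 / norm h powr s)"
      by (simp add: l2_norm_power2 forward_diff_def)
  qed
  finally show ?thesis by (simp add: s_def)
qed

text \<open>The bound on \<open>F\<close> itself is not immediate, since the norm refers to a chosen weak derivative of order
\<open>0\<close>; that this is \<open>F\<close> up to null sets is contained in the density of the test functions.\<close>

lemma sobolev_space_representation:
  fixes f :: "real^'n \<Rightarrow> real" and r :: real
  defines "n \<equiv> nat \<lfloor>r\<rfloor>" and "S \<equiv> sobolev_norm r UNIV f"
  assumes f: "f \<in> sobolev_space r UNIV"
  obtains F G where "square_integrable lborel F" "AE x in lborel. f x = F x" "l2_norm lborel F \<le> S"
    "\<And>ds. length ds = n \<Longrightarrow> square_integrable lborel (G ds)"
    "\<And>ds. length ds = n \<Longrightarrow> l2_norm lborel (G ds) \<le> S"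
    "\<And>ds \<phi>. length ds = n \<Longrightarrow> \<phi> \<in> test_functions UNIV \<Longrightarrow>
       (LINT x|lborel. F x * partial_derivs ds \<phi> x) = (-1) ^ n * (LINT x|lborel. G ds x * \<phi> x)"
    "\<And>ds. length ds = n \<Longrightarrow> frac r > 0 \<Longrightarrow>
       (\<integral>\<^sup>+h. ennreal ((l2_norm lborel (forward_diff h (G ds)))\<^sup>2 / norm h powr (CARD('n) + 2 * frac r)) \<partial>lborel)
         \<le> ennreal (S\<^sup>2)"
proof -
  define g where "g ds = weak_deriv UNIV ds f" for ds
  have weak: "has_weak_deriv UNIV ds f (g ds)" if "length ds \<le> n" for ds
  proof -
    have "\<exists>g. has_weak_deriv UNIV ds f g"
      using f that unfolding sobolev_space_def n_def by blast
    thus ?thesis unfolding g_def weak_deriv_def by (rule someI_ex)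
  qed
  have fL: "f \<in> L2_space UNIV" and gL: "\<And>ds. length ds \<le> n \<Longrightarrow> g ds \<in> L2_space UNIV"
    using f weak unfolding sobolev_space_def has_weak_deriv_def by auto
  define P where "P = (\<Sum>ds | length ds \<le> n. (norm_L2 UNIV (g ds))\<^sup>2)"
  define Q where "Q = (if frac r > 0 then \<Sum>ds | length ds = n. enn2real (gagliardo_sq (frac r) UNIV (g ds)) else 0)"
  have PQ: "P \<ge> 0" "Q \<ge> 0" by (auto simp: P_def Q_def intro!: sum_nonneg)
  have S: "S = sqrt (P + Q)" by (simp add: S_def sobolev_norm_def P_def Q_def n_def g_def)
  hence S2: "S\<^sup>2 = P + Q" "S \<ge> 0" using PQ by simp_all
  have fin: "finite {ds :: 'n list. length ds \<le> n}" "finite {ds :: 'n list. length ds = n}"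
    using finite_lists_length_le[of "UNIV :: 'n set" n] finite_lists_length_eq[of "UNIV :: 'n set" n] by simp_all
  have norm_g: "norm_L2 UNIV (g ds) \<le> S" if "length ds \<le> n" for ds
  proof (rule power2_le_imp_le[OF _ S2(2)])
    have "(norm_L2 UNIV (g ds))\<^sup>2 \<le> P" unfolding P_def using fin that by (intro member_le_sum) auto
    thus "(norm_L2 UNIV (g ds))\<^sup>2 \<le> S\<^sup>2" using S2 PQ by linarith
  qed
  obtain F where F: "square_integrable lborel F" "AE x in lborel. f x = F x"
    "\<And>\<psi>. \<psi> \<in> borel_measurable borel \<Longrightarrow> (LINT x|lebesgue_on UNIV. f x * \<psi> x) = (LINT x|lborel. F x * \<psi> x)"
    using L2_space_borel_representative[OF fL] by blast
  define R where "R ds G \<longleftrightarrow> square_integrable lborel G \<and> (AE x in lborel. g ds x = G x) \<and>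
    norm_L2 UNIV (g ds) = l2_norm lborel G \<and>
    (\<forall>\<psi>. \<psi> \<in> borel_measurable borel \<longrightarrow> (LINT x|lebesgue_on UNIV. g ds x * \<psi> x) = (LINT x|lborel. G x * \<psi> x))"
    for ds G
  define G where "G ds = (SOME G. R ds G)" for ds
  have R: "R ds (G ds)" if "length ds \<le> n" for ds
  proof -
    have "\<exists>G. R ds G"
      unfolding R_def by (rule L2_space_borel_representative[OF gL[OF that]]) blast
    thus ?thesis unfolding G_def by (rule someI_ex)
  qed
  have G: "square_integrable lborel (G ds)" "AE x in lborel. g ds x = G ds x"
    "norm_L2 UNIV (g ds) = l2_norm lborel (G ds)"
    "\<And>\<psi>. \<psi> \<in> borel_measurable borel \<Longrightarrow> (LINT x|lebesgue_on UNIV. g ds x * \<psi> x) = (LINT x|lborel. G ds x * \<psi> x)"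
    if "length ds \<le> n" for ds
    using R[OF that] unfolding R_def by blast+
  have weak': "(LINT x|lborel. F x * partial_derivs ds \<phi> x) = (-1) ^ length ds * (LINT x|lborel. G ds x * \<phi> x)"
    if ds: "length ds \<le> n" and \<phi>: "\<phi> \<in> test_functions UNIV" for ds \<phi>
  proof -
    have m: "\<phi> \<in> borel_measurable borel" "partial_derivs ds \<phi> \<in> borel_measurable borel"
      by (intro borel_measurable_continuous_onI test_function_continuous[OF \<phi>]
          test_function_continuous[OF partial_derivs_test_function[OF \<phi>]])+
    have "(LINT x|lebesgue_on UNIV. f x * partial_derivs ds \<phi> x) = (-1) ^ length ds * (LINT x|lebesgue_on UNIV. g ds x * \<phi> x)"
      using weak[OF ds] \<phi> unfolding has_weak_deriv_def by blast
    thus ?thesis by (simp only: F(3)[OF m(2)] G(4)[OF ds m(1)])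
  qed
  show thesis
  proof (rule that[OF F(1,2), of G])
    show "l2_norm lborel F \<le> S"
    proof (rule test_functions_dense[OF F(1) S2(2)])
      fix \<phi> :: "real^'n \<Rightarrow> real" assume \<phi>: "\<phi> \<in> test_functions UNIV"
      have "\<bar>LINT x|lborel. F x * \<phi> x\<bar> = \<bar>LINT x|lborel. G [] x * \<phi> x\<bar>"
        using weak'[of "[]" \<phi>] \<phi> by simp
      also have "\<dots> \<le> l2_norm lborel (G []) * l2_norm lborel \<phi>"
        by (intro l2_Cauchy_Schwarz G test_function_square_integrable[OF \<phi>]) simp
      also have "\<dots> \<le> S * l2_norm lborel \<phi>"
        using norm_g[of "[]"] G(3)[of "[]"] by (intro mult_right_mono) auto
      finally show "\<bar>LINT x|lborel. F x * \<phi> x\<bar> \<le> S * l2_norm lborel \<phi>" .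
    qed
    fix ds :: "'n list" assume ds: "length ds = n"
    show "square_integrable lborel (G ds)" "l2_norm lborel (G ds) \<le> S"
      using G(1,3) norm_g ds by simp_all
    show "(LINT x|lborel. F x * partial_derivs ds \<phi> x) = (-1) ^ n * (LINT x|lborel. G ds x * \<phi> x)"
      if "\<phi> \<in> test_functions UNIV" for \<phi> using weak'[OF _ that, of ds] ds by simp
    assume r: "frac r > 0"
    have "gagliardo_sq (frac r) UNIV (g ds) < \<infinity>"
      using f r ds unfolding sobolev_space_def g_def n_def by blast
    hence "gagliardo_sq (frac r) UNIV (g ds) = ennreal (enn2real (gagliardo_sq (frac r) UNIV (g ds)))"
      by (simp add: less_top)
    also have "enn2real (gagliardo_sq (frac r) UNIV (g ds)) \<le> Q"
      using r ds fin(2) member_le_sum[of ds "{ds. length ds = n}" "\<lambda>ds. enn2real (gagliardo_sq (frac r) UNIV (g ds))"]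
      unfolding Q_def by simp
    hence "ennreal (enn2real (gagliardo_sq (frac r) UNIV (g ds))) \<le> ennreal (S\<^sup>2)"
      using S2 PQ by (intro ennreal_leI) linarith
    finally show "(\<integral>\<^sup>+h. ennreal ((l2_norm lborel (forward_diff h (G ds)))\<^sup>2 / norm h powr (CARD('n) + 2 * frac r)) \<partial>lborel)
         \<le> ennreal (S\<^sup>2)"
      using gagliardo_sq_eq_forward_diff[OF G(1) G(2), of ds "frac r"] ds by simp
  qed
qed

section \<open>Jackson estimate in dual form\<close>

lemma decay_mult_powr_le:
  assumes "0 \<le> e" "e \<le> 2 * (real p - real q)" and a: "a \<ge> 0"
  shows "decay p a y * (a * norm y) powr e \<le> decay q a y"
proof -
  define t where "t = 1 + (a * norm y)\<^sup>2"
  have t: "t \<ge> 1" by (simp add: t_def)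
  have qp: "q \<le> p" using assms by simp
  have "a * norm y \<le> sqrt t" using a by (intro real_le_rsqrt) (simp add: t_def)
  hence "(a * norm y) powr e \<le> sqrt t powr e" using assms by (intro powr_mono2) auto
  also have "\<dots> \<le> sqrt t powr (2 * (real p - real q))" using assms t by (intro powr_mono) auto
  also have "2 * (real p - real q) = real (2 * (p - q))" using qp by (simp add: of_nat_diff)
  also have "sqrt t powr real (2 * (p - q)) = sqrt t ^ (2 * (p - q))" using t by (intro powr_realpow) simp
  also have "\<dots> = t ^ (p - q)" using t by (simp add: power_mult)
  finally have "inverse (t ^ p) * (a * norm y) powr e \<le> inverse (t ^ p) * t ^ (p - q)"
    using t by (intro mult_left_mono) auto
  also have "t ^ p = t ^ q * t ^ (p - q)" using qp by (simp flip: power_add)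
  hence "inverse (t ^ p) * t ^ (p - q) = inverse (t ^ q)" using t by (simp add: field_simps)
  finally show ?thesis by (simp add: decay_def t_def)
qed

definition decay_mass :: "'a::euclidean_space itself \<Rightarrow> real" where
  "decay_mass TYPE('a) = (LINT y|lborel. decay DIM('a) 1 (y :: 'a))"

lemma decay_mass_nonneg: "decay_mass TYPE('a::euclidean_space) \<ge> 0"
  by (simp add: decay_mass_def)

lemma l2_norm_forward_diff_le:
  fixes G :: "'a::euclidean_space \<Rightarrow> real"
  assumes "square_integrable lborel G"
  shows "l2_norm lborel (forward_diff h G) \<le> 2 * l2_norm lborel G"
  using l2_norm_diff_triangle[OF square_integrable_shift[OF assms, of h] assms] l2_norm_shift[OF assms, of h]
  by (simp add: forward_diff_def[abs_def])

context
  fixes G :: "real^'n \<Rightarrow> real" and r S a :: real and n p :: nat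
  assumes G: "square_integrable lborel G" and p: "p \<ge> n + CARD('n) + 1" and a: "a > 0"
    and GS: "l2_norm lborel G \<le> S"
begin

text \<open>This crude bound gives integrability in all cases, and for integer \<open>r\<close> also the final estimate.\<close>

lemma sine_kernel_forward_diff_pointwise:
  "sine_kernel p a h * (norm h ^ n * l2_norm lborel (forward_diff h G))
    \<le> 2 ^ (p * CARD('n)) * (2 * S) / a ^ n * decay CARD('n) a h"
proof -
  have S: "S \<ge> 0" using order_trans[OF l2_norm_nonneg GS] .
  have "sine_kernel p a h * (norm h ^ n * l2_norm lborel (forward_diff h G))
      \<le> (2 ^ (p * CARD('n)) * decay p a h) * (norm h ^ n * (2 * S))"
    using sine_kernel_le_decay[of p a h] l2_norm_forward_diff_le[OF G, of h] GS
    by (intro mult_mono) auto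
  also have "\<dots> = 2 ^ (p * CARD('n)) * (2 * S) / a ^ n * (decay p a h * \<bar>a * norm h\<bar> ^ n)"
    using a by (simp add: power_mult_distrib)
  also have "\<dots> \<le> 2 ^ (p * CARD('n)) * (2 * S) / a ^ n * decay CARD('n) a h"
    using p a S by (intro mult_left_mono decay_mult_power_le) auto
  finally show ?thesis .
qed

lemma integrable_sine_kernel_forward_diff:
  "integrable lborel (\<lambda>h. sine_kernel p a h * (norm h ^ n * l2_norm lborel (forward_diff h G)))"
proof (rule Bochner_Integration.integrable_bound)
  show "integrable lborel (\<lambda>h :: real^'n. 2 ^ (p * CARD('n)) * (2 * S) / a ^ n * decay CARD('n) a h)"
    using integrable_decay[where 'a="real^'n", of "CARD('n)" a] a by (intro integrable_mult_right) simp
  have [measurable]: "(\<lambda>h. l2_norm lborel (forward_diff h G)) \<in> borel_measurable borel"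
    using G by (intro l2_norm_forward_diff_measurable) (simp add: square_integrable_def)
  show "(\<lambda>h. sine_kernel p a h * (norm h ^ n * l2_norm lborel (forward_diff h G))) \<in> borel_measurable lborel"
    by measurable
  show "AE h in lborel. norm (sine_kernel p a h * (norm h ^ n * l2_norm lborel (forward_diff h G)))
      \<le> norm (2 ^ (p * CARD('n)) * (2 * S) / a ^ n * decay CARD('n) a h)"
  proof (rule AE_I2)
    fix h :: "real^'n"
    have "norm (sine_kernel p a h * (norm h ^ n * l2_norm lborel (forward_diff h G)))
        = sine_kernel p a h * (norm h ^ n * l2_norm lborel (forward_diff h G))" by simp
    also note sine_kernel_forward_diff_pointwise
    also have "2 ^ (p * CARD('n)) * (2 * S) / a ^ n * decay CARD('n) a h
        \<le> norm (2 ^ (p * CARD('n)) * (2 * S) / a ^ n * decay CARD('n) a h)"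
      by (simp only: real_norm_def abs_ge_self)
    finally show "norm (sine_kernel p a h * (norm h ^ n * l2_norm lborel (forward_diff h G)))
        \<le> norm (2 ^ (p * CARD('n)) * (2 * S) / a ^ n * decay CARD('n) a h)" .
  qed
qed

text \<open>For integer \<open>r\<close> the moduli of continuity are bounded and the factor \<open>norm h ^ n\<close> alone gives the rate. For
fractional \<open>r\<close>, Cauchy-Schwarz separates the Gagliardo seminorm from the integral of
\<open>K(h)\<^sup>2 |h|\<close> to the power \<open>2 r + d\<close>, which scales like \<open>a\<close> to the power \<open>-(2 r + d) - d\<close>.\<close>

lemma integral_sine_kernel_forward_diff_le:
  assumes r: "r \<ge> 0" "n = nat \<lfloor>r\<rfloor>"
    and Gag: "frac r > 0 \<Longrightarrow> (\<integral>\<^sup>+h. ennreal ((l2_norm lborel (forward_diff h G))\<^sup>2 / norm h powr (CARD('n) + 2 * frac r)) \<partial>lborel)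
         \<le> ennreal (S\<^sup>2)"
  shows "(LINT h|lborel. sine_kernel p a h * (norm h ^ n * l2_norm lborel (forward_diff h G)))
    \<le> 2 ^ (p * CARD('n)) * (2 * decay_mass TYPE(real^'n) + sqrt (decay_mass TYPE(real^'n))) * a powr (- (r + CARD('n))) * S"
proof -
  define J where "J = decay_mass TYPE(real^'n)"
  define d where "d = CARD('n)"
  have J: "J \<ge> 0" unfolding J_def by (rule decay_mass_nonneg)
  have S: "S \<ge> 0" using order_trans[OF l2_norm_nonneg GS] .
  have dJ: "(LINT h|lborel. decay d a (h :: real^'n)) \<le> J / a ^ d"
    using integral_decay_le[where 'a="real^'n", of d a] a by (simp add: J_def d_def decay_mass_def)
  have dint: "integrable lborel (decay d a :: real^'n \<Rightarrow> real)"
    using a by (intro integrable_decay) (simp_all add: d_def)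
  have rn: "r = real n + frac r" using r by (simp add: frac_def)
  have aS: "0 \<le> a powr (- (r + d)) * S" using S by simp
  show ?thesis
  proof (cases "frac r > 0")
    case False
    hence "frac r = 0" using frac_ge_0[of r] by linarith
    hence rn': "r = real n" using rn by linarith
    have "a powr (- (r + d)) = inverse (a powr (real n + real d))" unfolding rn' by (rule powr_minus)
    also have "\<dots> = 1 / (a ^ n * a ^ d)" by (simp only: powr_add powr_realpow[OF a] inverse_eq_divide)
    finally have ard: "a powr (- (r + d)) = 1 / (a ^ n * a ^ d)" .
    have "(LINT h|lborel. sine_kernel p a h * (norm h ^ n * l2_norm lborel (forward_diff h G)))
        \<le> (LINT h|lborel. 2 ^ (p * d) * (2 * S) / a ^ n * decay d a (h :: real^'n))"
      using integrable_sine_kernel_forward_diff dint sine_kernel_forward_diff_pointwise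
      unfolding d_def by (intro integral_mono integrable_mult_right) auto
    also have "\<dots> = 2 ^ (p * d) * (2 * S) / a ^ n * (LINT h|lborel. decay d a (h :: real^'n))" by simp
    also have "\<dots> \<le> 2 ^ (p * d) * (2 * S) / a ^ n * (J / a ^ d)"
      using dJ S a by (intro mult_left_mono) auto
    also have "\<dots> = 2 ^ (p * d) * (2 * J) * (a powr (- (r + d)) * S)"
      unfolding ard by simp
    also have "\<dots> \<le> 2 ^ (p * d) * (2 * J + sqrt J) * (a powr (- (r + d)) * S)"
      using J aS by (intro mult_right_mono mult_left_mono) auto
    finally show ?thesis by (simp add: J_def d_def mult.assoc)
  next
    case True
    define s where "s = d + 2 * frac r"
    define D where "D h = l2_norm lborel (forward_diff h G)" for h
    have [measurable]: "D \<in> borel_measurable borel"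
      unfolding D_def using G by (intro l2_norm_forward_diff_measurable) (simp add: square_integrable_def)
    define u where "u h = sine_kernel p a h * norm h ^ n * norm h powr (s / 2)" for h :: "real^'n"
    define v where "v h = D h / norm h powr (s / 2)" for h :: "real^'n"
    have [measurable]: "u \<in> borel_measurable borel" "v \<in> borel_measurable borel"
      unfolding u_def v_def by measurable
    have sq: "(norm h powr (s / 2))\<^sup>2 = norm h powr s" for h :: "real^'n"
      unfolding power2_eq_square powr_add[symmetric] by simp
    have v2: "(\<integral>\<^sup>+h. ennreal ((v h)\<^sup>2) \<partial>lborel) \<le> ennreal (S\<^sup>2)"
      using Gag[OF True] unfolding v_def power_divide sq unfolding D_def s_def d_def .
    have v: "square_integrable lborel v"
    proof -
      have "(\<integral>\<^sup>+h. ennreal (norm ((v h)\<^sup>2)) \<partial>lborel) < \<infinity>"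
        using le_less_trans[OF v2 ennreal_less_top] by simp
      hence "integrable lborel (\<lambda>h. (v h)\<^sup>2)" by (intro integrableI_bounded) auto
      thus ?thesis by (simp add: square_integrable_def)
    qed
    have "ennreal (LINT h|lborel. (v h)\<^sup>2) \<le> ennreal (S\<^sup>2)"
      using nn_integral_eq_integral[OF square_integrable_integrable_power2[OF v]] v2 by simp
    hence v_le: "l2_norm lborel v \<le> S"
      using S by (simp add: l2_norm_def real_le_lsqrt)
    have u2: "(u h)\<^sup>2 \<le> (2 ^ (p * d))\<^sup>2 * a powr (- (2 * r + d)) * decay d a h" for h
    proof (cases "h = 0")
      case False
      hence h: "norm h > 0" by simp
      have "(sine_kernel p a h)\<^sup>2 \<le> (2 ^ (p * d) * decay p a h)\<^sup>2"
        unfolding d_def by (intro power_mono sine_kernel_le_decay[of p a h, simplified]) simp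
      also have "\<dots> = (2 ^ (p * d))\<^sup>2 * decay (2 * p) a h"
      proof -
        have "(decay p a h)\<^sup>2 = decay (2 * p) a h"
          unfolding decay_def by (simp only: power_inverse power_mult[symmetric] mult.commute)
        thus ?thesis by (simp only: power_mult_distrib)
      qed
      finally have K2: "(sine_kernel p a h)\<^sup>2 \<le> (2 ^ (p * d))\<^sup>2 * decay (2 * p) a h" .
      have "(norm h ^ n)\<^sup>2 * norm h powr s = norm h powr (2 * r + d)"
      proof -
        have "(norm h ^ n)\<^sup>2 = norm h powr (2 * real n)"
        proof -
          have "norm h powr (2 * real n) = norm h powr real (2 * n)" by simp
          also have "\<dots> = norm h ^ (2 * n)" by (rule powr_realpow[OF h])
          also have "\<dots> = (norm h ^ n)\<^sup>2" by (simp only: power_mult[symmetric] mult.commute)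
          finally show ?thesis ..
        qed
        moreover have "2 * real n + s = 2 * r + d" using rn by (simp add: s_def)
        ultimately show ?thesis by (simp only: powr_add[symmetric])
      qed
      also have "\<dots> = a powr (- (2 * r + d)) * (a * norm h) powr (2 * r + d)"
      proof -
        have "(a * norm h) powr (2 * r + d) = a powr (2 * r + d) * norm h powr (2 * r + d)"
          by (rule powr_mult)
        moreover have "a powr (- (2 * r + d)) * a powr (2 * r + d) = 1"
          unfolding powr_minus using a by simp
        ultimately show ?thesis by (simp only: mult.assoc[symmetric] mult_1)
      qed
      finally have N2: "(norm h ^ n)\<^sup>2 * norm h powr s = a powr (- (2 * r + d)) * (a * norm h) powr (2 * r + d)" .
      have "(u h)\<^sup>2 = (sine_kernel p a h)\<^sup>2 * ((norm h ^ n)\<^sup>2 * norm h powr s)"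
        by (simp add: u_def power_mult_distrib sq mult.assoc)
      also have "\<dots> \<le> (2 ^ (p * d))\<^sup>2 * decay (2 * p) a h * (a powr (- (2 * r + d)) * (a * norm h) powr (2 * r + d))"
        unfolding N2 by (intro mult_right_mono K2) simp
      also have "\<dots> = (2 ^ (p * d))\<^sup>2 * a powr (- (2 * r + d)) * (decay (2 * p) a h * (a * norm h) powr (2 * r + d))"
        by simp
      also have "\<dots> \<le> (2 ^ (p * d))\<^sup>2 * a powr (- (2 * r + d)) * decay d a h"
      proof (intro mult_left_mono decay_mult_powr_le)
        show "2 * r + real d \<le> 2 * (real (2 * p) - real d)"
          using p rn frac_lt_1[of r] by (simp add: d_def)
      qed (use a r in auto)
      finally show ?thesis .
    qed (simp add: u_def)
    have u: "square_integrable lborel u"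
    proof (rule square_integrableI_bound[OF _ _ u2])
      show "integrable lborel (\<lambda>h. (2 ^ (p * d))\<^sup>2 * a powr (- (2 * r + d)) * decay d a (h :: real^'n))"
        using dint by (rule integrable_mult_right)
    qed measurable
    have "l2_norm lborel u \<le> 2 ^ (p * d) * sqrt J * a powr (- (r + d))"
    proof (rule power2_le_imp_le)
      have "(l2_norm lborel u)\<^sup>2 = (LINT h|lborel. (u h)\<^sup>2)" by (rule l2_norm_power2)
      also have "\<dots> \<le> (LINT h|lborel. (2 ^ (p * d))\<^sup>2 * a powr (- (2 * r + d)) * decay d a (h :: real^'n))"
        using u2 square_integrable_integrable_power2[OF u] dint by (intro integral_mono integrable_mult_right) auto
      also have "\<dots> = (2 ^ (p * d))\<^sup>2 * a powr (- (2 * r + d)) * (LINT h|lborel. decay d a (h :: real^'n))" by simp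
      also have "\<dots> \<le> (2 ^ (p * d))\<^sup>2 * a powr (- (2 * r + d)) * (J / a ^ d)"
        using dJ by (intro mult_left_mono) auto
      also have "a powr (- (2 * r + d)) * (J / a ^ d) = J * (a powr (- (r + d)))\<^sup>2"
      proof -
        have "(a powr (- (r + d)))\<^sup>2 = a powr (- (2 * r + d)) * a powr (- real d)"
          unfolding power2_eq_square powr_add[symmetric] by (rule arg_cong[of _ _ "(powr) a"]) simp
        also have "a powr (- real d) = 1 / a ^ d" using a by (simp add: powr_minus powr_realpow divide_inverse)
        finally show ?thesis by simp
      qed
      hence "(2 ^ (p * d))\<^sup>2 * a powr (- (2 * r + d)) * (J / a ^ d) = (2 ^ (p * d))\<^sup>2 * (J * (a powr (- (r + d)))\<^sup>2)"
        by (simp only: mult.assoc)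
      also have "\<dots> = (2 ^ (p * d) * sqrt J * a powr (- (r + d)))\<^sup>2"
        using J by (simp add: power_mult_distrib)
      finally show "(l2_norm lborel u)\<^sup>2 \<le> (2 ^ (p * d) * sqrt J * a powr (- (r + d)))\<^sup>2" .
    qed (use J in simp)
    have "sine_kernel p a h * (norm h ^ n * D h) = u h * v h" for h
    proof (cases "h = 0")
      case True
      thus ?thesis by (simp add: u_def v_def D_def forward_diff_def l2_norm_def)
    qed (simp add: u_def v_def)
    hence "(LINT h|lborel. sine_kernel p a h * (norm h ^ n * D h)) = (LINT h|lborel. u h * v h)" by simp
    also have "\<dots> \<le> l2_norm lborel u * l2_norm lborel v"
      using l2_Cauchy_Schwarz[OF u v] by linarith
    also have "\<dots> \<le> (2 ^ (p * d) * sqrt J * a powr (- (r + d))) * S"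
      using \<open>l2_norm lborel u \<le> _\<close> v_le J by (intro mult_mono) auto
    also have "\<dots> = 2 ^ (p * d) * sqrt J * (a powr (- (r + d)) * S)" by simp
    also have "\<dots> \<le> 2 ^ (p * d) * (2 * J + sqrt J) * (a powr (- (r + d)) * S)"
      using J aS by (intro mult_right_mono mult_left_mono) auto
    finally show ?thesis by (simp add: J_def d_def D_def mult.assoc)
  qed
qed

end

lemma integral_abs_shift:
  fixes g :: "'a::euclidean_space \<Rightarrow> real"
  assumes "integrable lborel g"
  shows "integrable lborel (\<lambda>x. g (x + a))" "(LINT x|lborel. \<bar>g (x + a)\<bar>) = (LINT x|lborel. \<bar>g x\<bar>)"
proof -
  have [measurable]: "g \<in> borel_measurable borel" using borel_measurable_integrable[OF assms] by simp
  show "integrable lborel (\<lambda>x. g (x + a))"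
    using integrable_lborel_affine[of 1 g a] assms by (simp add: add.commute)
  show "(LINT x|lborel. \<bar>g (x + a)\<bar>) = (LINT x|lborel. \<bar>g x\<bar>)" by (rule integral_shift) measurable
qed

text \<open>After shifting \<open>x\<close>, the average is the pairing of \<open>F\<close> with \<open>H(z) = \<integral> K(h) g(z - j h) dh\<close>. This
function is bounded by \<open>A\<close>, because the kernel is band-limited, and its \<open>L\<^sup>1\<close> norm is at most that of
\<open>g\<close> times the mass of the kernel, so \<open>\<parallel>H\<parallel>\<^sup>2 \<le> sup |H| \<integral> |H|\<close>.\<close>

lemma kernel_average_of_translates_le:
  fixes F g :: "'a::euclidean_space \<Rightarrow> real" and a A :: real and j p :: nat
  assumes F: "square_integrable lborel F" and g: "square_integrable lborel g" "integrable lborel g"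
    and p: "p \<ge> DIM('a)" and a: "a > 0" and j: "j \<ge> 1"
    and small: "\<And>\<xi>. norm \<xi> \<le> DIM('a) * (2 * p * a) \<Longrightarrow> norm (LINT x|lborel. of_real (g x) * cis (\<xi> \<bullet> x)) \<le> A"
  shows "\<bar>LINT h|lborel. sine_kernel p a h * (LINT x|lborel. F (x + real j *\<^sub>R h) * g x)\<bar>
    \<le> l2_norm lborel F * sqrt (A * (LINT x|lborel. \<bar>g x\<bar>) * (LINT h|lborel. sine_kernel p a (h :: 'a)))"
proof -
  define N where "N = (LINT x|lborel. \<bar>g x\<bar>)"
  define Z where "Z = (LINT h|lborel. sine_kernel p a (h :: 'a))"
  have K: "integrable lborel (sine_kernel p a :: 'a \<Rightarrow> real)" by (rule integrable_sine_kernel[OF p a])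
  have [measurable]: "F \<in> borel_measurable borel" "g \<in> borel_measurable borel"
    using F g by (simp_all add: square_integrable_def)
  have A0: "A \<ge> 0" using order_trans[OF norm_ge_zero small[of 0]] a by simp
  have N0: "N \<ge> 0" by (simp add: N_def)
  define P where "P h z = sine_kernel p a h * g (z - real j *\<^sub>R h)" for h z
  define H where "H z = (LINT h|lborel. P h z)" for z
  have Pm [measurable]: "case_prod P \<in> borel_measurable (lborel \<Otimes>\<^sub>M lborel)"
    unfolding P_def split_def by measurable
  have P_z: "integrable lborel (P h)" "(LINT z|lborel. \<bar>P h z\<bar>) = sine_kernel p a h * N" for h
    using integral_abs_shift[OF g(2), of "- (real j *\<^sub>R h)"] unfolding P_def by (simp_all add: abs_mult N_def)
  have P_int: "integrable (lborel \<Otimes>\<^sub>M lborel) (case_prod P)"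
    by (rule lborel_pair.Fubini_integrable[OF Pm]) (use P_z K in \<open>auto intro!: AE_I2\<close>)
  have H_int: "integrable lborel H"
    unfolding H_def using lborel_pair.integrable_snd[OF P_int] .
  have H_abs: "(LINT z|lborel. \<bar>H z\<bar>) \<le> Z * N"
  proof -
    have abs_int: "integrable (lborel \<Otimes>\<^sub>M lborel) (case_prod (\<lambda>h z. \<bar>P h z\<bar>))"
      using integrable_abs[OF P_int] by (simp add: split_def)
    have "(LINT z|lborel. \<bar>H z\<bar>) \<le> (LINT z|lborel. (LINT h|lborel. \<bar>P h z\<bar>))"
      using H_int lborel_pair.integrable_snd[OF abs_int] unfolding H_def
      by (intro integral_mono integral_abs_bound) auto
    also have "\<dots> = (LINT h|lborel. (LINT z|lborel. \<bar>P h z\<bar>))"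
      by (rule lborel_pair.Fubini_integral[OF abs_int])
    also have "\<dots> = Z * N" by (simp add: P_z Z_def)
    finally show ?thesis .
  qed
  have H_sup: "\<bar>H z\<bar> \<le> A" for z
  proof -
    \<comment> \<open>Substituting \<open>x = z - j h\<close> shows a convolution with the kernel at the coarser scale \<open>j / a\<close>.\<close>
    define f where "f x = sine_kernel p a ((z - x) /\<^sub>R real j) * g x" for x
    have [measurable]: "f \<in> borel_measurable borel" unfolding f_def by measurable
    have "(LINT x|lborel. f x) = \<bar>- real j\<bar> ^ DIM('a) *\<^sub>R (LINT h|lborel. f (z + (- real j) *\<^sub>R h))"
      by (rule integral_lborel_affine) (use j in auto)
    also have "(LINT h|lborel. f (z + (- real j) *\<^sub>R h)) = H z"
      using j by (simp add: H_def P_def f_def)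
    finally have eq: "(LINT x|lborel. f x) = real j ^ DIM('a) * H z" by simp
    have "band_limited (DIM('a) * (2 * p * (a / j))) (sine_kernel p (a / j) :: 'a \<Rightarrow> real)"
      using band_limited_sine_kernel[of "a / j" p, where 'a = 'a] a by simp
    moreover have "integrable lborel (\<lambda>x. complex_of_real (g x))" using g(2) by simp
    moreover have "norm (LINT x|lborel. complex_of_real (g x) * cis (\<xi> \<bullet> x)) \<le> A"
      if "norm \<xi> \<le> DIM('a) * (2 * p * (a / j))" for \<xi>
    proof (rule small, rule order_trans[OF that])
      have "a / j \<le> a" using a j by (simp add: divide_le_eq mult_le_cancel_left1)
      thus "DIM('a) * (2 * p * (a / j)) \<le> DIM('a) * (2 * p * a)" by (intro mult_left_mono) auto
    qed
    ultimately have "norm (LINT x|lborel. complex_of_real (g x) * complex_of_real (sine_kernel p (a / j) (z - x))) \<le> A"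
      unfolding band_limited_def by blast
    also have "(LINT x|lborel. complex_of_real (g x) * complex_of_real (sine_kernel p (a / j) (z - x)))
        = complex_of_real (LINT x|lborel. f x)"
      by (simp only: f_def sine_kernel_scale of_real_mult[symmetric] integral_complex_of_real mult.commute)
    finally have "\<bar>real j ^ DIM('a) * H z\<bar> \<le> A" unfolding eq norm_of_real .
    hence "real j ^ DIM('a) * \<bar>H z\<bar> \<le> A" by (simp add: abs_mult)
    moreover have "1 * \<bar>H z\<bar> \<le> real j ^ DIM('a) * \<bar>H z\<bar>" using j by (intro mult_right_mono one_le_power) auto
    ultimately show ?thesis by simp
  qed
  have Hm [measurable]: "H \<in> borel_measurable borel" using borel_measurable_integrable[OF H_int] by simp
  have H2: "(H z)\<^sup>2 \<le> A * \<bar>H z\<bar>" for z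
    using mult_right_mono[OF H_sup[of z], of "\<bar>H z\<bar>"] by (simp add: power2_eq_square)
  have H_sq: "square_integrable lborel H"
    by (rule square_integrableI_bound[OF _ _ H2]) (use H_int in auto)
  have H_l2: "l2_norm lborel H \<le> sqrt (A * N * Z)"
    unfolding l2_norm_def
  proof (rule real_sqrt_le_mono)
    have "(LINT z|lborel. (H z)\<^sup>2) \<le> (LINT z|lborel. A * \<bar>H z\<bar>)"
      using H2 H_int square_integrable_integrable_power2[OF H_sq] by (intro integral_mono) auto
    also have "\<dots> = A * (LINT z|lborel. \<bar>H z\<bar>)" by simp
    also have "\<dots> \<le> A * (Z * N)" using H_abs A0 by (rule mult_left_mono)
    finally show "(LINT z|lborel. (H z)\<^sup>2) \<le> A * N * Z" by (simp add: mult_ac)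
  qed
  have gs: "square_integrable lborel (\<lambda>z. g (z - real j *\<^sub>R h))" for h
    using square_integrable_shift[OF g(1), of "- (real j *\<^sub>R h)"] by simp
  have gs_norm: "l2_norm lborel (\<lambda>z. g (z - real j *\<^sub>R h)) = l2_norm lborel g" for h
    using l2_norm_shift[OF g(1), of "- (real j *\<^sub>R h)"] by simp
  define Q where "Q h z = F z * P h z" for h z
  have Qm [measurable]: "case_prod Q \<in> borel_measurable (lborel \<Otimes>\<^sub>M lborel)"
    unfolding Q_def P_def split_def by measurable
  have abs_sq: "square_integrable lborel (\<lambda>z. \<bar>f z\<bar>)" "l2_norm lborel (\<lambda>z. \<bar>f z\<bar>) = l2_norm lborel f"
    if "square_integrable lborel f" for f :: "'a \<Rightarrow> real"
    using that by (auto simp: square_integrable_def l2_norm_def)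
  have Q_z: "integrable lborel (Q h)" for h
    using integrable_mult_right[OF square_integrable_mult_integrable[OF F gs[of h]], of "sine_kernel p a h"]
    unfolding Q_def P_def by (simp add: mult_ac)
  have Q_norm: "(LINT z|lborel. norm (Q h z)) \<le> l2_norm lborel F * l2_norm lborel g * sine_kernel p a h" for h
  proof -
    have "(LINT z|lborel. norm (Q h z)) = (LINT z|lborel. sine_kernel p a h * (\<bar>F z\<bar> * \<bar>g (z - real j *\<^sub>R h)\<bar>))"
      by (rule Bochner_Integration.integral_cong) (simp_all add: Q_def P_def abs_mult)
    also have "\<dots> = sine_kernel p a h * (LINT z|lborel. \<bar>F z\<bar> * \<bar>g (z - real j *\<^sub>R h)\<bar>)" by simp
    also have "\<dots> \<le> sine_kernel p a h * (l2_norm lborel F * l2_norm lborel g)"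
      using l2_Cauchy_Schwarz[OF abs_sq(1)[OF F] abs_sq(1)[OF gs[of h]]] abs_sq(2)[OF F] abs_sq(2)[OF gs[of h]] gs_norm[of h]
      by (intro mult_left_mono) auto
    finally show ?thesis by (simp only: mult_ac)
  qed
  have Q_int: "integrable (lborel \<Otimes>\<^sub>M lborel) (case_prod Q)"
  proof (rule lborel_pair.Fubini_integrable[OF Qm])
    show "integrable lborel (\<lambda>h. LINT z|lborel. norm (case_prod Q (h, z)))"
    proof (rule Bochner_Integration.integrable_bound)
      show "integrable lborel (\<lambda>h :: 'a. l2_norm lborel F * l2_norm lborel g * sine_kernel p a h)"
        using K by (rule integrable_mult_right)
      show "(\<lambda>h. LINT z|lborel. norm (case_prod Q (h, z))) \<in> borel_measurable lborel" by measurable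
      show "AE h in lborel. norm (LINT z|lborel. norm (case_prod Q (h, z)))
          \<le> norm (l2_norm lborel F * l2_norm lborel g * sine_kernel p a h)"
        using Q_norm by (intro AE_I2) (simp add: abs_of_nonneg)
    qed
    show "AE h in lborel. integrable lborel (\<lambda>z. case_prod Q (h, z))" using Q_z by simp
  qed
  have "(LINT h|lborel. sine_kernel p a h * (LINT x|lborel. F (x + real j *\<^sub>R h) * g x))
      = (LINT h|lborel. (LINT z|lborel. Q h z))"
  proof (rule Bochner_Integration.integral_cong[OF refl])
    fix h :: 'a
    have "(LINT x|lborel. F (x + real j *\<^sub>R h) * g x) = (LINT z|lborel. F z * g (z - real j *\<^sub>R h))"
      using integral_shift[of "\<lambda>z. F z * g (z - real j *\<^sub>R h)" "real j *\<^sub>R h"] by simp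
    moreover have "Q h z = sine_kernel p a h * (F z * g (z - real j *\<^sub>R h))" for z
      by (simp add: Q_def P_def)
    ultimately show "sine_kernel p a h * (LINT x|lborel. F (x + real j *\<^sub>R h) * g x) = (LINT z|lborel. Q h z)"
      by (simp only: integral_mult_right_zero)
  qed
  also have "\<dots> = (LINT z|lborel. (LINT h|lborel. Q h z))"
    by (rule lborel_pair.Fubini_integral[OF Q_int, symmetric])
  also have "\<dots> = (LINT z|lborel. F z * H z)" by (simp add: Q_def H_def)
  finally have "\<bar>LINT h|lborel. sine_kernel p a h * (LINT x|lborel. F (x + real j *\<^sub>R h) * g x)\<bar>
      \<le> l2_norm lborel F * l2_norm lborel H"
    using l2_Cauchy_Schwarz[OF F H_sq] by simp
  also have "\<dots> \<le> l2_norm lborel F * sqrt (A * N * Z)" using H_l2 by (intro mult_left_mono) auto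
  finally show ?thesis by (simp add: N_def Z_def)
qed

text \<open>Jackson's argument in dual form: the pairing is \<open>O(a\<^sup>-\<^sup>r)\<close> up to an error that is governed by the size
\<open>A\<close> of the Fourier transform of \<open>g\<close> on a ball of radius proportional to \<open>a\<close>. The exponent
\<open>p\<close> of the kernel is fixed such that its decay pays for all powers of \<open>norm h\<close> that occur.\<close>

lemma sobolev_pairing_le:
  fixes r :: real
  assumes r: "r > 0"
  obtains C :: real and p :: nat where "C > 0"
    "\<And>f F g (a :: real) A. f \<in> sobolev_space r UNIV \<Longrightarrow> square_integrable lborel F \<Longrightarrow> (AE x in lborel. f x = F x)
      \<Longrightarrow> square_integrable lborel g \<Longrightarrow> integrable lborel g \<Longrightarrow> a > 0
      \<Longrightarrow> (\<And>\<xi> :: real^'n. norm \<xi> \<le> CARD('n) * (2 * p * a) \<Longrightarrow> norm (LINT x|lborel. of_real (g x) * cis (\<xi> \<bullet> x)) \<le> A)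
      \<Longrightarrow> \<bar>LINT x|lborel. F x * g x\<bar> \<le> C * sobolev_norm r UNIV f *
            (a powr (- r) * l2_norm lborel g + sqrt (A * (LINT x|lborel. \<bar>g x\<bar>) * a ^ CARD('n)))"
proof -
  define n where "n = nat \<lfloor>r\<rfloor>"
  define d where "d = CARD('n)"
  define p where "p = n + d + 1"
  have pd: "p \<ge> DIM(real^'n)" by (simp add: p_def d_def)
  obtain c :: "nat \<Rightarrow> real" where c: "c 0 = (-1) ^ Suc n"
    "\<And>(f :: real^'n \<Rightarrow> real) h x. (forward_diff h ^^ Suc n) f x = (\<Sum>j\<le>Suc n. c j * f (x + real j *\<^sub>R h))"
    using forward_diff_power_expansion[of "Suc n", where 'a = "real^'n"] by blast
  obtain z where z: "z > 0" "\<And>a. a > 0 \<Longrightarrow> p \<ge> DIM(real^'n)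
      \<Longrightarrow> z / a ^ DIM(real^'n) \<le> (LINT y|lborel. sine_kernel p a (y :: real^'n))"
    by (rule integral_sine_kernel_ge[where 'a = "real^'n" and p = p]) blast
  define C1 where "C1 = real d ^ n * real (card {ds :: 'n list. length ds = n}) *
    (2 ^ (p * d) * (2 * decay_mass TYPE(real^'n) + sqrt (decay_mass TYPE(real^'n))))"
  define C2 where "C2 = (\<Sum>j=1..Suc n. \<bar>c j\<bar>)"
  have C: "C1 \<ge> 0" "C2 \<ge> 0"
    unfolding C1_def C2_def using decay_mass_nonneg[where 'a = "real^'n"]
    by (auto intro!: mult_nonneg_nonneg add_nonneg_nonneg sum_nonneg)
  show ?thesis
  proof (rule that[of "C1 / z + C2 / sqrt z + 1" p])
    show "0 < C1 / z + C2 / sqrt z + 1" using C z by (intro add_nonneg_pos add_nonneg_nonneg) auto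
    fix f F g :: "real^'n \<Rightarrow> real" and a A :: real
    assume f: "f \<in> sobolev_space r UNIV" and F: "square_integrable lborel F" and fF: "AE x in lborel. f x = F x"
      and g: "square_integrable lborel g" "integrable lborel g" and a: "a > 0"
      and small: "\<And>\<xi> :: real^'n. norm \<xi> \<le> CARD('n) * (2 * p * a) \<Longrightarrow> norm (LINT x|lborel. of_real (g x) * cis (\<xi> \<bullet> x)) \<le> A"
    define S where "S = sobolev_norm r UNIV f"
    define N where "N = (LINT x|lborel. \<bar>g x\<bar>)"
    define Z where "Z = (LINT h|lborel. sine_kernel p a (h :: real^'n))"
    obtain F' G where FG: "square_integrable lborel F'" "AE x in lborel. f x = F' x" "l2_norm lborel F' \<le> S"
      "\<And>ds. length ds = n \<Longrightarrow> square_integrable lborel (G ds)"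
      "\<And>ds. length ds = n \<Longrightarrow> l2_norm lborel (G ds) \<le> S"
      "\<And>ds \<phi>. length ds = n \<Longrightarrow> \<phi> \<in> test_functions UNIV \<Longrightarrow>
         (LINT x|lborel. F' x * partial_derivs ds \<phi> x) = (-1) ^ n * (LINT x|lborel. G ds x * \<phi> x)"
      "\<And>ds. length ds = n \<Longrightarrow> frac r > 0 \<Longrightarrow>
         (\<integral>\<^sup>+h. ennreal ((l2_norm lborel (forward_diff h (G ds)))\<^sup>2 / norm h powr (CARD('n) + 2 * frac r)) \<partial>lborel)
           \<le> ennreal (S\<^sup>2)"
      by (rule sobolev_space_representation[OF f, folded n_def S_def]) blast
    have S: "S \<ge> 0" using order_trans[OF l2_norm_nonneg FG(3)] .
    have Z: "Z \<ge> z / a ^ d" using z(2)[OF a pd] by (simp add: Z_def d_def)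
    have Z0: "Z > 0" using z(1) a by (intro less_le_trans[OF _ Z]) simp
    have K: "integrable lborel (sine_kernel p a :: real^'n \<Rightarrow> real)" by (rule integrable_sine_kernel[OF pd a])
    have [measurable]: "F' \<in> borel_measurable borel" "g \<in> borel_measurable borel" "F \<in> borel_measurable borel"
      using FG(1) g F by (simp_all add: square_integrable_def)
    define T where "T j h = (LINT x|lborel. F' (x + real j *\<^sub>R h) * g x)" for j h
    have T_meas [measurable]: "T j \<in> borel_measurable borel" for j
    proof -
      have "T j \<in> borel_measurable lborel" unfolding T_def by measurable
      thus ?thesis by simp
    qed
    have shift_sq: "square_integrable lborel (\<lambda>x. F' (x + b))" for b by (rule square_integrable_shift[OF FG(1)])
    have T_int: "integrable lborel (\<lambda>h. sine_kernel p a h * T j h)" for j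
    proof (rule integrable_mult_bounded[OF K])
      show "norm (T j h) \<le> l2_norm lborel F' * l2_norm lborel g" for h
        using l2_Cauchy_Schwarz[OF shift_sq g(1), of "real j *\<^sub>R h"] l2_norm_shift[OF FG(1), of "real j *\<^sub>R h"]
        by (simp add: T_def)
    qed measurable
    have diff_eq: "(LINT x|lborel. (forward_diff h ^^ Suc n) F' x * g x) = (\<Sum>j\<le>Suc n. c j * T j h)" for h
    proof -
      have "(LINT x|lborel. (forward_diff h ^^ Suc n) F' x * g x)
          = (LINT x|lborel. (\<Sum>j\<le>Suc n. c j * (F' (x + real j *\<^sub>R h) * g x)))"
        by (simp only: c(2) sum_distrib_right mult.assoc)
      also have "\<dots> = (\<Sum>j\<le>Suc n. LINT x|lborel. c j * (F' (x + real j *\<^sub>R h) * g x))"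
        by (intro Bochner_Integration.integral_sum integrable_mult_right square_integrable_mult_integrable shift_sq g)
      finally show ?thesis by (simp add: T_def)
    qed
    define W where "W h = (\<Sum>ds | length ds = n. sine_kernel p a h * (norm h ^ n * l2_norm lborel (forward_diff h (G ds))))" for h
    have W_int: "integrable lborel W"
      unfolding W_def using FG(4,5) a
      by (intro Bochner_Integration.integrable_sum integrable_sine_kernel_forward_diff) (auto simp: p_def d_def)
    have diff_le: "\<bar>sine_kernel p a h * (\<Sum>j\<le>Suc n. c j * T j h)\<bar> \<le> real d ^ n * l2_norm lborel g * W h" for h
    proof -
      have "\<bar>\<Sum>j\<le>Suc n. c j * T j h\<bar> \<le> l2_norm lborel ((forward_diff h ^^ Suc n) F') * l2_norm lborel g"
        unfolding diff_eq[symmetric] by (intro l2_Cauchy_Schwarz square_integrable_forward_diff_power FG(1) g(1))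
      also have "\<dots> \<le> ((CARD('n) * norm h) ^ n * (\<Sum>ds | length ds = n. l2_norm lborel (forward_diff h (G ds)))) * l2_norm lborel g"
        using FG(1,4,6) by (intro mult_right_mono forward_diff_power_le_weak_derivatives) auto
      finally have "sine_kernel p a h * \<bar>\<Sum>j\<le>Suc n. c j * T j h\<bar>
          \<le> sine_kernel p a h * (((CARD('n) * norm h) ^ n * (\<Sum>ds | length ds = n. l2_norm lborel (forward_diff h (G ds)))) * l2_norm lborel g)"
        by (rule mult_left_mono) simp
      also have "\<dots> = real d ^ n * l2_norm lborel g * W h"
        by (simp add: W_def d_def power_mult_distrib sum_distrib_left mult_ac)
      finally show ?thesis by (simp add: abs_mult)
    qed
    have main: "\<bar>LINT h|lborel. sine_kernel p a h * (\<Sum>j\<le>Suc n. c j * T j h)\<bar> \<le> C1 * a powr (- (r + d)) * S * l2_norm lborel g"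
    proof -
      have int: "integrable lborel (\<lambda>h. sine_kernel p a h * (\<Sum>j\<le>Suc n. c j * T j h))"
      proof -
        have "integrable lborel (\<lambda>h. \<Sum>j\<le>Suc n. c j * (sine_kernel p a h * T j h))"
          by (intro Bochner_Integration.integrable_sum integrable_mult_right T_int)
        moreover have "(\<Sum>j\<le>Suc n. c j * (sine_kernel p a h * T j h)) = sine_kernel p a h * (\<Sum>j\<le>Suc n. c j * T j h)" for h
          by (simp only: sum_distrib_left mult.left_commute)
        ultimately show ?thesis by simp
      qed
      have "\<bar>LINT h|lborel. sine_kernel p a h * (\<Sum>j\<le>Suc n. c j * T j h)\<bar>
          \<le> (LINT h|lborel. \<bar>sine_kernel p a h * (\<Sum>j\<le>Suc n. c j * T j h)\<bar>)" by (rule integral_abs_bound)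
      also have "\<dots> \<le> (LINT h|lborel. real d ^ n * l2_norm lborel g * W h)"
        using diff_le int W_int by (intro integral_mono integrable_abs integrable_mult_right) auto
      also have "\<dots> = real d ^ n * l2_norm lborel g * (LINT h|lborel. W h)" by simp
      also have "(LINT h|lborel. W h)
          = (\<Sum>ds | length ds = n. LINT h|lborel. sine_kernel p a h * (norm h ^ n * l2_norm lborel (forward_diff h (G ds))))"
        unfolding W_def using FG(4,5) a
        by (intro Bochner_Integration.integral_sum integrable_sine_kernel_forward_diff) (auto simp: p_def d_def)
      also have "\<dots> \<le> (\<Sum>ds | length (ds :: 'n list) = n. 2 ^ (p * CARD('n)) *
          (2 * decay_mass TYPE(real^'n) + sqrt (decay_mass TYPE(real^'n))) * a powr (- (r + CARD('n))) * S)"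
        using FG(4,5,7) a r by (intro sum_mono integral_sine_kernel_forward_diff_le) (auto simp: p_def d_def n_def)
      also have "\<dots> = real (card {ds :: 'n list. length ds = n}) * (2 ^ (p * d) *
          (2 * decay_mass TYPE(real^'n) + sqrt (decay_mass TYPE(real^'n))) * a powr (- (r + d)) * S)"
        by (simp add: d_def)
      finally have "\<bar>LINT h|lborel. sine_kernel p a h * (\<Sum>j\<le>Suc n. c j * T j h)\<bar>
          \<le> real d ^ n * l2_norm lborel g * (real (card {ds :: 'n list. length ds = n}) * (2 ^ (p * d) *
          (2 * decay_mass TYPE(real^'n) + sqrt (decay_mass TYPE(real^'n))) * a powr (- (r + d)) * S))"
        by (simp add: mult_left_mono)
      thus ?thesis by (simp add: C1_def mult_ac)
    qed
    have sum_eq: "(LINT h|lborel. sine_kernel p a h * (\<Sum>j\<le>Suc n. c j * T j h))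
        = c 0 * (Z * T 0 0) + (\<Sum>j=1..Suc n. c j * (LINT h|lborel. sine_kernel p a h * T j h))"
    proof -
      have "(LINT h|lborel. sine_kernel p a h * (\<Sum>j\<le>Suc n. c j * T j h))
          = (LINT h|lborel. (\<Sum>j\<le>Suc n. c j * (sine_kernel p a h * T j h)))"
        by (simp only: sum_distrib_left mult.left_commute)
      also have "\<dots> = (\<Sum>j\<le>Suc n. c j * (LINT h|lborel. sine_kernel p a h * T j h))"
        by (subst Bochner_Integration.integral_sum) (simp_all add: T_int)
      also have "\<dots> = c 0 * (LINT h|lborel. sine_kernel p a h * T 0 h) + (\<Sum>j=1..Suc n. c j * (LINT h|lborel. sine_kernel p a h * T j h))"
        by (simp only: atMost_atLeast0 sum.atLeast_Suc_atMost[of 0 "Suc n"] le0 One_nat_def)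
      also have "(LINT h|lborel. sine_kernel p a h * T 0 h) = Z * T 0 0" by (simp add: T_def Z_def)
      finally show ?thesis .
    qed
    have rest: "\<bar>\<Sum>j=1..Suc n. c j * (LINT h|lborel. sine_kernel p a h * T j h)\<bar> \<le> C2 * (S * sqrt (A * N * Z))"
    proof -
      have "\<bar>\<Sum>j=1..Suc n. c j * (LINT h|lborel. sine_kernel p a h * T j h)\<bar>
          \<le> (\<Sum>j=1..Suc n. \<bar>c j * (LINT h|lborel. sine_kernel p a h * T j h)\<bar>)" by (rule sum_abs)
      also have "\<dots> \<le> (\<Sum>j=1..Suc n. \<bar>c j\<bar> * (S * sqrt (A * N * Z)))"
      proof (rule sum_mono)
        fix j assume "j \<in> {1..Suc n}"
        hence "\<bar>LINT h|lborel. sine_kernel p a h * T j h\<bar> \<le> l2_norm lborel F' * sqrt (A * N * Z)"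
          unfolding T_def N_def Z_def using small by (intro kernel_average_of_translates_le FG(1) g pd a) auto
        also have "\<dots> \<le> S * sqrt (A * N * Z)"
        proof (rule mult_right_mono[OF FG(3)])
          have "A \<ge> 0" using order_trans[OF norm_ge_zero small[of 0]] a by simp
          thus "0 \<le> sqrt (A * N * Z)" using Z0 by (simp add: N_def)
        qed
        finally show "\<bar>c j * (LINT h|lborel. sine_kernel p a h * T j h)\<bar> \<le> \<bar>c j\<bar> * (S * sqrt (A * N * Z))"
          by (simp add: abs_mult mult_left_mono)
      qed
      finally show ?thesis by (simp only: C2_def sum_distrib_right)
    qed
    have "\<bar>c 0 * (Z * T 0 0)\<bar> = Z * \<bar>T 0 0\<bar>" using Z0 by (simp add: c(1) abs_mult power_abs)
    hence "Z * \<bar>T 0 0\<bar> \<le> C1 * a powr (- (r + d)) * S * l2_norm lborel g + C2 * (S * sqrt (A * N * Z))"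
      using main rest unfolding sum_eq by linarith
    hence "\<bar>T 0 0\<bar> \<le> (C1 * a powr (- (r + d)) * S * l2_norm lborel g + C2 * (S * sqrt (A * N * Z))) / Z"
      using Z0 by (simp add: pos_le_divide_eq mult.commute)
    also have "\<dots> = C1 * S * (a powr (- (r + d)) / Z) * l2_norm lborel g + C2 * S * (sqrt (A * N) / sqrt Z)"
    proof -
      have "sqrt (A * N * Z) / Z = sqrt (A * N) / sqrt Z"
      proof -
        have "sqrt (A * N * Z) / (sqrt Z * sqrt Z) = sqrt (A * N) / sqrt Z"
          unfolding real_sqrt_mult[of "A * N" Z] using Z0
          by (intro nonzero_mult_divide_mult_cancel_right) simp
        moreover have "sqrt Z * sqrt Z = Z" using Z0 by simp
        ultimately show ?thesis by (simp only:)
      qed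
      moreover have "C2 * (S * sqrt (A * N * Z)) / Z = C2 * S * (sqrt (A * N * Z) / Z)" by simp
      moreover have "C1 * a powr (- (r + d)) * S * l2_norm lborel g / Z = C1 * S * (a powr (- (r + d)) / Z) * l2_norm lborel g"
        by simp
      ultimately show ?thesis by (simp only: add_divide_distrib)
    qed
    also have "\<dots> \<le> C1 * S * (a powr (- r) / z) * l2_norm lborel g + C2 * S * (sqrt (A * N * a ^ d) / sqrt z)"
    proof (intro add_mono mult_left_mono mult_right_mono)
      have inv: "1 / Z \<le> a ^ d / z"
      proof -
        have "1 / Z \<le> 1 / (z / a ^ d)" using Z z(1) a Z0 by (intro divide_left_mono) auto
        thus ?thesis by simp
      qed
      have "a powr (- (r + d)) = a powr (- r) * (1 / a ^ d)"
        using a by (simp add: powr_diff powr_realpow)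
      hence "a powr (- (r + d)) / Z = a powr (- r) * (1 / a ^ d) * (1 / Z)" by simp
      also have "\<dots> \<le> a powr (- r) * (1 / a ^ d) * (a ^ d / z)"
        using inv a by (intro mult_left_mono) auto
      also have "\<dots> = a powr (- r) / z" using a by simp
      finally show "a powr (- (r + d)) / Z \<le> a powr (- r) / z" .
      have A0: "A * N \<ge> 0" using order_trans[OF norm_ge_zero small[of 0]] a by (simp add: N_def)
      have "sqrt (A * N) / sqrt Z = sqrt (A * N * (1 / Z))" by (simp add: real_sqrt_mult real_sqrt_divide)
      also have "\<dots> \<le> sqrt (A * N * (a ^ d / z))" using inv A0 by (intro real_sqrt_le_mono mult_left_mono) auto
      also have "\<dots> = sqrt (A * N * a ^ d) / sqrt z" by (simp add: real_sqrt_mult real_sqrt_divide)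
      finally show "sqrt (A * N) / sqrt Z \<le> sqrt (A * N * a ^ d) / sqrt z" .
    qed (use C S in auto)
    also have "\<dots> = S * ((C1 / z) * (a powr (- r) * l2_norm lborel g) + (C2 / sqrt z) * sqrt (A * N * a ^ d))"
      by (simp add: algebra_simps)
    also have "\<dots> \<le> S * ((C1 / z + C2 / sqrt z + 1) * (a powr (- r) * l2_norm lborel g)
        + (C1 / z + C2 / sqrt z + 1) * sqrt (A * N * a ^ d))"
    proof (intro mult_left_mono[OF _ S] add_mono mult_right_mono)
      have "A * N * a ^ d \<ge> 0" using order_trans[OF norm_ge_zero small[of 0]] a by (simp add: N_def)
      thus "0 \<le> sqrt (A * N * a ^ d)" by simp
    qed (use C z in auto)
    also have "T 0 0 = (LINT x|lborel. F x * g x)"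
      unfolding T_def
    proof (rule integral_cong_AE)
      show "AE x in lborel. F' (x + real 0 *\<^sub>R 0) * g x = F x * g x"
        using fF FG(2) by eventually_elim simp
    qed measurable
    finally show "\<bar>LINT x|lborel. F x * g x\<bar> \<le> (C1 / z + C2 / sqrt z + 1) * sobolev_norm r UNIV f *
            (a powr (- r) * l2_norm lborel g + sqrt (A * (LINT x|lborel. \<bar>g x\<bar>) * a ^ CARD('n)))"
      by (simp add: S_def N_def d_def algebra_simps)
  qed
qed

section \<open>The approximation rate\<close>

lemma norm_L2_eq_l2_norm:
  fixes f h :: "real^'n \<Rightarrow> real"
  assumes \<Omega>: "\<Omega> \<in> sets borel" and f: "f \<in> borel_measurable (lebesgue_on \<Omega>)"
    and eq: "AE x in lebesgue_on \<Omega>. f x = h x" and h: "h \<in> borel_measurable borel" "\<And>x. x \<notin> \<Omega> \<Longrightarrow> h x = 0"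
  shows "norm_L2 \<Omega> f = l2_norm lborel h"
proof -
  have hm: "h \<in> borel_measurable lebesgue" using h by (simp add: measurable_completion)
  have \<Omega>m: "\<Omega> \<in> sets lebesgue" using \<Omega> by simp
  have "(LINT x|lebesgue_on \<Omega>. (f x)\<^sup>2) = (LINT x|lebesgue_on \<Omega>. (h x)\<^sup>2)"
  proof (rule integral_cong_AE)
    show "AE x in lebesgue_on \<Omega>. (f x)\<^sup>2 = (h x)\<^sup>2" using eq by eventually_elim simp
    show "(\<lambda>x. (h x)\<^sup>2) \<in> borel_measurable (lebesgue_on \<Omega>)"
      using hm by (intro borel_measurable_power measurable_restrict_space1)
  qed (use f in simp)
  also have "\<dots> = (LINT x|lebesgue. indicator \<Omega> x *\<^sub>R (h x)\<^sup>2)"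
    using \<Omega>m by (intro integral_restrict_space) simp
  also have "\<dots> = (LINT x|lebesgue. (h x)\<^sup>2)"
    using h(2) by (intro Bochner_Integration.integral_cong refl) (auto simp: indicator_def)
  also have "\<dots> = (LINT x|lborel. (h x)\<^sup>2)"
    using h(1) by (intro integral_completion) simp
  finally show ?thesis by (simp add: norm_L2_def l2_norm_def)
qed

lemma sobolev_norm_nonneg: "sobolev_norm s \<Omega> f \<ge> 0"
  unfolding sobolev_norm_def by (auto intro!: add_nonneg_nonneg sum_nonneg)

lemma bounded_support_L1_le_L2:
  fixes g :: "'a::euclidean_space \<Rightarrow> real"
  assumes \<Omega>: "open \<Omega>" "bounded \<Omega>" and g: "square_integrable lborel g" "\<And>x. g x \<noteq> 0 \<Longrightarrow> x \<in> \<Omega>"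
  shows "integrable lborel g" "(LINT x|lborel. \<bar>g x\<bar>) \<le> l2_norm lborel (indicator \<Omega>) * l2_norm lborel g"
proof -
  have "emeasure lborel \<Omega> < \<infinity>" using emeasure_bounded_finite[OF \<Omega>(2)] .
  hence I: "square_integrable lborel (indicator \<Omega>)"
    using \<Omega>(1) by (auto simp: square_integrable_def power2_eq_square integrable_indicator_iff simp flip: indicator_inter_arith)
  have abs_g: "square_integrable lborel (\<lambda>x. \<bar>g x\<bar>)" "l2_norm lborel (\<lambda>x. \<bar>g x\<bar>) = l2_norm lborel g"
    using g(1) by (auto simp: square_integrable_def l2_norm_def)
  have eq: "g = (\<lambda>x. indicator \<Omega> x * g x)" "(\<lambda>x. \<bar>g x\<bar>) = (\<lambda>x. indicator \<Omega> x * \<bar>g x\<bar>)"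
    using g(2) by (auto simp: indicator_def fun_eq_iff)
  show "integrable lborel g"
    by (subst eq(1)) (rule square_integrable_mult_integrable[OF I g(1)])
  have "\<bar>LINT x|lborel. indicator \<Omega> x * \<bar>g x\<bar>\<bar> \<le> l2_norm lborel (indicator \<Omega>) * l2_norm lborel (\<lambda>x. \<bar>g x\<bar>)"
    by (rule l2_Cauchy_Schwarz[OF I abs_g(1)])
  thus "(LINT x|lborel. \<bar>g x\<bar>) \<le> l2_norm lborel (indicator \<Omega>) * l2_norm lborel g"
    unfolding eq(2)[symmetric] abs_g(2) by linarith
qed

text \<open>Applied to the residual \<open>g\<close> of the projection, the hypothesis reads \<open>\<parallel>g\<parallel>\<^sup>2 = \<langle>F, g\<rangle> \<le> \<epsilon> \<parallel>g\<parallel>\<close>.\<close>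

lemma best_approximation_by_duality:
  fixes F :: "'a \<Rightarrow> real"
  assumes A: "finite A" and u: "\<And>b. b \<in> A \<Longrightarrow> square_integrable M (u b)" and F: "square_integrable M F"
    and key: "\<And>c g. g = (\<lambda>x. F x - (\<Sum>b\<in>A. c b * u b x)) \<Longrightarrow> square_integrable M g
       \<Longrightarrow> (\<And>b. b \<in> A \<Longrightarrow> (LINT x|M. g x * u b x) = 0) \<Longrightarrow> \<bar>LINT x|M. F x * g x\<bar> \<le> \<epsilon> * l2_norm M g"
    and \<epsilon>: "\<epsilon> \<ge> 0"
  obtains c where "l2_norm M (\<lambda>x. F x - (\<Sum>b\<in>A. c b * u b x)) \<le> \<epsilon>"
proof -
  obtain c where c: "\<And>b. b \<in> A \<Longrightarrow> (LINT x|M. (F x - (\<Sum>a\<in>A. c a * u a x)) * u b x) = 0"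
    using l2_projection[of A M u F] A u F by blast
  define g where "g = (\<lambda>x. F x - (\<Sum>a\<in>A. c a * u a x))"
  have g: "square_integrable M g"
    unfolding g_def by (intro square_integrable_diff square_integrable_sum square_integrable_cmult F u)
  have "(l2_norm M g)\<^sup>2 = (LINT x|M. F x * g x - (\<Sum>b\<in>A. c b * (g x * u b x)))"
    unfolding l2_norm_power2
    by (rule Bochner_Integration.integral_cong)
      (auto simp: power2_eq_square g_def left_diff_distrib sum_distrib_right mult_ac)
  also have "\<dots> = (LINT x|M. F x * g x) - (\<Sum>b\<in>A. c b * (LINT x|M. g x * u b x))"
    using square_integrable_mult_integrable[OF F g] square_integrable_mult_integrable[OF g u]
    by (subst Bochner_Integration.integral_diff) (auto simp: Bochner_Integration.integral_sum intro!: Bochner_Integration.integrable_sum)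
  also have "\<dots> = (LINT x|M. F x * g x)" using c by (simp add: g_def)
  finally have eq: "l2_norm M g * l2_norm M g = (LINT x|M. F x * g x)" by (simp add: power2_eq_square)
  have "\<bar>LINT x|M. F x * g x\<bar> \<le> \<epsilon> * l2_norm M g"
    by (rule key[OF g_def g]) (use c in \<open>simp add: g_def\<close>)
  hence "l2_norm M g * l2_norm M g \<le> \<epsilon> * l2_norm M g" using eq by linarith
  hence "l2_norm M g \<le> \<epsilon>"
    using \<epsilon> l2_norm_nonneg[of M g] by (cases "l2_norm M g = 0") (auto simp: mult_le_cancel_right)
  thus ?thesis using that by (simp add: g_def)
qed

lemma exponential_beats_power:
  fixes \<gamma> b C r :: real and d :: nat
  assumes "\<gamma> > 0" "b \<ge> 0" "C \<ge> 0" "r \<ge> 0"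
  obtains K where "K \<ge> 0" "\<And>m :: nat. m \<ge> 1 \<Longrightarrow> sqrt (C * exp (- \<gamma> * m) * (b * m) ^ d) \<le> K * real m powr (- r)"
proof -
  define q where "q = d + nat \<lceil>2 * r\<rceil>"
  define K where "K = sqrt (C * b ^ d * (fact q / \<gamma> ^ q))"
  show ?thesis
  proof (rule that[of K])
    show "K \<ge> 0" using assms by (simp add: K_def)
    fix m :: nat assume m: "m \<ge> 1"
    have "(\<gamma> * m) ^ q / fact q \<le> exp (\<gamma> * m)" using assms by (intro power_div_fact_le_exp) simp
    hence "(\<gamma> * m) ^ q \<le> exp (\<gamma> * m) * fact q" by (simp add: pos_divide_le_eq)
    hence "(\<gamma> * m) ^ q / \<gamma> ^ q \<le> exp (\<gamma> * m) * fact q / \<gamma> ^ q"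
      using assms by (intro divide_right_mono) auto
    moreover have "(\<gamma> * m) ^ q / \<gamma> ^ q = real m ^ q" using assms by (simp add: power_mult_distrib)
    ultimately have "real m ^ q \<le> fact q / \<gamma> ^ q * exp (\<gamma> * m)" by (simp add: mult.commute)
    hence "exp (- \<gamma> * m) * real m ^ q \<le> exp (- \<gamma> * m) * (fact q / \<gamma> ^ q * exp (\<gamma> * m))"
      by (rule mult_left_mono) simp
    also have "\<dots> = fact q / \<gamma> ^ q" by (simp add: exp_minus)
    finally have q: "exp (- \<gamma> * m) * real m ^ q \<le> fact q / \<gamma> ^ q" .
    have "real m ^ d * (real m powr r)\<^sup>2 = real m powr (real d + 2 * r)"
      using m powr_realpow[of "real m" d] by (simp only: powr_add power2_eq_square mult_2)
    also have "\<dots> \<le> real m powr real q"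
      using m by (intro powr_mono) (auto simp: q_def of_nat_ceiling)
    also have "\<dots> = real m ^ q" using m by (intro powr_realpow) simp
    finally have "C * b ^ d * (exp (- \<gamma> * m) * (real m ^ d * (real m powr r)\<^sup>2)) \<le> C * b ^ d * (exp (- \<gamma> * m) * real m ^ q)"
      using assms by (intro mult_left_mono) auto
    also have "\<dots> \<le> C * b ^ d * (fact q / \<gamma> ^ q)" using q assms by (intro mult_left_mono) auto
    finally have "sqrt (C * exp (- \<gamma> * m) * (b * m) ^ d * (real m powr r)\<^sup>2) \<le> K"
      unfolding K_def by (intro real_sqrt_le_mono) (simp add: power_mult_distrib mult_ac)
    hence "sqrt (C * exp (- \<gamma> * m) * (b * m) ^ d) * real m powr r \<le> K"
      by (simp add: real_sqrt_mult)
    hence "sqrt (C * exp (- \<gamma> * m) * (b * m) ^ d) \<le> K / real m powr r"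
      using m by (simp add: pos_le_divide_eq)
    thus "sqrt (C * exp (- \<gamma> * m) * (b * m) ^ d) \<le> K * real m powr (- r)"
      by (simp add: powr_minus divide_inverse)
  qed
qed

theorem corollary1:
  fixes \<Omega> :: "(real^'n) set" and r :: real
    and \<sigma> :: "complex \<Rightarrow> complex" and \<Omega>\<^sub>\<sigma> :: "complex set" and c\<^sub>\<sigma> \<rho>\<^sub>\<sigma> :: real
    and I I' :: "real set"
    and N :: "nat \<Rightarrow> nat" and \<theta> :: "nat \<Rightarrow> nat \<Rightarrow> real^'n" and \<omega> :: "nat \<Rightarrow> nat \<Rightarrow> real"
  assumes "CARD('n) \<ge> 2" and "r > 0"
    and "open \<Omega>" and "connected \<Omega>" and "\<Omega> \<noteq> {}" and "bounded \<Omega>"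
    and "\<exists>E. sobolev_extension_operator \<Omega> E"
    and "open \<Omega>\<^sub>\<sigma>" and "connected \<Omega>\<^sub>\<sigma>" and "\<Omega>\<^sub>\<sigma> \<noteq> {}" and "bounded \<Omega>\<^sub>\<sigma>"
    and "\<sigma> analytic_on \<Omega>\<^sub>\<sigma>"
    and "\<And>z. z \<in> \<Omega>\<^sub>\<sigma> \<inter> \<real> \<Longrightarrow> \<sigma> z \<in> \<real>"
    and "c\<^sub>\<sigma> > 0" and "\<rho>\<^sub>\<sigma> > 0"
    and "\<And>k. 1 / fact k * norm ((deriv ^^ k) \<sigma> 0) \<ge> c\<^sub>\<sigma> * \<rho>\<^sub>\<sigma> powi (- int k)"
    and "open I" and "is_interval I" and "bounded I"
    and "\<And>\<eta> x. \<eta> \<in> sphere 0 1 \<Longrightarrow> x \<in> closure \<Omega> \<Longrightarrow> \<eta> \<bullet> x \<in> I"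
    and "is_interval I'" and "bounded I'" and "Inf I' < Sup I'" and "0 \<in> I'"
    and "compactly_contained {complex_of_real (w * t) | w t. w \<in> I' \<and> t \<in> I} \<Omega>\<^sub>\<sigma>"
    and "quasi_uniform (sphere 0 1) sphere_dist N \<theta>"
    and "\<exists>c\<^sub>1>0. \<exists>c\<^sub>2>0. \<forall>m\<ge>1. c\<^sub>1 * real m ^ (CARD('n) - 1) \<le> real (N m) \<and>
           real (N m) \<le> c\<^sub>2 * real m ^ (CARD('n) - 1)"
    and "quasi_chebyshev I' (\<lambda>m. m) \<omega>"
  shows "\<exists>K>0. \<forall>m\<ge>1. \<forall>f\<in>sobolev_space r \<Omega>.
     (INF a :: nat \<Rightarrow> nat \<Rightarrow> real.
        norm_L2 \<Omega> (\<lambda>x. f x - (\<Sum>i = 1..N m. \<Sum>j = 1..m.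
          a i j * Re (\<sigma> (complex_of_real (\<omega> m j * (\<theta> m i \<bullet> x)))))))
     \<le> K * real (m ^ CARD('n)) powr (- r / real CARD('n)) * sobolev_norm r \<Omega> f"
proof -
  note d = assms(1) and r = assms(2) and \<Omega> = assms(3,5,6)
  define J where "J = closure I'"
  have hol: "\<sigma> holomorphic_on \<Omega>\<^sub>\<sigma>" using assms(12) by (rule analytic_imp_holomorphic)
  have J: "compact J" "convex J" "0 \<in> J"
    using assms(21,22,24) closure_subset unfolding J_def
    by (auto simp: compact_closure is_interval_convex_1 intro!: convex_closure)
  \<comment> \<open>Points of \<open>closure I'\<close> are covered because the closure of the set of products lies in \<open>\<Omega>\<^sub>\<sigma>\<close>.\<close>
  have JT: "of_real (w * (\<eta> \<bullet> x)) \<in> \<Omega>\<^sub>\<sigma>" if "w \<in> J" "\<eta> \<in> sphere 0 1" "x \<in> closure \<Omega>" for w \<eta> x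
  proof -
    let ?X = "{complex_of_real (w * t) | w t. w \<in> I' \<and> t \<in> I}"
    let ?h = "\<lambda>w. complex_of_real (w * (\<eta> \<bullet> x))"
    have "?h ` closure I' \<subseteq> closure ?X"
    proof (rule image_closure_subset)
      show "?h ` I' \<subseteq> closure ?X"
        using assms(20)[OF that(2,3)] closure_subset[of ?X] by blast
    qed (auto intro!: continuous_intros)
    also have "closure ?X \<subseteq> \<Omega>\<^sub>\<sigma>"
      using assms(25) interior_subset unfolding compactly_contained_def by blast
    finally show ?thesis using that(1) unfolding J_def by blast
  qed
  have real: "\<sigma> (of_real (w * (\<eta> \<bullet> x))) \<in> \<real>" if "w \<in> J" "\<eta> \<in> sphere 0 1" "x \<in> closure \<Omega>" for w \<eta> x
    using assms(13)[of "of_real (w * (\<eta> \<bullet> x))"] JT[OF that] by simp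
  have lower: "norm ((deriv ^^ k) \<sigma> 0) \<ge> fact k * c\<^sub>\<sigma> / \<rho>\<^sub>\<sigma> ^ k" for k
    using assms(16)[of k] by (simp add: power_int_minus field_simps)
  obtain c1 where c1: "c1 > 0" "\<And>m. m \<ge> 1 \<Longrightarrow> c1 * real m ^ (CARD('n) - 1) \<le> real (N m)"
    using assms(27) by blast
  have \<omega>: "\<omega> m ` {1..m} \<subseteq> J" if "m \<ge> 1" for m
    using assms(28) that closure_subset[of I'] unfolding quasi_chebyshev_def J_def by blast
  have \<theta>: "\<theta> m i \<in> sphere 0 1" if "m \<ge> 1" "i \<in> {1..N m}" for m i
    using assms(26) that unfolding quasi_uniform_def by blast
  obtain \<kappa> \<gamma> C M :: real where \<kappa>: "\<kappa> > 0" "\<gamma> > 0" "C > 0" and fourier: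
    "\<And>m g \<xi>. real m \<ge> M \<Longrightarrow> integrable lborel g \<Longrightarrow> (\<And>x. g x \<noteq> 0 \<Longrightarrow> x \<in> \<Omega>)
      \<Longrightarrow> (\<And>i j. i \<in> {1..N m} \<Longrightarrow> j \<in> {1..m} \<Longrightarrow>
            (LINT x|lborel. g x * Re (\<sigma> (of_real (\<omega> m j * (\<theta> m i \<bullet> x))))) = 0)
      \<Longrightarrow> norm \<xi> \<le> \<kappa> * m
      \<Longrightarrow> norm (LINT x|lborel. of_real (g x) * cis (\<xi> \<bullet> x)) \<le> C * exp (- \<gamma> * m) * (LINT x|lborel. \<bar>g x\<bar>)"
  proof (rule fourier_transform_exponentially_small[OF d \<Omega>(3,2) hol assms(8) J JT real assms(14,15) lower
          assms(26) c1 \<omega> quasi_chebyshev_distinct[OF assms(28,23)]], assumption+, goal_cases)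
    case (1 \<kappa> \<gamma> C M)
    show ?case by (rule 1(1)[OF 1(2,3,4)]) (fact 1(5))
  qed
  obtain p :: nat and B :: real where B: "B > 0" and pairing:
    "\<And>f F g (a :: real) A. f \<in> sobolev_space r UNIV \<Longrightarrow> square_integrable lborel F \<Longrightarrow> (AE x in lborel. f x = F x)
      \<Longrightarrow> square_integrable lborel g \<Longrightarrow> integrable lborel g \<Longrightarrow> a > 0
      \<Longrightarrow> (\<And>\<xi> :: real^'n. norm \<xi> \<le> CARD('n) * (2 * p * a) \<Longrightarrow> norm (LINT x|lborel. of_real (g x) * cis (\<xi> \<bullet> x)) \<le> A)
      \<Longrightarrow> \<bar>LINT x|lborel. F x * g x\<bar> \<le> B * sobolev_norm r UNIV f *
            (a powr (- r) * l2_norm lborel g + sqrt (A * (LINT x|lborel. \<bar>g x\<bar>) * a ^ CARD('n)))"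
  proof (rule sobolev_pairing_le[where 'n = 'n, OF r], goal_cases)
    case (1 B p)
    show ?case by (rule 1(1)[OF 1(2)]) (fact 1(3))
  qed
  \<comment> \<open>The kernel at scale \<open>a = b m\<close> only involves frequencies of norm at most \<open>\<kappa> m\<close>.\<close>
  define b where "b = \<kappa> / (CARD('n) * (2 * p) + 1)"
  have b_pos: "real (CARD('n) * (2 * p) + 1) > 0" by (simp add: add_pos_nonneg)
  hence b: "b > 0" unfolding b_def using \<kappa> by (intro divide_pos_pos)
  have b_le: "CARD('n) * (2 * p * (b * m)) \<le> \<kappa> * m" for m :: nat
  proof -
    have "real (CARD('n)) * (2 * p) * b \<le> (CARD('n) * (2 * p) + 1) * b" using b by (intro mult_right_mono) auto
    also have "\<dots> = \<kappa>" unfolding b_def using b_pos by simp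
    finally have "real (CARD('n)) * (2 * p) * b * m \<le> \<kappa> * m" by (rule mult_right_mono) simp
    thus ?thesis by (simp add: mult_ac)
  qed
  define V where "V = l2_norm lborel (indicator \<Omega> :: real^'n \<Rightarrow> real)"
  obtain K1 where K1: "K1 \<ge> 0" "\<And>m :: nat. m \<ge> 1 \<Longrightarrow>
      sqrt (C * exp (- \<gamma> * m) * (b * m) ^ CARD('n)) \<le> K1 * real m powr (- r)"
    using exponential_beats_power[OF \<kappa>(2) less_imp_le[OF b] less_imp_le[OF \<kappa>(3)] less_imp_le[OF r]] by blast
  obtain E where E: "sobolev_extension_operator \<Omega> E" using assms(7) by blast
  have "\<exists>C. \<forall>f\<in>sobolev_space r \<Omega>. E f \<in> sobolev_space r UNIV \<and>
        sobolev_norm r UNIV (E f) \<le> C * sobolev_norm r \<Omega> f"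
    using E less_imp_le[OF r] unfolding sobolev_extension_operator_def by blast
  then obtain CE where CE: "\<And>f. f \<in> sobolev_space r \<Omega> \<Longrightarrow> E f \<in> sobolev_space r UNIV \<and>
        sobolev_norm r UNIV (E f) \<le> CE * sobolev_norm r \<Omega> f"
    by blast
  define D where "D = \<bar>CE\<bar> + 1"
  define M1 where "M1 = max 1 M"
  define K where "K = B * D * (b powr (- r) + V * K1) + D * M1 powr r + 1"
  have D: "D > 0" by (simp add: D_def)
  have V: "V \<ge> 0" by (simp add: V_def)
  have "K > 0" unfolding K_def using B D V K1(1) by (intro add_nonneg_pos add_nonneg_nonneg mult_nonneg_nonneg) auto
  show ?thesis
  proof (intro exI[of _ K] conjI allI impI ballI)
    show "K > 0" by fact
    fix m :: nat and f assume m: "m \<ge> 1" and f: "f \<in> sobolev_space r \<Omega>"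
    define S where "S = sobolev_norm r \<Omega> f"
    have S: "S \<ge> 0" unfolding S_def by (rule sobolev_norm_nonneg)
    have fL: "f \<in> L2_space \<Omega>" using f by (simp add: sobolev_space_def)
    have Ef: "E f \<in> sobolev_space r UNIV" "sobolev_norm r UNIV (E f) \<le> D * S"
    proof -
      show "E f \<in> sobolev_space r UNIV" using CE[OF f] ..
      have "sobolev_norm r UNIV (E f) \<le> CE * S" using CE[OF f] by (simp add: S_def)
      also have "\<dots> \<le> D * S" using S by (intro mult_right_mono) (auto simp: D_def)
      finally show "sobolev_norm r UNIV (E f) \<le> D * S" .
    qed
    obtain F where F: "square_integrable lborel F" "AE x in lborel. E f x = F x" "l2_norm lborel F \<le> sobolev_norm r UNIV (E f)"
      by (rule sobolev_space_representation[OF Ef(1)]) blast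
    have [measurable]: "F \<in> borel_measurable borel" using F by (simp add: square_integrable_def)
    have \<Omega>_borel [measurable]: "\<Omega> \<in> sets borel" using \<Omega>(1) by simp
    define neuron where "neuron i j x = Re (\<sigma> (of_real (\<omega> m j * (\<theta> m i \<bullet> x))))" for i j x
    define u where "u = (\<lambda>(i, j) x. if x \<in> \<Omega> then neuron i j x else 0)"
    define A where "A = {1..N m} \<times> {1..m}"
    have neuron_cont: "continuous_on (closure \<Omega>) (neuron i j)" if "i \<in> {1..N m}" "j \<in> {1..m}" for i j
    proof -
      have "continuous_on (closure \<Omega>) (\<lambda>x. \<sigma> (of_real (\<omega> m j * (\<theta> m i \<bullet> x))))"
      proof (rule continuous_on_compose2[OF holomorphic_on_imp_continuous_on[OF hol]])
        show "(\<lambda>x. complex_of_real (\<omega> m j * (\<theta> m i \<bullet> x))) ` closure \<Omega> \<subseteq> \<Omega>\<^sub>\<sigma>"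
          using JT[OF _ \<theta>[OF m that(1)]] \<omega>[OF m] that(2) by blast
      qed (intro continuous_intros)
      thus ?thesis unfolding neuron_def by (intro continuous_intros)
    qed
    have u_sq: "square_integrable lborel (u a)" if "a \<in> A" for a
    proof -
      have "fst a \<in> {1..N m}" "snd a \<in> {1..m}" using that by (auto simp: A_def)
      then obtain i j where a: "a = (i, j)" "i \<in> {1..N m}" "j \<in> {1..m}" using surjective_pairing by blast
      have "compact (closure \<Omega>)" using \<Omega>(3) by (simp add: compact_closure)
      then obtain H where H: "\<And>x. x \<in> closure \<Omega> \<Longrightarrow> \<bar>neuron i j x\<bar> \<le> H"
        using compact_imp_bounded[OF compact_continuous_image[OF neuron_cont[OF a(2,3)]]] unfolding bounded_iff by auto
      have "u a \<in> borel_measurable borel"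
        unfolding u_def a split_conv using continuous_on_subset[OF neuron_cont[OF a(2,3)] closure_subset]
        by (intro borel_measurable_continuous_on_if \<Omega>_borel) auto
      moreover have "emeasure lborel \<Omega> < \<infinity>" using emeasure_bounded_finite[OF \<Omega>(3)] .
      hence "integrable lborel (\<lambda>x. H\<^sup>2 * indicator \<Omega> x :: real)"
        using \<Omega>_borel by (intro integrable_mult_right) (simp add: integrable_indicator_iff)
      moreover have "(u a x)\<^sup>2 \<le> H\<^sup>2 * indicator \<Omega> x" for x
        using H[of x] closure_subset[of \<Omega>] power_mono[of "\<bar>neuron i j x\<bar>" H 2] by (auto simp: u_def a)
      ultimately show ?thesis by (intro square_integrableI_bound[where b = "\<lambda>x. H\<^sup>2 * indicator \<Omega> x"]) auto
    qed
    have [measurable]: "u a \<in> borel_measurable borel" if "a \<in> A" for a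
      using u_sq[OF that] by (simp add: square_integrable_def)
    define F0 where "F0 x = (if x \<in> \<Omega> then F x else 0)" for x
    have F0_m [measurable]: "F0 \<in> borel_measurable borel" unfolding F0_def by measurable
    have F0: "square_integrable lborel F0"
      by (rule square_integrableI_bound[OF _ square_integrable_integrable_power2[OF F(1)]]) (auto simp: F0_def)
    have INF_le: "(INF a :: nat \<Rightarrow> nat \<Rightarrow> real.
        norm_L2 \<Omega> (\<lambda>x. f x - (\<Sum>i = 1..N m. \<Sum>j = 1..m. a i j * Re (\<sigma> (complex_of_real (\<omega> m j * (\<theta> m i \<bullet> x)))))))
      \<le> l2_norm lborel (\<lambda>x. F0 x - (\<Sum>a\<in>A. c a * u a x))" for c
    proof -
      define h where "h x = F0 x - (\<Sum>a\<in>A. c a * u a x)" for x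
      have h: "h \<in> borel_measurable borel" unfolding h_def by measurable
      have h0: "h x = 0" if "x \<notin> \<Omega>" for x using that by (simp add: h_def F0_def u_def split_def)
      have on: "(\<Sum>i = 1..N m. \<Sum>j = 1..m. c (i, j) * neuron i j x) = (\<Sum>a\<in>A. c a * u a x)" if "x \<in> \<Omega>" for x
        unfolding A_def sum.cartesian_product using that by (intro sum.cong) (auto simp: u_def)
      have "norm_L2 \<Omega> (\<lambda>x. f x - (\<Sum>i = 1..N m. \<Sum>j = 1..m. c (i, j) * neuron i j x)) = l2_norm lborel h"
      proof (rule norm_L2_eq_l2_norm[OF \<Omega>_borel _ _ h h0])
        have "(\<lambda>x. \<Sum>a\<in>A. c a * u a x) \<in> borel_measurable borel" by measurable
        hence "(\<lambda>x. \<Sum>a\<in>A. c a * u a x) \<in> borel_measurable (lebesgue_on \<Omega>)"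
          by (intro measurable_restrict_space1) (simp add: measurable_completion)
        hence meas: "(\<lambda>x. f x - (\<Sum>a\<in>A. c a * u a x)) \<in> borel_measurable (lebesgue_on \<Omega>)"
          using fL by (intro borel_measurable_diff) (auto simp: L2_space_def)
        have eq: "f x - (\<Sum>i = 1..N m. \<Sum>j = 1..m. c (i, j) * neuron i j x) = f x - (\<Sum>a\<in>A. c a * u a x)"
          if "x \<in> space (lebesgue_on \<Omega>)" for x
        proof -
          have "x \<in> \<Omega>" using that by simp
          thus ?thesis by (simp only: on)
        qed
        show "(\<lambda>x. f x - (\<Sum>i = 1..N m. \<Sum>j = 1..m. c (i, j) * neuron i j x)) \<in> borel_measurable (lebesgue_on \<Omega>)"
          by (rule measurable_cong[THEN iffD2, rotated, OF meas]) (rule eq)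
        have "AE x in lebesgue_on \<Omega>. E f x = f x"
          using E fL unfolding sobolev_extension_operator_def by blast
        moreover have "AE x in lebesgue_on \<Omega>. E f x = F x"
          using AE_completion[OF F(2)] by (subst AE_restrict_space_iff) (auto elim: eventually_mono)
        moreover have "AE x in lebesgue_on \<Omega>. x \<in> \<Omega>"
          by (rule AE_I2) simp
        ultimately show "AE x in lebesgue_on \<Omega>. f x - (\<Sum>i = 1..N m. \<Sum>j = 1..m. c (i, j) * neuron i j x) = h x"
          by eventually_elim (simp only: on h_def F0_def if_True)
      qed
      moreover have "(INF a :: nat \<Rightarrow> nat \<Rightarrow> real. norm_L2 \<Omega> (\<lambda>x. f x - (\<Sum>i = 1..N m. \<Sum>j = 1..m. a i j * neuron i j x)))
          \<le> norm_L2 \<Omega> (\<lambda>x. f x - (\<Sum>i = 1..N m. \<Sum>j = 1..m. c (i, j) * neuron i j x))"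
        by (rule cINF_lower[of _ _ "\<lambda>i j. c (i, j)"]) (auto intro!: bdd_belowI2[of _ 0] simp: norm_L2_def)
      ultimately show ?thesis by (simp add: h_def[abs_def] neuron_def)
    qed
    \<comment> \<open>Below the threshold \<open>M\<close>, where the exponential estimate is not available, zero coefficients do.\<close>
    have goal: "\<exists>c. l2_norm lborel (\<lambda>x. F0 x - (\<Sum>a\<in>A. c a * u a x)) \<le> K * real m powr (- r) * S"
    proof (cases "real m \<ge> M")
      case True
      define \<epsilon> where "\<epsilon> = B * (D * S) * (b powr (- r) + V * K1) * real m powr (- r)"
      have \<epsilon>: "\<epsilon> \<ge> 0" using B D S V K1 by (simp add: \<epsilon>_def)
      obtain c where "l2_norm lborel (\<lambda>x. F0 x - (\<Sum>a\<in>A. c a * u a x)) \<le> \<epsilon>"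
      proof (rule best_approximation_by_duality[of A lborel u F0 \<epsilon>])
        show "finite A" by (simp add: A_def)
        show "square_integrable lborel (u a)" if "a \<in> A" for a by (rule u_sq[OF that])
        show "square_integrable lborel F0" "\<epsilon> \<ge> 0" by (fact F0, fact \<epsilon>)
        fix c g assume g_eq: "g = (\<lambda>x. F0 x - (\<Sum>b\<in>A. c b * u b x))" and g: "square_integrable lborel g"
          and orth: "\<And>b. b \<in> A \<Longrightarrow> (LINT x|lborel. g x * u b x) = 0"
        have supp: "x \<in> \<Omega>" if "g x \<noteq> 0" for x
          using that by (cases "x \<in> \<Omega>") (auto simp: g_eq F0_def u_def split_def)
        have gi: "integrable lborel g" and g1: "(LINT x|lborel. \<bar>g x\<bar>) \<le> V * l2_norm lborel g"
          using bounded_support_L1_le_L2[OF \<Omega>(1,3) g supp] by (simp_all add: V_def)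
        have orth': "(LINT x|lborel. g x * Re (\<sigma> (of_real (\<omega> m j * (\<theta> m i \<bullet> x))))) = 0"
          if "i \<in> {1..N m}" "j \<in> {1..m}" for i j
        proof -
          have "g x * Re (\<sigma> (of_real (\<omega> m j * (\<theta> m i \<bullet> x)))) = g x * u (i, j) x" for x
            using supp[of x] by (cases "g x = 0") (auto simp: u_def neuron_def)
          hence "(LINT x|lborel. g x * Re (\<sigma> (of_real (\<omega> m j * (\<theta> m i \<bullet> x))))) = (LINT x|lborel. g x * u (i, j) x)"
            by (simp only:)
          also have "\<dots> = 0" using that by (intro orth) (simp add: A_def)
          finally show ?thesis .
        qed
        define n1 where "n1 = (LINT x|lborel. \<bar>g x\<bar>)"
        have n1: "0 \<le> n1" "n1 \<le> V * l2_norm lborel g" using g1 by (simp_all add: n1_def)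
        have bm: "b * m > 0" using b m by simp
        have "\<bar>LINT x|lborel. F x * g x\<bar> \<le> B * sobolev_norm r UNIV (E f) *
            ((b * m) powr (- r) * l2_norm lborel g + sqrt ((C * exp (- \<gamma> * m) * n1) * n1 * (b * m) ^ CARD('n)))"
          unfolding n1_def
        proof (rule pairing[OF Ef(1) F(1,2) g gi bm])
          fix \<xi> :: "real^'n" assume "norm \<xi> \<le> CARD('n) * (2 * p * (b * m))"
          hence "norm \<xi> \<le> \<kappa> * m" using b_le[of m] by (rule order_trans)
          thus "norm (LINT x|lborel. of_real (g x) * cis (\<xi> \<bullet> x)) \<le> C * exp (- \<gamma> * m) * (LINT x|lborel. \<bar>g x\<bar>)"
            by (intro fourier[OF True gi supp orth'])
        qed
        also have "\<dots> \<le> B * (D * S) * ((b powr (- r) + V * K1) * real m powr (- r) * l2_norm lborel g)"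
        proof (intro mult_mono)
          have "sqrt ((C * exp (- \<gamma> * m) * n1) * n1 * (b * m) ^ CARD('n)) = sqrt (C * exp (- \<gamma> * m) * (b * m) ^ CARD('n) * n1\<^sup>2)"
            by (simp add: power2_eq_square mult_ac)
          also have "\<dots> = sqrt (C * exp (- \<gamma> * m) * (b * m) ^ CARD('n)) * n1"
            unfolding real_sqrt_mult[of _ "n1\<^sup>2"] using n1(1) by simp
          also have "\<dots> \<le> (K1 * real m powr (- r)) * (V * l2_norm lborel g)"
            using K1 m n1 b \<kappa> by (intro mult_mono) auto
          finally have "sqrt ((C * exp (- \<gamma> * m) * n1) * n1 * (b * m) ^ CARD('n)) \<le> V * K1 * real m powr (- r) * l2_norm lborel g"
            by (simp only: mult_ac)
          moreover have "(b * m) powr (- r) = b powr (- r) * real m powr (- r)"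
            by (rule powr_mult)
          ultimately show "(b * m) powr (- r) * l2_norm lborel g + sqrt ((C * exp (- \<gamma> * m) * n1) * n1 * (b * m) ^ CARD('n))
              \<le> (b powr (- r) + V * K1) * real m powr (- r) * l2_norm lborel g"
            by (simp add: distrib_right)
        next
          have "C * exp (- \<gamma> * m) * n1 * n1 * (b * m) ^ CARD('n) \<ge> 0"
            using \<kappa>(3) n1(1) b by (intro mult_nonneg_nonneg) auto
          thus "0 \<le> (b * m) powr (- r) * l2_norm lborel g + sqrt ((C * exp (- \<gamma> * m) * n1) * n1 * (b * m) ^ CARD('n))"
            by (intro add_nonneg_nonneg mult_nonneg_nonneg) auto
        qed (use Ef B D S sobolev_norm_nonneg in auto)
        also have "\<dots> = \<epsilon> * l2_norm lborel g" by (simp add: \<epsilon>_def)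
        also have "(LINT x|lborel. F x * g x) = (LINT x|lborel. F0 x * g x)"
          using supp by (intro Bochner_Integration.integral_cong) (auto simp: F0_def)
        finally show "\<bar>LINT x|lborel. F0 x * g x\<bar> \<le> \<epsilon> * l2_norm lborel g" .
      qed (rule that)
      moreover have "\<epsilon> \<le> K * real m powr (- r) * S"
      proof -
        have "\<epsilon> = (B * D * (b powr (- r) + V * K1)) * (real m powr (- r) * S)" by (simp add: \<epsilon>_def)
        also have "\<dots> \<le> K * (real m powr (- r) * S)"
          using S D by (intro mult_right_mono) (auto simp: K_def)
        finally show ?thesis by simp
      qed
      ultimately show ?thesis using order_trans by blast
    next
      case False
      have "l2_norm lborel F0 \<le> l2_norm lborel F"
        unfolding l2_norm_def using square_integrable_integrable_power2[OF F0] square_integrable_integrable_power2[OF F(1)]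
        by (intro real_sqrt_le_mono integral_mono) (auto simp: F0_def)
      also have "\<dots> \<le> D * S" using F(3) Ef(2) by simp
      also have "\<dots> \<le> (D * M1 powr r) * (real m powr (- r) * S)"
      proof -
        have "real m powr r \<le> M1 powr r" using False m r by (intro powr_mono2) (auto simp: M1_def)
        hence "1 \<le> M1 powr r * real m powr (- r)" using m by (simp add: powr_minus field_simps)
        hence "D * S * 1 \<le> D * S * (M1 powr r * real m powr (- r))" using D S by (intro mult_left_mono) auto
        thus ?thesis by (simp add: mult_ac)
      qed
      also have "\<dots> \<le> K * (real m powr (- r) * S)"
        using S B D V K1(1) by (intro mult_right_mono) (auto simp: K_def)
      finally show ?thesis by (intro exI[of _ "\<lambda>a. 0"]) simp
    qed
    have "real (m ^ CARD('n)) powr (- r / real CARD('n)) = real m powr (- r)"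
    proof -
      have "real (m ^ CARD('n)) = real m powr real CARD('n)" using m by (simp add: powr_realpow)
      thus ?thesis using d by (simp add: powr_powr)
    qed
    moreover obtain c where "l2_norm lborel (\<lambda>x. F0 x - (\<Sum>a\<in>A. c a * u a x)) \<le> K * real m powr (- r) * S"
      using goal by blast
    ultimately show "(INF a :: nat \<Rightarrow> nat \<Rightarrow> real.
        norm_L2 \<Omega> (\<lambda>x. f x - (\<Sum>i = 1..N m. \<Sum>j = 1..m. a i j * Re (\<sigma> (complex_of_real (\<omega> m j * (\<theta> m i \<bullet> x)))))))
      \<le> K * real (m ^ CARD('n)) powr (- r / real CARD('n)) * sobolev_norm r \<Omega> f"
      using order_trans[OF INF_le] by (simp only: S_def)
  qed
qed

end
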